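(* Let $\Omega\subset\mathbb{R}$ be a bounded open interval, let $d\in C^0(\overline{\Omega})$ be nonnegative with $d\in C^1(\{d>0\})$ and $\int_\Omega\frac1d<\infty$, let $g\in C^2([0,\infty))$ satisfy $g(0)=0$ and $\underline{\gamma}\le g'\le\overline{\gamma}$ on $[0,\infty)$ with constants $\underline\gamma,\overline\gamma>0$, and let $0\le u_0\in C^0(\overline\Omega)$, $u_0\not\equiv0$, and $0\le w_0\in C^0(\overline\Omega)$ with $\sqrt{w_0}\in W^{1,2}(\Omega)$ and $\int_\Omega\frac{d_x^2}{d}w_0<\infty$. Assume in addition that $$\int_\Omega\frac1d\ln\frac1d<\infty\qquad\text{and}\qquad\frac{w_0}{d}\in L^\infty(\Omega).$$ Let $(u,w)$ be the constructed solution (as defined in the context) of $$u_t=(d(x)u)_{xx}-(d(x)uw_x)_x,\qquad w_t=-ug(w)\qquad(x\in\Omega,\ t>0),$$ with no-flux boundary condition $(d(x)u)_x-d(x)uw_x=0$ on $\partial\Omega$ and initial data $(u_0,w_0)$. Then $$\int_\tau^T\big\|\ln\big(du(\cdot,t)\big)\big\|_{L^\infty(\Omega)}^3\,dt<\infty\qquad\text{for all }T>0\text{ and }\tau\in(0,T).$$ In particular, for a.e. $t>0$ there exist $C_1(t)>0$ and $C_2(t)>0$ such that $$\frac{C_1(t)}{d(x)}\le u(x,t)\le\frac{C_2(t)}{d(x)}\qquad\text{for a.e. }x\in\Omega,$$ and if $\frac1d\notin L^\infty(\Omega)$, then $\|u(\cdot,t)\|_{L^\infty(\Omega)}=\infty$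 for a.e. $t>0$.
   Context: Notation: $\{d>0\}:=\{x\in\overline\Omega:d(x)>0\}$ (of full measure because $\int_\Omega\frac1d<\infty$; integrals involving $d_x$ are over this set). $C^0_w([0,\infty);L^1(\Omega))$: functions $[0,\infty)\to L^1(\Omega)$ continuous for the weak topology. For a function $w\ge0$ with $\sqrt w\in W^{1,2}(\Omega)$, $\frac{w_x^2}{w}$ means $4((\sqrt w)_x)^2$. Approximating data. $(d_\varepsilon)_{\varepsilon\in(0,1)}\subset C^\infty(\overline\Omega)$ is a family such that, as $\varepsilon\searrow0$, $d_\varepsilon\to d$ in $L^\infty(\Omega)$ and $d_{\varepsilon x}\to d_x$ in $L^\infty_{loc}(\{d>0\}\cap\Omega)$ and in $L^p_{loc}(\{d>0\})$ for all $p\in[1,\infty)$; $d_\varepsilon\le d_{\varepsilon'}$ for $0<\varepsilon\le\varepsilon'<1$ (hence $d_\varepsilon\ge d$); and for all $\varepsilon\in(0,1)$: $d_\varepsilon>0$ in $\overline\Omega$, $d_{\varepsilon x}=0$ on $\partial\Omega$, $d_\varepsilon\le\|d\|_{L^\infty(\Omega)}+1$, $\varepsilon^2\int_\Omega\frac{d_{\varepsilon x}^2}{d_\varepsilon^3}\le1$, $\sqrt\varepsilon\int_\Omega\frac{d_{\varepsilon x}^4}{d_\varepsilon^2}\le1$, $\varepsilon^{1/4}\frac1{\inf_\Omega d_\varepsilon}\le1$, $\varepsilon^{1/4}\|\frac{d_{\varepsilon x}}{d_\varepsilon}\|_{L^\infty(\Omega)}\le1$. $(w_{0j})_{j\in\mathbb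 N}\subset L^\infty(\Omega)$ is a sequence of nonnegative functions with $\sqrt{w_{0j}}\in W^{1,2}(\Omega)$, $\operatorname{supp}w_{0j}\subset\{d>0\}$, $w_{0j}\nearrow w_0$ in $\Omega$ as $j\to\infty$, and $\sup_j\int_\Omega d\frac{w_{0jx}^2}{w_{0j}}<\infty$. $(\varepsilon_j)_{j\in\mathbb N}\subset(0,1)$ is a sequence decreasing to $0$ such that $w_{0\varepsilon}:=w_{0j}+\varepsilon^{1/4}$ for $\varepsilon=\varepsilon_j$ satisfies $\sup_{\varepsilon\in(\varepsilon_j)}\int_\Omega d_\varepsilon\frac{w_{0\varepsilon x}^2}{w_{0\varepsilon}}<\infty$ and $\sup_{\varepsilon\in(\varepsilon_j)}\int_\Omega\frac{d_{\varepsilon x}^2}{d_\varepsilon}w_{0\varepsilon}<\infty$. Regularized problems. For $\varepsilon\in(\varepsilon_j)_{j\in\mathbb N}$, $(u_\varepsilon,w_\varepsilon)$ is the global classical solution of $$u_{\varepsilon t}=(d_\varepsilon u_\varepsilon)_{xx}-(d_\varepsilon u_\varepsilon w_{\varepsilon x})_x,\qquad w_{\varepsilon t}=\varepsilon\Big(d_\varepsilon\frac{w_{\varepsilon x}}{\sqrt{g(w_\varepsilon)}}\Big)_x-u_\varepsilon g(w_\varepsilon)\qquad(x\in\Omega,\ t>0),$$ $u_{\varepsilon x}=w_{\varepsilon x}=0$ on $\partial\Omega$, $u_\varepsilon(\cdot,0)=u_0$, $w_\varepsilon(\cdot,0)=w_{0\varepsilon}$, with $u_\varepsilon\in C^0(\overline\Omega\times[0,\infty))\cap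 C^{2,1}(\overline\Omega\times(0,\infty))$, $w_\varepsilon\in C^0([0,\infty);W^{1,2}(\Omega))\cap C^{2,1}(\overline\Omega\times(0,\infty))$, $u_\varepsilon>0$ in $\overline\Omega\times(0,\infty)$ and $w_\varepsilon>0$ in $\overline\Omega\times[0,\infty)$. Constructed solution. This is a pair $(u,w)$ of nonnegative functions, $u\in C^0_w([0,\infty);L^1(\Omega))\cap L^\infty((0,\infty);L^1(\Omega))\cap C^0([0,\infty);(W^{1,\infty}(\Omega))^\star)$, $w\in C^0(\overline\Omega\times[0,\infty))\cap L^\infty(\Omega\times(0,\infty))\cap L^1_{loc}([0,\infty);W^{1,1}(\Omega))$, obtained as limit along a subsequence $\varepsilon=\varepsilon_{j_k}\searrow0$ of $(\varepsilon_j)$ in the sense that $u_\varepsilon\to u$ a.e. in $\Omega\times(0,\infty)$, in $L^1_{loc}(\overline\Omega\times[0,\infty))$ and in $C^0_{loc}([0,\infty);(W^{1,\infty}(\Omega))^\star)$, $w_\varepsilon\to w$ in $C^0_{loc}(\overline\Omega\times[0,\infty))$, $w_{\varepsilon x}\rightharpoonup w_x$ in $L^1_{loc}(\overline\Omega\times[0,\infty))$ and $\sqrt{d_\varepsilon}w_{\varepsilon x}\rightharpoonup\sqrt d\,w_x$ in $L^2_{loc}(\overline\Omega\times[0,\infty))$. Such data, solutions and limits exist under the stated hypotheses, and $(u,w)$ is then a global weak solution of the limit problem. *)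

theory Defs
  imports "HOL-Analysis.Analysis" "HOL-Probability.Essential_Supremum"
begin

text \<open>
  The interval \<open>\<Omega>\<close> is \<open>{a<..<b}\<close>. Functions on \<open>\<Omega>\<close> or on its closure are total functions on
  the reals of which only the values on \<open>\<Omega>\<close> (respectively \<open>{a..b}\<close>) are ever used; functions of
  space and time take the space variable first. All measure theory is with respect to \<open>lebesgue\<close>,
  so that elements of Lebesgue and Sobolev spaces are represented by Lebesgue measurable functions.
\<close>

section \<open>Classical derivatives\<close>

text \<open>The derivative relative to \<open>S\<close>; at an end point of an interval it is one-sided.\<close>

definition der_on :: "real set \<Rightarrow> (real \<Rightarrow> real) \<Rightarrow> real \<Rightarrow> real"
  where "der_on S f x = vector_derivative f (at x within S)"

definition Ck_on :: "nat \<Rightarrow> real set \<Rightarrow> (real \<Rightarrow> real) \<Rightarrow> bool"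
  where "Ck_on k S f \<longleftrightarrow> (\<exists>D :: nat \<Rightarrow> real \<Rightarrow> real. D 0 = f
    \<and> (\<forall>i<k. \<forall>x\<in>S. (D i has_real_derivative D (Suc i) x) (at x within S))
    \<and> (\<forall>i\<le>k. continuous_on S (D i)))"

definition smooth_on :: "real set \<Rightarrow> (real \<Rightarrow> real) \<Rightarrow> bool"
  where "smooth_on S f \<longleftrightarrow> (\<forall>k. Ck_on k S f)"

text \<open>\<open>C\<^sup>2\<^sup>,\<^sup>1([a,b] \<times> (0,\<infinity>))\<close>: two derivatives in space, one in time.\<close>

definition C21 :: "real \<Rightarrow> real \<Rightarrow> (real \<Rightarrow> real \<Rightarrow> real) \<Rightarrow> bool"
  where "C21 a b f \<longleftrightarrow> (\<exists>fx fxx ft :: real \<Rightarrow> real \<Rightarrow> real.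
    (\<forall>x\<in>{a..b}. \<forall>t>0.
        ((\<lambda>y. f y t) has_real_derivative fx x t) (at x within {a..b})
      \<and> ((\<lambda>y. fx y t) has_real_derivative fxx x t) (at x within {a..b})
      \<and> ((\<lambda>s. f x s) has_real_derivative ft x t) (at t))
    \<and> (\<forall>h\<in>{f, fx, fxx, ft}. continuous_on ({a..b} \<times> {0<..}) (\<lambda>(x, t). h x t)))"

section \<open>Lebesgue and Sobolev spaces\<close>

definition Linf_norm :: "'a::euclidean_space set \<Rightarrow> ('a \<Rightarrow> real) \<Rightarrow> ennreal"
  where "Linf_norm S f = esssup (restrict_space lebesgue S) (\<lambda>x. ennreal \<bar>f x\<bar>)"

definition Linf_on :: "'a::euclidean_space set \<Rightarrow> ('a \<Rightarrow> real) \<Rightarrow> bool"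
  where "Linf_on S f \<longleftrightarrow> set_borel_measurable lebesgue S f \<and> Linf_norm S f < \<infinity>"

definition Lp_on :: "real \<Rightarrow> 'a::euclidean_space set \<Rightarrow> ('a \<Rightarrow> real) \<Rightarrow> bool"
  where "Lp_on p S f \<longleftrightarrow> set_borel_measurable lebesgue S f
    \<and> set_integrable lebesgue S (\<lambda>x. \<bar>f x\<bar> powr p)"

definition test_function :: "real set \<Rightarrow> (real \<Rightarrow> real) \<Rightarrow> bool"
  where "test_function S \<phi> \<longleftrightarrow> smooth_on UNIV \<phi>
    \<and> compact (closure {x. \<phi> x \<noteq> 0}) \<and> closure {x. \<phi> x \<noteq> 0} \<subseteq> S"

definition has_weak_deriv :: "real set \<Rightarrow> (real \<Rightarrow> real) \<Rightarrow> (real \<Rightarrow> real) \<Rightarrow> bool"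
  where "has_weak_deriv S f h \<longleftrightarrow>
      (\<forall>K. compact K \<and> K \<subseteq> S \<longrightarrow> set_integrable lebesgue K f \<and> set_integrable lebesgue K h)
    \<and> (\<forall>\<phi>. test_function S \<phi> \<longrightarrow>
        (LINT x:S|lebesgue. f x * deriv \<phi> x) = - (LINT x:S|lebesgue. h x * \<phi> x))"

text \<open>A representative of the weak derivative, which is unique up to null sets if it exists.\<close>

definition weak_deriv :: "real set \<Rightarrow> (real \<Rightarrow> real) \<Rightarrow> real \<Rightarrow> real"
  where "weak_deriv S f = (SOME h. has_weak_deriv S f h)"

definition W1p_on :: "real \<Rightarrow> real set \<Rightarrow> (real \<Rightarrow> real) \<Rightarrow> bool"
  where "W1p_on p S f \<longleftrightarrow> Lp_on p S f \<and> (\<exists>h. has_weak_deriv S f h \<and> Lp_on p S h)"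

text \<open>
  For \<open>w \<ge> 0\<close> with \<open>\<surd>w\<close> weakly differentiable, \<open>w\<^sub>x\<^sup>2 / w\<close> is understood as
  \<open>4 ((\<surd>w)\<^sub>x)\<^sup>2\<close>.
\<close>

definition grad_sq_over :: "real set \<Rightarrow> (real \<Rightarrow> real) \<Rightarrow> real \<Rightarrow> real"
  where "grad_sq_over S w x = 4 * (weak_deriv S (\<lambda>y. sqrt (w y)) x)\<^sup>2"

text \<open>
  The norm in the dual of \<open>W\<^sup>1\<^sup>,\<^sup>\<infinity>(S)\<close> of the functional \<open>\<phi> \<mapsto> \<integral> f \<phi>\<close>, where
  \<open>W\<^sup>1\<^sup>,\<^sup>\<infinity>(S)\<close> carries the maximum of the sup norms of \<open>\<phi>\<close> and \<open>\<phi>\<^sub>x\<close>.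
\<close>

definition W1inf_dual_norm :: "real set \<Rightarrow> (real \<Rightarrow> real) \<Rightarrow> ennreal"
  where "W1inf_dual_norm S f =
    (SUP \<phi> \<in> {\<phi>. Linf_on S \<phi> \<and> Linf_norm S \<phi> \<le> 1
                \<and> (\<exists>h. has_weak_deriv S \<phi> h \<and> Linf_on S h \<and> Linf_norm S h \<le> 1)}.
       ennreal \<bar>LINT x:S|lebesgue. f x * \<phi> x\<bar>)"

text \<open>
  Weak convergence in a Lebesgue space: \<open>X\<close> is membership in that space and \<open>Y\<close> membership in
  its dual space.
\<close>

definition weakly_converges ::
    "'a::euclidean_space set \<Rightarrow> (('a \<Rightarrow> real) \<Rightarrow> bool) \<Rightarrow> (('a \<Rightarrow> real) \<Rightarrow> bool)
      \<Rightarrow> (nat \<Rightarrow> 'a \<Rightarrow> real) \<Rightarrow> ('a \<Rightarrow> real) \<Rightarrow> bool"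
  where "weakly_converges S X Y F f \<longleftrightarrow> (\<forall>k. X (F k)) \<and> X f
    \<and> (\<forall>\<phi>. Y \<phi> \<longrightarrow>
        (\<lambda>k. LINT z:S|lebesgue. F k z * \<phi> z) \<longlonglongrightarrow> (LINT z:S|lebesgue. f z * \<phi> z))"

section \<open>The approximating data\<close>

definition pos_set :: "real \<Rightarrow> real \<Rightarrow> (real \<Rightarrow> real) \<Rightarrow> real set"
  where "pos_set a b d = {x \<in> {a..b}. d x > 0}"

definition approx_diffusion ::
    "real \<Rightarrow> real \<Rightarrow> (real \<Rightarrow> real) \<Rightarrow> (real \<Rightarrow> real \<Rightarrow> real) \<Rightarrow> bool"
  where "approx_diffusion a b d dE \<longleftrightarrow>
    (\<forall>\<epsilon>\<in>{0<..<1}. smooth_on {a..b} (dE \<epsilon>))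
  \<and> ((\<lambda>\<epsilon>. Linf_norm {a<..<b} (\<lambda>x. dE \<epsilon> x - d x)) \<longlongrightarrow> 0) (at_right 0)
  \<and> (\<forall>K. compact K \<and> K \<subseteq> pos_set a b d \<inter> {a<..<b} \<longrightarrow>
      ((\<lambda>\<epsilon>. Linf_norm K (\<lambda>x. der_on {a..b} (dE \<epsilon>) x - der_on {a..b} d x)) \<longlongrightarrow> 0) (at_right 0))
  \<and> (\<forall>K. \<forall>p\<ge>1. compact K \<and> K \<subseteq> pos_set a b d \<longrightarrow>
      ((\<lambda>\<epsilon>. \<integral>\<^sup>+x\<in>K. ennreal (\<bar>der_on {a..b} (dE \<epsilon>) x - der_on {a..b} d x\<bar> powr p) \<partial>lebesgue)
        \<longlongrightarrow> 0) (at_right 0))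
  \<and> (\<forall>\<epsilon> \<epsilon>'. 0 < \<epsilon> \<and> \<epsilon> \<le> \<epsilon>' \<and> \<epsilon>' < 1 \<longrightarrow> (\<forall>x\<in>{a..b}. dE \<epsilon> x \<le> dE \<epsilon>' x))
  \<and> (\<forall>\<epsilon>\<in>{0<..<1}.
        (\<forall>x\<in>{a..b}. dE \<epsilon> x > 0)
      \<and> (\<forall>x\<in>{a, b}. der_on {a..b} (dE \<epsilon>) x = 0)
      \<and> (\<forall>x\<in>{a..b}. ennreal (dE \<epsilon> x) \<le> Linf_norm {a<..<b} d + 1)
      \<and> ennreal (\<epsilon>\<^sup>2) *
          (\<integral>\<^sup>+x\<in>{a<..<b}. ennreal ((der_on {a..b} (dE \<epsilon>) x)\<^sup>2 / dE \<epsilon> x ^ 3) \<partial>lebesgue) \<le> 1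
      \<and> ennreal (sqrt \<epsilon>) *
          (\<integral>\<^sup>+x\<in>{a<..<b}. ennreal (der_on {a..b} (dE \<epsilon>) x ^ 4 / (dE \<epsilon> x)\<^sup>2) \<partial>lebesgue) \<le> 1
      \<and> \<epsilon> powr (1/4) * (1 / (INF x\<in>{a<..<b}. dE \<epsilon> x)) \<le> 1
      \<and> ennreal (\<epsilon> powr (1/4)) *
          Linf_norm {a<..<b} (\<lambda>x. der_on {a..b} (dE \<epsilon>) x / dE \<epsilon> x) \<le> 1)"

text \<open>
  The functions \<open>w\<^sub>0\<^sub>j\<close> are represented by their continuous representatives, which exist because
  \<open>\<surd>w\<^sub>0\<^sub>j \<in> W\<^sup>1\<^sup>,\<^sup>2\<close>; this makes their supports and their pointwise limit meaningful.
\<close>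

definition approx_w0 ::
    "real \<Rightarrow> real \<Rightarrow> (real \<Rightarrow> real) \<Rightarrow> (real \<Rightarrow> real) \<Rightarrow> (nat \<Rightarrow> real \<Rightarrow> real) \<Rightarrow> bool"
  where "approx_w0 a b d w0 w0J \<longleftrightarrow>
    (\<forall>j. continuous_on {a..b} (w0J j) \<and> Linf_on {a<..<b} (w0J j)
      \<and> (\<forall>x\<in>{a..b}. w0J j x \<ge> 0)
      \<and> W1p_on 2 {a<..<b} (\<lambda>x. sqrt (w0J j x))
      \<and> closure {x\<in>{a..b}. w0J j x \<noteq> 0} \<subseteq> pos_set a b d)
  \<and> (\<forall>x\<in>{a<..<b}. incseq (\<lambda>j. w0J j x) \<and> (\<lambda>j. w0J j x) \<longlonglongrightarrow> w0 x)
  \<and> (SUP j. \<integral>\<^sup>+x\<in>{a<..<b}. ennreal (d x * grad_sq_over {a<..<b} (w0J j) x) \<partial>lebesgue) < \<infinity>"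

definition w0_reg :: "(nat \<Rightarrow> real \<Rightarrow> real) \<Rightarrow> (nat \<Rightarrow> real) \<Rightarrow> nat \<Rightarrow> real \<Rightarrow> real"
  where "w0_reg w0J eps j x = w0J j x + eps j powr (1/4)"

definition approx_eps ::
    "real \<Rightarrow> real \<Rightarrow> (real \<Rightarrow> real \<Rightarrow> real) \<Rightarrow> (nat \<Rightarrow> real \<Rightarrow> real) \<Rightarrow> (nat \<Rightarrow> real) \<Rightarrow> bool"
  where "approx_eps a b dE w0J eps \<longleftrightarrow>
    (\<forall>j. eps j \<in> {0<..<1}) \<and> decseq eps \<and> eps \<longlonglongrightarrow> 0
  \<and> (SUP j. \<integral>\<^sup>+x\<in>{a<..<b}.
        ennreal (dE (eps j) x * grad_sq_over {a<..<b} (w0_reg w0J eps j) x) \<partial>lebesgue) < \<infinity>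
  \<and> (SUP j. \<integral>\<^sup>+x\<in>{a<..<b}.
        ennreal ((der_on {a..b} (dE (eps j)) x)\<^sup>2 / dE (eps j) x * w0_reg w0J eps j x) \<partial>lebesgue) < \<infinity>"

section \<open>The regularized problems\<close>

definition C0_W12 :: "real \<Rightarrow> real \<Rightarrow> (real \<Rightarrow> real \<Rightarrow> real) \<Rightarrow> bool"
  where "C0_W12 a b f \<longleftrightarrow>
    (\<forall>t\<ge>0. W1p_on 2 {a<..<b} (\<lambda>x. f x t))
  \<and> (\<forall>s\<ge>0. ((\<lambda>t. \<integral>\<^sup>+x\<in>{a<..<b}. ennreal ((f x t - f x s)\<^sup>2
        + (weak_deriv {a<..<b} (\<lambda>y. f y t) x - weak_deriv {a<..<b} (\<lambda>y. f y s) x)\<^sup>2) \<partial>lebesgue)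
      \<longlongrightarrow> 0) (at s within {0..}))"

definition reg_solution ::
    "real \<Rightarrow> real \<Rightarrow> (real \<Rightarrow> real) \<Rightarrow> (real \<Rightarrow> real) \<Rightarrow> real \<Rightarrow> (real \<Rightarrow> real) \<Rightarrow> (real \<Rightarrow> real)
      \<Rightarrow> (real \<Rightarrow> real \<Rightarrow> real) \<Rightarrow> (real \<Rightarrow> real \<Rightarrow> real) \<Rightarrow> bool"
  where "reg_solution a b d\<^sub>\<epsilon> g \<epsilon> u0 w0\<^sub>\<epsilon> u w \<longleftrightarrow>
    continuous_on ({a..b} \<times> {0..}) (\<lambda>(x, t). u x t) \<and> C21 a b u
  \<and> C0_W12 a b w \<and> C21 a b w
  \<and> (\<forall>x\<in>{a..b}. \<forall>t>0. u x t > 0) \<and> (\<forall>x\<in>{a..b}. \<forall>t\<ge>0. w x t > 0)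
  \<and> (\<forall>x\<in>{a<..<b}. \<forall>t>0.
        deriv (\<lambda>s. u x s) t
          = der_on {a..b} (der_on {a..b} (\<lambda>y. d\<^sub>\<epsilon> y * u y t)) x
            - der_on {a..b} (\<lambda>y. d\<^sub>\<epsilon> y * u y t * der_on {a..b} (\<lambda>z. w z t) y) x
      \<and> deriv (\<lambda>s. w x s) t
          = \<epsilon> * der_on {a..b} (\<lambda>y. d\<^sub>\<epsilon> y * (der_on {a..b} (\<lambda>z. w z t) y / sqrt (g (w y t)))) x
            - u x t * g (w x t))
  \<and> (\<forall>x\<in>{a, b}. \<forall>t>0. der_on {a..b} (\<lambda>y. u y t) x = 0 \<and> der_on {a..b} (\<lambda>y. w y t) x = 0)
  \<and> (\<forall>x\<in>{a..b}. u x 0 = u0 x \<and> w x 0 = w0\<^sub>\<epsilon> x)"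

section \<open>The constructed solution\<close>

text \<open>
  The spaces for \<open>u\<close>: weak continuity with values in \<open>L\<^sup>1(\<Omega>)\<close>, boundedness in \<open>L\<^sup>1(\<Omega>)\<close>, and
  norm continuity with values in the dual of \<open>W\<^sup>1\<^sup>,\<^sup>\<infinity>(\<Omega>)\<close>.
\<close>

definition u_regularity :: "real \<Rightarrow> real \<Rightarrow> (real \<Rightarrow> real \<Rightarrow> real) \<Rightarrow> bool"
  where "u_regularity a b u \<longleftrightarrow>
    (\<forall>t\<ge>0. set_integrable lebesgue {a<..<b} (\<lambda>x. u x t))
  \<and> (\<forall>\<phi>. Linf_on {a<..<b} \<phi> \<longrightarrow>
        continuous_on {0..} (\<lambda>t. LINT x:{a<..<b}|lebesgue. u x t * \<phi> x))
  \<and> (\<exists>C. AE t in lebesgue. t > 0 \<longrightarrow> (LINT x:{a<..<b}|lebesgue. \<bar>u x t\<bar>) \<le> C)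
  \<and> (\<forall>s\<ge>0. ((\<lambda>t. W1inf_dual_norm {a<..<b} (\<lambda>x. u x t - u x s)) \<longlongrightarrow> 0) (at s within {0..}))"

text \<open>
  The spaces for \<open>w\<close>, where \<open>wx\<close> is the weak derivative of \<open>w\<close> in space. Membership in
  \<open>L\<^sup>1\<^sub>l\<^sub>o\<^sub>c([0,\<infinity>); W\<^sup>1\<^sup>,\<^sup>1(\<Omega>))\<close> is expressed by joint integrability of \<open>w\<close> and \<open>wx\<close> on
  \<open>\<Omega> \<times> (0,T)\<close> for each \<open>T\<close>.
\<close>

definition w_regularity ::
    "real \<Rightarrow> real \<Rightarrow> (real \<Rightarrow> real \<Rightarrow> real) \<Rightarrow> (real \<Rightarrow> real \<Rightarrow> real) \<Rightarrow> bool"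
  where "w_regularity a b w wx \<longleftrightarrow>
    continuous_on ({a..b} \<times> {0..}) (\<lambda>(x, t). w x t)
  \<and> Linf_on ({a<..<b} \<times> {0<..}) (\<lambda>(x, t). w x t)
  \<and> (\<forall>T>0. set_integrable lebesgue ({a<..<b} \<times> {0<..<T}) (\<lambda>(x, t). w x t)
          \<and> set_integrable lebesgue ({a<..<b} \<times> {0<..<T}) (\<lambda>(x, t). wx x t))
  \<and> (AE t in lebesgue. t > 0 \<longrightarrow> W1p_on 1 {a<..<b} (\<lambda>x. w x t)
          \<and> has_weak_deriv {a<..<b} (\<lambda>x. w x t) (\<lambda>x. wx x t))"

text \<open>
  The solution \<open>(uE j, wE j)\<close> belongs to the parameter \<open>eps j\<close>; the limit is taken along the
  subsequence given by \<open>r\<close>.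
\<close>

definition constructed_solution ::
    "real \<Rightarrow> real \<Rightarrow> (real \<Rightarrow> real) \<Rightarrow> (real \<Rightarrow> real) \<Rightarrow> (real \<Rightarrow> real) \<Rightarrow> (real \<Rightarrow> real)
      \<Rightarrow> (real \<Rightarrow> real \<Rightarrow> real) \<Rightarrow> (real \<Rightarrow> real \<Rightarrow> real) \<Rightarrow> bool"
  where "constructed_solution a b d g u0 w0 u w \<longleftrightarrow>
    (\<exists>dE w0J eps uE wE r wx.
        approx_diffusion a b d dE
      \<and> approx_w0 a b d w0 w0J
      \<and> approx_eps a b dE w0J eps
      \<and> (\<forall>j. reg_solution a b (dE (eps j)) g (eps j) u0 (w0_reg w0J eps j) (uE j) (wE j))
      \<and> u_regularity a b u \<and> w_regularity a b w wx
      \<and> (\<forall>t\<ge>0. AE x in lebesgue. x \<in> {a<..<b} \<longrightarrow> u x t \<ge> 0)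
      \<and> (\<forall>x\<in>{a..b}. \<forall>t\<ge>0. w x t \<ge> 0)
      \<and> strict_mono r
      \<and> (AE z in lebesgue. z \<in> {a<..<b} \<times> {0<..} \<longrightarrow>
            (\<lambda>k. uE (r k) (fst z) (snd z)) \<longlonglongrightarrow> u (fst z) (snd z))
      \<and> (\<forall>T>0. set_integrable lebesgue ({a<..<b} \<times> {0<..<T}) (\<lambda>(x, t). u x t)
            \<and> (\<lambda>k. \<integral>\<^sup>+z\<in>{a<..<b} \<times> {0<..<T}.
                  ennreal \<bar>uE (r k) (fst z) (snd z) - u (fst z) (snd z)\<bar> \<partial>lebesgue) \<longlonglongrightarrow> 0)
      \<and> (\<forall>T>0. (\<lambda>k. SUP t\<in>{0..T}. W1inf_dual_norm {a<..<b} (\<lambda>x. uE (r k) x t - u x t))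
            \<longlonglongrightarrow> 0)
      \<and> (\<forall>T>0. uniform_limit ({a..b} \<times> {0..T})
            (\<lambda>k (x, t). wE (r k) x t) (\<lambda>(x, t). w x t) sequentially)
      \<and> (\<forall>T>0. let Q = {a<..<b} \<times> {0<..<T} in
            weakly_converges Q (Lp_on 1 Q) (Linf_on Q)
              (\<lambda>k (x, t). der_on {a..b} (\<lambda>y. wE (r k) y t) x) (\<lambda>(x, t). wx x t)
          \<and> weakly_converges Q (Lp_on 2 Q) (Lp_on 2 Q)
              (\<lambda>k (x, t). sqrt (dE (eps (r k)) x) * der_on {a..b} (\<lambda>y. wE (r k) y t) x)
              (\<lambda>(x, t). sqrt (d x) * wx x t)))"

text \<open>
  \<open>\<bar>ln s\<bar>\<close> for \<open>s \<ge> 0\<close> with \<open>\<bar>ln 0\<bar> = \<infinity>\<close>; the library's \<open>ln\<close> on the reals has \<open>ln 0 = 0\<close>.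
\<close>

definition abs_ln :: "real \<Rightarrow> ennreal"
  where "abs_ln s = (if s > 0 then ennreal \<bar>ln s\<bar> else \<infinity>)"

definition ln_Linf_norm :: "real set \<Rightarrow> (real \<Rightarrow> real) \<Rightarrow> ennreal"
  where "ln_Linf_norm S f = esssup (restrict_space lebesgue S) (\<lambda>x. abs_ln (f x))"

end

theory Submission
  imports Defs
begin

text \<open>
  Put \<open>v = d u\<close>. At the level of the regularized problems the equation for \<open>u\<close> reads
  \<open>v\<^sub>t / d = (v\<^sub>x - v w\<^sub>x)\<^sub>x\<close>, and testing it with \<open>1 / v\<close> gives
  \<open>y' = \<integral> (ln v)\<^sub>x\<^sup>2 - \<integral> (ln v)\<^sub>x w\<^sub>x\<close> for \<open>y = \<integral> (ln v) / d\<close>. The weight \<open>1 / d\<close> has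
  removed the degenerate factor, so that a bound \<open>K\<close> on \<open>\<integral> w\<^sub>x\<^sup>2\<close> implies
  \<open>y' \<ge> 1/2 \<integral> (ln v)\<^sub>x\<^sup>2 - K/2\<close>. The mass \<open>m = \<integral> u = \<integral> v / d\<close> is conserved, hence \<open>v\<close> is
  somewhere at least \<open>m / \<integral> 1/d\<close>, and a very negative \<open>y\<close> forces \<open>\<integral> (ln v)\<^sub>x\<^sup>2\<close> to be at least a
  multiple of \<open>y\<^sup>2\<close>. This Riccati inequality bounds \<open>y\<close> from below at every time after \<open>\<tau>\<close>,
  whatever the initial data are (\<open>riccati_lower_bound\<close>). As \<open>y \<le> m\<close>, integration in time
  bounds \<open>\<integral>\<integral> (ln v)\<^sub>x\<^sup>2\<close> over \<open>(\<tau>, T)\<close> (\<open>log_estimate\<close>), and the interpolation inequality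
  \<open>\<parallel>f\<parallel>\<^sub>\<infinity>\<^sup>3 \<le> C \<parallel>f\<parallel>\<^sub>1 \<parallel>f\<^sub>x\<parallel>\<^sub>2\<^sup>2 + C \<parallel>f\<parallel>\<^sub>1\<^sup>3\<close> for \<open>f = ln v\<close> produces the exponent three
  (\<open>cube_le_gradient_mass\<close>).

  The bound on \<open>\<integral> w\<^sub>x\<^sup>2\<close> has two sources. The energy
  \<open>\<integral> u ln (d u) + 1/2 \<integral> d w\<^sub>x\<^sup>2 / g(w) + 1/\<gamma>\<^sub>1 \<integral> (d\<^sub>x\<^sup>2 / d) w\<close> grows at most linearly in time
  (\<open>energy_deriv_le\<close>), which controls \<open>\<integral> d w\<^sub>x\<^sup>2 / g(w)\<close>. If moreover \<open>w \<le> M d\<close>, then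
  \<open>g(w) \<le> \<gamma>\<^sub>2 M d\<close> and the weight drops out (\<open>nutrient_gradient_le\<close>). For the limit
  problem the bound \<open>w \<le> M d\<close> is inherited from \<open>w\<^sub>0\<close>, because \<open>w\<close> decreases in time; the
  regularized equation contains the additional term \<open>\<epsilon> (d\<^sub>\<epsilon> w\<^sub>x / \<surd>g(w))\<^sub>x\<close>, and there
  \<open>w / d\<^sub>\<epsilon>\<close> is bounded independently of \<open>\<epsilon>\<close> through the integrals of its powers with exponents
  up to \<open>1 / \<surd>\<epsilon>\<close>, combined with a rough Hoelder bound (\<open>ratio_power_le\<close>, \<open>ratio_le\<close>).

  No constant depends on \<open>\<epsilon>\<close>. The energy at \<open>t = 0\<close> is reached through the continuity
  of \<open>w\<^sub>\<epsilon>\<close> with values in \<open>W\<^sup>1\<^sup>,\<^sup>2\<close> (\<open>initial_gradient_energy\<close>). For \<open>\<epsilon> \<down> 0\<close> the norm of the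
  logarithm is lower semicontinuous, and Fatou's lemma carries the bound over to \<open>u\<close>
  (\<open>ln_Linf_norm_cube_integral\<close>). Finiteness of \<open>\<parallel>ln (d u(\<cdot>, t))\<parallel>\<^sub>\<infinity>\<close> for almost every \<open>t\<close> is the
  two-sided estimate of \<open>u\<close> by multiples of \<open>1 / d\<close>, and the lower one makes \<open>u(\<cdot>, t)\<close>
  unbounded when \<open>1 / d\<close> is.
\<close>

section \<open>Calculus on a compact interval\<close>

lemma integral_nonneg_cont:
  fixes f :: "real \<Rightarrow> real"
  assumes "continuous_on {a..b} f" "\<And>x. x \<in> {a..b} \<Longrightarrow> 0 \<le> f x"
  shows "0 \<le> integral {a..b} f"
  using assms by (intro integral_nonneg integrable_continuous_real) auto

lemma integral_mono_cont:
  fixes f h :: "real \<Rightarrow> real"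
  assumes "continuous_on {a..b} f" "continuous_on {a..b} h"
    "\<And>x. x \<in> {a..b} \<Longrightarrow> f x \<le> h x"
  shows "integral {a..b} f \<le> integral {a..b} h"
  using assms by (intro integral_le integrable_continuous_real) auto

lemma ibp_vanishing_flux:
  fixes f f' h h' :: "real \<Rightarrow> real"
  assumes ab: "a \<le> b"
    and f: "\<And>x. x \<in> {a..b} \<Longrightarrow> (f has_real_derivative f' x) (at x within {a..b})"
    and h: "\<And>x. x \<in> {a..b} \<Longrightarrow> (h has_real_derivative h' x) (at x within {a..b})"
    and cf: "continuous_on {a..b} f'" and ch: "continuous_on {a..b} h'"
    and h0: "h a = 0" "h b = 0"
  shows "integral {a..b} (\<lambda>x. f x * h' x) = - integral {a..b} (\<lambda>x. f' x * h x)"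
proof -
  have c1: "continuous_on {a..b} f" "continuous_on {a..b} h"
    using DERIV_continuous_on[OF f] DERIV_continuous_on[OF h] by blast+
  have "((\<lambda>x. f x * h' x + f' x * h x) has_integral (f b * h b - f a * h a)) {a..b}"
    using ab
  proof (rule fundamental_theorem_of_calculus)
    fix x assume "x \<in> {a..b}"
    then show "((\<lambda>x. f x * h x) has_vector_derivative f x * h' x + f' x * h x) (at x within {a..b})"
      unfolding has_real_derivative_iff_has_vector_derivative[symmetric]
      by (auto intro!: derivative_eq_intros f h simp: algebra_simps)
  qed
  then have "integral {a..b} (\<lambda>x. f x * h' x + f' x * h x) = 0"
    using h0 by (simp add: integral_unique)
  moreover have "integral {a..b} (\<lambda>x. f x * h' x + f' x * h x)
      = integral {a..b} (\<lambda>x. f x * h' x) + integral {a..b} (\<lambda>x. f' x * h x)"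
    by (rule integral_add) (intro integrable_continuous_real continuous_intros c1 cf ch)+
  ultimately show ?thesis by linarith
qed

text \<open>
  The Cauchy--Schwarz inequality \<open>(\<integral> f')\<^sup>2 \<le> (y - x) \<integral> f'\<^sup>2\<close> makes functions with square
  integrable derivative Hoelder continuous with exponent \<open>1/2\<close>.
\<close>

lemma square_increment_le:
  fixes f f' :: "real \<Rightarrow> real"
  assumes f: "\<And>x. x \<in> {a..b} \<Longrightarrow> (f has_real_derivative f' x) (at x within {a..b})"
    and cf: "continuous_on {a..b} f'"
    and x: "x \<in> {a..b}" and y: "y \<in> {a..b}"
  shows "(f x - f y)\<^sup>2 \<le> \<bar>x - y\<bar> * integral {a..b} (\<lambda>z. (f' z)\<^sup>2)"
proof -
  have main: "(f y - f x)\<^sup>2 \<le> (y - x) * integral {a..b} (\<lambda>z. (f' z)\<^sup>2)"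
    if x: "x \<in> {a..b}" and y: "y \<in> {a..b}" and xy: "x < y" for x y
  proof -
    define c where "c = (f y - f x) / (y - x)"
    have sub: "{x..y} \<subseteq> {a..b}" using x y by auto
    have cf': "continuous_on {x..y} f'" using cf sub by (rule continuous_on_subset)
    have "(f' has_integral (f y - f x)) {x..y}"
    proof (rule fundamental_theorem_of_calculus)
      show "x \<le> y" using xy by simp
      show "(f has_vector_derivative f' z) (at z within {x..y})" if "z \<in> {x..y}" for z
        unfolding has_real_derivative_iff_has_vector_derivative[symmetric]
        using f[of z] that sub by (intro has_field_derivative_subset[OF _ sub]) auto
    qed
    then have I: "integral {x..y} f' = f y - f x" by (simp add: integral_unique)
    have "0 \<le> integral {x..y} (\<lambda>z. (f' z - c)\<^sup>2)"
      by (rule integral_nonneg) (auto intro!: integrable_continuous_real continuous_intros cf')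
    also have "\<dots> = integral {x..y} (\<lambda>z. (f' z)\<^sup>2 + (c\<^sup>2 - 2 * c * f' z))"
      by (rule integral_cong) (simp add: power2_eq_square algebra_simps)
    also have "\<dots> = integral {x..y} (\<lambda>z. (f' z)\<^sup>2) + (integral {x..y} (\<lambda>z. c\<^sup>2) - integral {x..y} (\<lambda>z. 2 * c * f' z))"
      by (subst integral_add integral_diff,
          (intro integrable_continuous_real continuous_intros cf')+)+ (rule refl)
    also have "\<dots> = integral {x..y} (\<lambda>z. (f' z)\<^sup>2) + (c\<^sup>2 * (y - x) - 2 * c * (f y - f x))"
      using xy by (simp add: I)
    also have "c\<^sup>2 * (y - x) - 2 * c * (f y - f x) = - ((f y - f x)\<^sup>2 / (y - x))"
    proof -
      have "c\<^sup>2 * e - 2 * c * (c * e) = - ((c * e)\<^sup>2 / e)" if "e \<noteq> 0" for e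
        using that by (simp add: power2_eq_square)
      from this[of "y - x"] show ?thesis using xy by (simp add: c_def)
    qed
    finally have "(f y - f x)\<^sup>2 / (y - x) \<le> integral {x..y} (\<lambda>z. (f' z)\<^sup>2)" by simp
    also have "\<dots> \<le> integral {a..b} (\<lambda>z. (f' z)\<^sup>2)"
      by (rule integral_subset_le)
        (use sub in \<open>auto intro!: integrable_continuous_real continuous_intros cf cf'\<close>)
    finally show ?thesis using xy by (simp add: field_simps)
  qed
  consider "x < y" | "x = y" | "y < x" by linarith
  then show ?thesis
  proof cases
    case 1 with main[OF x y] show ?thesis by (simp add: power2_commute)
  next
    case 3 with main[OF y x] show ?thesis by simp
  qed simp
qed

text \<open>
  A function that attains a large value stays large on an interval whose length is controlled by
  the Hoelder bound; half of the interval is kept so that it fits on one side of the point.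
\<close>

lemma half_interval_at:
  fixes x :: real
  assumes "x \<in> {a..b}" "0 \<le> l" "l \<le> (b - a) / 2"
  obtains c where "{c..c + l} \<subseteq> {a..b}" "\<And>y. y \<in> {c..c + l} \<Longrightarrow> \<bar>x - y\<bar> \<le> l"
proof (cases "x + l \<le> b")
  case True
  then show ?thesis using assms by (intro that[of x]) auto
next
  case False
  then show ?thesis using assms by (intro that[of "x - l"]) (auto simp: field_simps)
qed

text \<open>
  An interpolation inequality of Gagliardo--Nirenberg type. If \<open>\<bar>f\<bar>\<close> has the value \<open>F\<close> at some
  point, it exceeds \<open>F/2\<close> on an interval of length comparable to \<open>F\<^sup>2 / \<integral> f'\<^sup>2\<close> or to \<open>b - a\<close>,
  which forces \<open>\<integral> \<bar>f\<bar>\<close> to be large.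
\<close>

lemma cube_le_gradient_mass:
  fixes f f' :: "real \<Rightarrow> real"
  assumes ab: "a < b"
    and f: "\<And>x. x \<in> {a..b} \<Longrightarrow> (f has_real_derivative f' x) (at x within {a..b})"
    and cf: "continuous_on {a..b} f'"
    and x: "x \<in> {a..b}"
    and A: "integral {a..b} (\<lambda>z. \<bar>f z\<bar>) \<le> A"
  shows "\<bar>f x\<bar> ^ 3 \<le> 8 * A * integral {a..b} (\<lambda>z. (f' z)\<^sup>2) + 64 * A ^ 3 / (b - a) ^ 3"
proof (cases "f x = 0")
  case True
  have "0 \<le> integral {a..b} (\<lambda>z. \<bar>f z\<bar>)" "0 \<le> integral {a..b} (\<lambda>z. (f' z)\<^sup>2)"
    by (intro integral_nonneg_cont continuous_intros DERIV_continuous_on[OF f] cf; simp)+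
  then show ?thesis using True A ab by simp
next
  case False
  define F Q where "F = \<bar>f x\<bar>" and "Q = integral {a..b} (\<lambda>z. (f' z)\<^sup>2)"
  have F0: "F > 0" using False by (simp add: F_def)
  have cf0: "continuous_on {a..b} f"
    using DERIV_continuous_on[OF f] by blast
  have Q0: "0 \<le> Q" unfolding Q_def
    by (rule integral_nonneg) (auto intro!: integrable_continuous_real continuous_intros cf)
  have A0: "0 \<le> A"
    by (rule order_trans[OF _ A], rule integral_nonneg)
      (auto intro!: integrable_continuous_real continuous_intros cf0)
  have key: "l * F / 2 \<le> A" if l: "0 \<le> l" "l \<le> (b - a) / 2" "l * Q \<le> F\<^sup>2 / 4" for l
  proof -
    obtain c where c: "{c..c + l} \<subseteq> {a..b}" "\<And>y. y \<in> {c..c + l} \<Longrightarrow> \<bar>x - y\<bar> \<le> l"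
      using half_interval_at[OF x l(1,2)] by metis
    have "F / 2 \<le> \<bar>f y\<bar>" if y: "y \<in> {c..c + l}" for y
    proof -
      have "(f x - f y)\<^sup>2 \<le> \<bar>x - y\<bar> * Q" unfolding Q_def
        using y c(1) by (intro square_increment_le f cf x) auto
      also have "\<dots> \<le> l * Q" by (rule mult_right_mono[OF c(2)[OF y] Q0])
      also have "\<dots> \<le> (F / 2)\<^sup>2" using l(3) by (simp add: power_divide)
      finally have "\<bar>f x - f y\<bar> \<le> F / 2" using F0 by (simp add: abs_le_square_iff[symmetric])
      then show ?thesis unfolding F_def by linarith
    qed
    then have "integral {c..c + l} (\<lambda>y. F / 2) \<le> integral {c..c + l} (\<lambda>y. \<bar>f y\<bar>)"
      by (intro integral_le integrable_continuous_real continuous_intros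
          continuous_on_subset[OF cf0 c(1)])
    also have "\<dots> \<le> integral {a..b} (\<lambda>y. \<bar>f y\<bar>)"
      by (rule integral_subset_le) (use c(1) in \<open>auto intro!: integrable_continuous_real
          continuous_intros cf0 intro: continuous_on_subset[OF cf0 c(1)]\<close>)
    finally show ?thesis using A l(1) by simp
  qed
  have F3: "F ^ 3 \<le> 8 * A * Q + 64 * A ^ 3 / (b - a) ^ 3"
  proof (cases "Q * ((b - a) / 2) \<le> F\<^sup>2 / 4")
    case True
    have "(b - a) / 2 * F / 2 \<le> A" using key[of "(b - a) / 2"] ab True by (simp add: mult.commute)
    then have "F \<le> 4 * A / (b - a)" using ab by (simp add: field_simps)
    then have "F ^ 3 \<le> (4 * A / (b - a)) ^ 3" using F0 by (intro power_mono) auto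
    also have "\<dots> = 64 * A ^ 3 / (b - a) ^ 3" by (simp add: power_divide power_mult_distrib)
    finally show ?thesis using A0 Q0 by (smt (verit) mult_nonneg_nonneg)
  next
    case False
    then have Qp: "Q > 0" using Q0 F0 by (cases "Q = 0") auto
    have "F\<^sup>2 / (4 * Q) * F / 2 \<le> A"
      using False Qp F0 by (intro key) (auto simp: field_simps)
    then have "F ^ 3 \<le> 8 * A * Q" using Qp by (simp add: field_simps power2_eq_square power3_eq_cube)
    moreover have "0 \<le> 64 * A ^ 3 / (b - a) ^ 3" using A0 ab by simp
    ultimately show ?thesis by linarith
  qed
  then show ?thesis by (simp add: F_def Q_def)
qed

lemma continuous_on_space_slice:
  assumes "continuous_on (A \<times> U) (\<lambda>(x, t). f x t)" "t \<in> U"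
  shows "continuous_on A (\<lambda>x. f x t)"
proof -
  have "continuous_on A (\<lambda>x. (\<lambda>(x, t). f x t) (x, t))"
    by (rule continuous_on_compose2[OF assms(1)]) (use assms(2) in \<open>auto intro!: continuous_intros\<close>)
  then show ?thesis by simp
qed

lemma has_derivative_integral_time:
  fixes f ft :: "real \<Rightarrow> real \<Rightarrow> real"
  assumes f: "\<And>x s. x \<in> {a..b} \<Longrightarrow> s > 0 \<Longrightarrow> ((\<lambda>s. f x s) has_real_derivative ft x s) (at s)"
    and cf: "continuous_on ({a..b} \<times> {0<..}) (\<lambda>(x, t). f x t)"
    and cft: "continuous_on ({a..b} \<times> {0<..}) (\<lambda>(x, t). ft x t)"
    and t: "t > 0"
  shows "((\<lambda>s. integral {a..b} (\<lambda>x. f x s)) has_real_derivative integral {a..b} (\<lambda>x. ft x t)) (at t)"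
proof -
  have "((\<lambda>s. integral (cbox a b) (\<lambda>x. f x s)) has_field_derivative integral (cbox a b) (\<lambda>x. ft x t))
      (at t within {0<..})"
  proof (rule leibniz_rule_field_derivative)
    show "((\<lambda>s. f x s) has_real_derivative ft x s) (at s within {0<..})"
      if "s \<in> {0<..}" "x \<in> cbox a b" for x s
      using f[of x s] that by (auto intro: has_field_derivative_at_within)
    show "(\<lambda>x. f x s) integrable_on cbox a b" if "s \<in> {0<..}" for s
    proof -
      have "continuous_on {a..b} (\<lambda>x. f x s)"
        using that by (auto intro: continuous_on_space_slice[OF cf])
      then show ?thesis by (simp add: integrable_continuous_real)
    qed
    show "continuous_on ({0<..} \<times> cbox a b) (\<lambda>(s, x). ft x s)"
      using continuous_on_swap_args[OF cft] by simp
  qed (use t in auto)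
  then show ?thesis using t by (simp add: at_within_open[of t "{0<..}"])
qed

lemma continuous_on_integral_time:
  fixes f :: "real \<Rightarrow> 'a::topological_space \<Rightarrow> real"
  assumes cf: "continuous_on ({a..b} \<times> U) (\<lambda>(x, t). f x t)"
  shows "continuous_on U (\<lambda>t. integral {a..b} (\<lambda>x. f x t))"
proof -
  have "continuous_on (U \<times> cbox a b) (\<lambda>(s, x). f x s)"
    using continuous_on_swap_args[OF cf] by simp
  from integral_continuous_on_param[OF this] show ?thesis by simp
qed

lemma increment_le_of_deriv_le:
  fixes f f' :: "real \<Rightarrow> real"
  assumes "s \<le> t" and "\<And>r. s \<le> r \<Longrightarrow> r \<le> t \<Longrightarrow> (f has_real_derivative f' r) (at r)"
    and "\<And>r. s \<le> r \<Longrightarrow> r \<le> t \<Longrightarrow> f' r \<le> c"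
  shows "f t \<le> f s + c * (t - s)"
proof (cases "s = t")
  case False
  then have st: "s < t" using assms(1) by simp
  from MVT2[OF st assms(2)] obtain z where "s < z" "z < t" "f t - f s = (t - s) * f' z" by blast
  moreover have "(t - s) * f' z \<le> (t - s) * c"
    using assms(3)[of z] \<open>s < z\<close> \<open>z < t\<close> st by (intro mult_left_mono) auto
  ultimately have "f t - f s \<le> (t - s) * c" by simp
  then show ?thesis by (simp add: mult.commute)
qed simp

text \<open>
  A symmetric function of two times is differentiable along the diagonal as soon as one of its
  partial derivatives is continuous. This is applied to \<open>\<integral> d z\<^sub>x(s) z\<^sub>x(t)\<close>, whose partial
  derivatives can be computed after an integration by parts without the mixed derivative
  \<open>z\<^sub>x\<^sub>t\<close>.
\<close>

lemma symmetric_diagonal_derivative: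
  fixes \<Phi> \<Psi> :: "real \<Rightarrow> real \<Rightarrow> real"
  assumes sym: "\<And>s t. s > 0 \<Longrightarrow> t > 0 \<Longrightarrow> \<Phi> s t = \<Phi> t s"
    and der: "\<And>s t. s > 0 \<Longrightarrow> t > 0 \<Longrightarrow> ((\<lambda>r. \<Phi> s r) has_real_derivative \<Psi> s t) (at t)"
    and cont: "continuous_on ({0<..} \<times> {0<..}) (\<lambda>(s, t). \<Psi> s t)"
    and t: "t > 0"
  shows "((\<lambda>s. \<Phi> s s) has_real_derivative 2 * \<Psi> t t) (at t)"
proof -
  have ex: "\<exists>\<xi>. \<bar>\<xi> - t\<bar> \<le> \<bar>s - t\<bar> \<and> \<Phi> s s - \<Phi> s t = (s - t) * \<Psi> s \<xi>" if s: "s > 0" for s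
  proof -
    consider "s < t" | "s = t" | "t < s" by linarith
    then show ?thesis
    proof cases
      case 1
      from MVT2[OF 1, of "\<Phi> s" "\<Psi> s"] der s obtain z where "s < z" "z < t"
        "\<Phi> s t - \<Phi> s s = (t - s) * \<Psi> s z" by fastforce
      then show ?thesis by (intro exI[of _ z]) (auto simp: algebra_simps)
    next
      case 3
      from MVT2[OF 3, of "\<Phi> s" "\<Psi> s"] der s t obtain z where "t < z" "z < s"
        "\<Phi> s s - \<Phi> s t = (s - t) * \<Psi> s z" by fastforce
      then show ?thesis by (intro exI[of _ z]) (auto simp: algebra_simps)
    qed auto
  qed
  then obtain \<xi> where \<xi>: "\<And>s. s > 0 \<Longrightarrow> \<bar>\<xi> s - t\<bar> \<le> \<bar>s - t\<bar>"
    "\<And>s. s > 0 \<Longrightarrow> \<Phi> s s - \<Phi> s t = (s - t) * \<Psi> s (\<xi> s)" by metis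
  have pos: "\<forall>\<^sub>F s in at t. s > 0"
    using order_tendstoD(1)[OF tendsto_ident_at t] .
  have lim0: "((\<lambda>s. \<bar>s - t\<bar>) \<longlongrightarrow> 0) (at t)"
    by (rule tendsto_eq_intros refl | simp)+
  have "((\<lambda>s. \<xi> s - t) \<longlongrightarrow> 0) (at t)"
    by (rule Lim_null_comparison[OF _ lim0]) (use pos \<xi>(1) in \<open>auto elim: eventually_mono\<close>)
  then have lim\<xi>: "(\<xi> \<longlongrightarrow> t) (at t)" by (simp add: LIM_zero_iff)
  have pair: "((\<lambda>s. (s, \<xi> s)) \<longlongrightarrow> (t, t)) (at t)" by (intro tendsto_intros lim\<xi>)
  have "isCont (\<lambda>(s, t). \<Psi> s t) (t, t)"
    using cont t by (auto simp: continuous_on_eq_continuous_at open_Times)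
  from isCont_tendsto_compose[OF this pair]
  have l1: "((\<lambda>s. \<Psi> s (\<xi> s)) \<longlongrightarrow> \<Psi> t t) (at t)" by simp
  have l2: "((\<lambda>s. (\<Phi> t s - \<Phi> t t) / (s - t)) \<longlongrightarrow> \<Psi> t t) (at t)"
    using der[OF t t] by (simp add: has_field_derivative_iff)
  have "((\<lambda>s. (\<Phi> s s - \<Phi> t t) / (s - t)) \<longlongrightarrow> 2 * \<Psi> t t) (at t)"
  proof (rule Lim_transform_eventually)
    show "((\<lambda>s. \<Psi> s (\<xi> s) + (\<Phi> t s - \<Phi> t t) / (s - t)) \<longlongrightarrow> 2 * \<Psi> t t) (at t)"
      using tendsto_add[OF l1 l2] by simp
    show "\<forall>\<^sub>F s in at t. \<Psi> s (\<xi> s) + (\<Phi> t s - \<Phi> t t) / (s - t) = (\<Phi> s s - \<Phi> t t) / (s - t)"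
      using pos eventually_neq_at_within[of t t UNIV]
    proof eventually_elim
      case (elim s)
      then show ?case using \<xi>(2)[of s] sym[of s t] t by (simp add: field_simps)
    qed
  qed
  then show ?thesis by (simp add: has_field_derivative_iff)
qed

section \<open>The energy of a regularized solution\<close>

text \<open>
  The three terms are the integrands of the time derivatives of the entropy \<open>\<integral> u ln (d u)\<close>, the
  gradient energy \<open>1/2 \<integral> d w\<^sub>x\<^sup>2 / g(w)\<close> and the integral \<open>1/\<gamma> \<integral> (d\<^sub>x\<^sup>2 / d) w\<close>, the first two
  after an integration by parts; \<open>Q\<close> stands for \<open>(d w\<^sub>x / \<surd>g)\<^sub>x\<close>. In their sum the terms
  \<open>\<plusminus>d u\<^sub>x w\<^sub>x\<close> cancel. What remains of the taxis term is \<open>d\<^sub>x u w\<^sub>x\<close>, which Young's inequality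
  distributes to the consumption terms of the second and the third functional. The third one leaves
  a diffusion error, and this is controlled by \<open>Q\<^sup>2\<close>.
\<close>

lemma energy_integrand_le:
  fixes d dx u ux wx wt g g' \<epsilon> \<gamma> Q :: real
  assumes pos: "0 < d" "0 < u" "0 < g" "0 < \<epsilon>" "0 < \<gamma>" and g': "\<gamma> \<le> g'"
    and Q: "wt = \<epsilon> * Q - u * g"
  shows "- ((dx * u + d * ux) / (d * u) * (dx * u + d * ux - d * u * wx))
      - (\<epsilon> * Q\<^sup>2 / sqrt g + (d * wx / sqrt g * (ux * sqrt g + u * (g' * wx / (2 * sqrt g)))))
      + dx\<^sup>2 / d * wt / \<gamma>
    \<le> \<epsilon> / (4 * \<gamma>\<^sup>2) * (dx ^ 4 / d\<^sup>2 * sqrt g)"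
proof -
  define r where "r = sqrt g"
  have r: "0 < r" "g = r\<^sup>2" using pos by (auto simp: r_def)
  have e1: "d * wx / r * (ux * r + u * (g' * wx / (2 * r))) = d * ux * wx + d * u * g' * wx\<^sup>2 / (2 * r\<^sup>2)"
    using r(1) by (simp add: field_simps power2_eq_square)
  have e2: "(dx * u + d * ux) / (d * u) * (dx * u + d * ux - d * u * wx)
      = (dx * u + d * ux)\<^sup>2 / (d * u) - (dx * u + d * ux) * wx"
    using pos by (simp add: field_simps power2_eq_square)
  have e3: "dx\<^sup>2 / d * wt / \<gamma> = \<epsilon> * (dx\<^sup>2 * Q / (d * \<gamma>)) - dx\<^sup>2 * u * r\<^sup>2 / (d * \<gamma>)"
    using pos by (simp add: Q r(2) field_simps)
  have b1: "0 \<le> (dx * u + d * ux)\<^sup>2 / (d * u)" using pos by simp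
  have b2: "dx * u * wx \<le> d * u * g' * wx\<^sup>2 / (2 * r\<^sup>2) + dx\<^sup>2 * u * r\<^sup>2 / (d * \<gamma>)"
  proof -
    have "d * u * \<gamma> * wx\<^sup>2 / (2 * r\<^sup>2) \<le> d * u * g' * wx\<^sup>2 / (2 * r\<^sup>2)"
      using pos r g' by (intro divide_right_mono mult_right_mono mult_left_mono) auto
    moreover have "dx * u * wx \<le> d * u * \<gamma> * wx\<^sup>2 / (2 * r\<^sup>2) + dx\<^sup>2 * u * r\<^sup>2 / (d * \<gamma>)"
    proof -
      define A where "A = d * \<gamma> / r\<^sup>2"
      have A: "0 < A" using pos r by (simp add: A_def)
      have "dx * wx \<le> A * wx\<^sup>2 / 2 + dx\<^sup>2 / A"
      proof -
        have "0 \<le> (A * wx - dx)\<^sup>2 + dx\<^sup>2" by simp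
        also have "\<dots> = 2 * A * (A * wx\<^sup>2 / 2 + dx\<^sup>2 / A - dx * wx)"
          using A by (simp add: field_simps power2_eq_square)
        finally show ?thesis using A by (simp add: zero_le_mult_iff)
      qed
      then have "u * (dx * wx) \<le> u * (A * wx\<^sup>2 / 2 + dx\<^sup>2 / A)" using pos by (intro mult_left_mono) auto
      then show ?thesis using pos r(1) unfolding A_def by (simp add: field_simps)
    qed
    ultimately show ?thesis by linarith
  qed
  have b3: "dx\<^sup>2 * Q / (d * \<gamma>) \<le> Q\<^sup>2 / r + dx ^ 4 / d\<^sup>2 * r / (4 * \<gamma>\<^sup>2)"
  proof -
    define B where "B = dx\<^sup>2 / (d * \<gamma>)"
    have "0 \<le> (Q - B * r / 2)\<^sup>2 / r" using r by simp
    also have "\<dots> = Q\<^sup>2 / r + B\<^sup>2 * r / 4 - B * Q"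
      using r(1) by (simp add: field_simps power2_eq_square)
    finally have "B * Q \<le> Q\<^sup>2 / r + B\<^sup>2 * r / 4" by simp
    moreover have "B\<^sup>2 * r / 4 = dx ^ 4 / d\<^sup>2 * r / (4 * \<gamma>\<^sup>2)"
      by (simp add: B_def power_divide power_mult_distrib flip: power_mult)
    ultimately show ?thesis by (simp add: B_def)
  qed
  have "\<epsilon> * (dx\<^sup>2 * Q / (d * \<gamma>)) \<le> \<epsilon> * (Q\<^sup>2 / r + dx ^ 4 / d\<^sup>2 * r / (4 * \<gamma>\<^sup>2))"
    using b3 pos by (intro mult_left_mono) auto
  then have b4: "\<epsilon> * (dx\<^sup>2 * Q / (d * \<gamma>)) \<le> \<epsilon> * Q\<^sup>2 / r + \<epsilon> / (4 * \<gamma>\<^sup>2) * (dx ^ 4 / d\<^sup>2 * r)"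
    by (simp add: algebra_simps)
  show ?thesis unfolding r_def[symmetric] e1 e2 e3 using b1 b2 b4 by (simp add: algebra_simps)
qed

text \<open>
  The flux form of the two equations is all that is used about them, so no second derivative in
  space appears: \<open>J = (d u)\<^sub>x - d u w\<^sub>x\<close> has derivative \<open>u\<^sub>t\<close> and \<open>q = d w\<^sub>x / \<surd>g(w)\<close> has
  derivative \<open>(w\<^sub>t + u g(w)) / \<epsilon>\<close>.
\<close>

locale taxis_solution =
  fixes a b \<epsilon> \<gamma>\<^sub>1 \<gamma>\<^sub>2 :: real
    and d dx g g' :: "real \<Rightarrow> real"
    and u ux ut w wx wt :: "real \<Rightarrow> real \<Rightarrow> real"
  assumes ab: "a < b" and eps: "0 < \<epsilon>" and \<gamma>: "0 < \<gamma>\<^sub>1" "0 < \<gamma>\<^sub>2"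
    and d_deriv: "\<And>x. x \<in> {a..b} \<Longrightarrow> (d has_real_derivative dx x) (at x within {a..b})"
    and dx_cont: "continuous_on {a..b} dx"
    and d_pos: "\<And>x. x \<in> {a..b} \<Longrightarrow> 0 < d x"
    and dx_bdry: "dx a = 0" "dx b = 0"
    and g_deriv: "\<And>s. 0 < s \<Longrightarrow> (g has_real_derivative g' s) (at s)"
    and g'_cont: "continuous_on {0<..} g'"
    and g'_lower: "\<And>s. 0 < s \<Longrightarrow> \<gamma>\<^sub>1 \<le> g' s"
    and g_bounds: "\<And>s. 0 < s \<Longrightarrow> \<gamma>\<^sub>1 * s \<le> g s" "\<And>s. 0 < s \<Longrightarrow> g s \<le> \<gamma>\<^sub>2 * s"
    and u_cont: "continuous_on ({a..b} \<times> {0..}) (\<lambda>(x, t). u x t)"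
    and u_x: "\<And>x t. x \<in> {a..b} \<Longrightarrow> 0 < t \<Longrightarrow>
      ((\<lambda>y. u y t) has_real_derivative ux x t) (at x within {a..b})"
    and u_t: "\<And>x t. x \<in> {a..b} \<Longrightarrow> 0 < t \<Longrightarrow> ((\<lambda>s. u x s) has_real_derivative ut x t) (at t)"
    and ux_cont: "continuous_on ({a..b} \<times> {0<..}) (\<lambda>(x, t). ux x t)"
    and ut_cont: "continuous_on ({a..b} \<times> {0<..}) (\<lambda>(x, t). ut x t)"
    and w_cont: "continuous_on ({a..b} \<times> {0..}) (\<lambda>(x, t). w x t)"
    and w_x: "\<And>x t. x \<in> {a..b} \<Longrightarrow> 0 < t \<Longrightarrow>
      ((\<lambda>y. w y t) has_real_derivative wx x t) (at x within {a..b})"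
    and w_t: "\<And>x t. x \<in> {a..b} \<Longrightarrow> 0 < t \<Longrightarrow> ((\<lambda>s. w x s) has_real_derivative wt x t) (at t)"
    and wx_cont: "continuous_on ({a..b} \<times> {0<..}) (\<lambda>(x, t). wx x t)"
    and wt_cont: "continuous_on ({a..b} \<times> {0<..}) (\<lambda>(x, t). wt x t)"
    and u_pos: "\<And>x t. x \<in> {a..b} \<Longrightarrow> 0 < t \<Longrightarrow> 0 < u x t"
    and w_pos: "\<And>x t. x \<in> {a..b} \<Longrightarrow> 0 \<le> t \<Longrightarrow> 0 < w x t"
    and ux_bdry: "\<And>t. 0 < t \<Longrightarrow> ux a t = 0" "\<And>t. 0 < t \<Longrightarrow> ux b t = 0"
    and wx_bdry: "\<And>t. 0 < t \<Longrightarrow> wx a t = 0" "\<And>t. 0 < t \<Longrightarrow> wx b t = 0"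
    and u_flux: "\<And>x t. x \<in> {a..b} \<Longrightarrow> 0 < t \<Longrightarrow>
      ((\<lambda>y. dx y * u y t + d y * ux y t - d y * u y t * wx y t) has_real_derivative ut x t)
        (at x within {a..b})"
    and w_flux: "\<And>x t. x \<in> {a..b} \<Longrightarrow> 0 < t \<Longrightarrow>
      ((\<lambda>y. d y * wx y t / sqrt (g (w y t))) has_real_derivative
        (wt x t + u x t * g (w x t)) / \<epsilon>) (at x within {a..b})"
begin

lemma g_pos: "0 < s \<Longrightarrow> 0 < g s"
  using g_bounds(1)[of s] \<gamma> by (meson less_le_trans mult_pos_pos)

lemma g_cont: "continuous_on {0<..} g"
  by (rule DERIV_continuous_on[of _ _ g']) (auto intro: has_field_derivative_at_within g_deriv)

lemma d_cont: "continuous_on {a..b} d"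
  using DERIV_continuous_on[OF d_deriv] by blast

lemma nonzero:
  "a \<le> x \<Longrightarrow> x \<le> b \<Longrightarrow> d x \<noteq> 0"
  "a \<le> x \<Longrightarrow> x \<le> b \<Longrightarrow> 0 < t \<Longrightarrow> u x t \<noteq> 0"
  "a \<le> x \<Longrightarrow> x \<le> b \<Longrightarrow> 0 \<le> t \<Longrightarrow> w x t \<noteq> 0"
  "a \<le> x \<Longrightarrow> x \<le> b \<Longrightarrow> 0 \<le> t \<Longrightarrow> g (w x t) \<noteq> 0"
  using d_pos[of x] u_pos[of x t] w_pos[of x t] g_pos[of "w x t"] by force+

lemma positive_times_subset: "{0<..} \<subseteq> {0::real..}"
  by auto

lemma cont_facts:
  "continuous_on ({a..b} \<times> T) (\<lambda>z. d (fst z))"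
  "continuous_on ({a..b} \<times> T) (\<lambda>z. dx (fst z))"
  "T \<subseteq> {0..} \<Longrightarrow> continuous_on ({a..b} \<times> T) (\<lambda>z. u (fst z) (snd z))"
  "T \<subseteq> {0<..} \<Longrightarrow> continuous_on ({a..b} \<times> T) (\<lambda>z. ux (fst z) (snd z))"
  "T \<subseteq> {0<..} \<Longrightarrow> continuous_on ({a..b} \<times> T) (\<lambda>z. ut (fst z) (snd z))"
  "T \<subseteq> {0..} \<Longrightarrow> continuous_on ({a..b} \<times> T) (\<lambda>z. w (fst z) (snd z))"
  "T \<subseteq> {0<..} \<Longrightarrow> continuous_on ({a..b} \<times> T) (\<lambda>z. wx (fst z) (snd z))"
  "T \<subseteq> {0<..} \<Longrightarrow> continuous_on ({a..b} \<times> T) (\<lambda>z. wt (fst z) (snd z))"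
  "T \<subseteq> {0..} \<Longrightarrow> continuous_on ({a..b} \<times> T) (\<lambda>z. g (w (fst z) (snd z)))"
  "T \<subseteq> {0..} \<Longrightarrow> continuous_on ({a..b} \<times> T) (\<lambda>z. g' (w (fst z) (snd z)))"
proof -
  have fs: "continuous_on ({a..b} \<times> T) fst" by (intro continuous_intros)
  show "continuous_on ({a..b} \<times> T) (\<lambda>z. d (fst z))" "continuous_on ({a..b} \<times> T) (\<lambda>z. dx (fst z))"
    by (rule continuous_on_compose2[OF d_cont fs] continuous_on_compose2[OF dx_cont fs]; auto)+
  have sub: "{a..b} \<times> T \<subseteq> {a..b} \<times> {0::real..}" if "T \<subseteq> {0..}" using that by auto
  have sub': "{a..b} \<times> T \<subseteq> {a..b} \<times> {0::real<..}" if "T \<subseteq> {0<..}" using that by auto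
  show "T \<subseteq> {0..} \<Longrightarrow> continuous_on ({a..b} \<times> T) (\<lambda>z. u (fst z) (snd z))"
    using continuous_on_subset[OF u_cont sub] by (simp add: split_beta)
  show w: "T \<subseteq> {0..} \<Longrightarrow> continuous_on ({a..b} \<times> T) (\<lambda>z. w (fst z) (snd z))"
    using continuous_on_subset[OF w_cont sub] by (simp add: split_beta)
  show "T \<subseteq> {0<..} \<Longrightarrow> continuous_on ({a..b} \<times> T) (\<lambda>z. ux (fst z) (snd z))"
    using continuous_on_subset[OF ux_cont sub'] by (simp add: split_beta)
  show "T \<subseteq> {0<..} \<Longrightarrow> continuous_on ({a..b} \<times> T) (\<lambda>z. ut (fst z) (snd z))"
    using continuous_on_subset[OF ut_cont sub'] by (simp add: split_beta)
  show "T \<subseteq> {0<..} \<Longrightarrow> continuous_on ({a..b} \<times> T) (\<lambda>z. wx (fst z) (snd z))"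
    using continuous_on_subset[OF wx_cont sub'] by (simp add: split_beta)
  show "T \<subseteq> {0<..} \<Longrightarrow> continuous_on ({a..b} \<times> T) (\<lambda>z. wt (fst z) (snd z))"
    using continuous_on_subset[OF wt_cont sub'] by (simp add: split_beta)
  show "T \<subseteq> {0..} \<Longrightarrow> continuous_on ({a..b} \<times> T) (\<lambda>z. g (w (fst z) (snd z)))"
    by (rule continuous_on_compose2[OF g_cont w]) (auto intro!: w_pos)
  show "T \<subseteq> {0..} \<Longrightarrow> continuous_on ({a..b} \<times> T) (\<lambda>z. g' (w (fst z) (snd z)))"
    by (rule continuous_on_compose2[OF g'_cont w]) (auto intro!: w_pos)
qed

lemmas joint_cont =
  cont_facts(1,2)[of "{0<..}"] cont_facts(3)[OF positive_times_subset] cont_facts(4,5)[OF order_refl]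
  cont_facts(6)[OF positive_times_subset] cont_facts(7,8)[OF order_refl]
  cont_facts(9,10)[OF positive_times_subset]

lemmas joint_cont0 = cont_facts(1,2)[of "{0..}"] cont_facts(3,6,9,10)[OF order_refl]

lemma slice_facts:
  assumes "0 < t"
  shows "continuous_on {a..b} (\<lambda>x. u x t)" "continuous_on {a..b} (\<lambda>x. ux x t)"
    "continuous_on {a..b} (\<lambda>x. ut x t)" "continuous_on {a..b} (\<lambda>x. w x t)"
    "continuous_on {a..b} (\<lambda>x. wx x t)" "continuous_on {a..b} (\<lambda>x. wt x t)"
    "continuous_on {a..b} (\<lambda>x. g (w x t))" "continuous_on {a..b} (\<lambda>x. g' (w x t))"
proof -
  have c: "continuous_on {a..b} (\<lambda>x. F (x, t))" if "continuous_on ({a..b} \<times> {0<..}) F"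
    for F :: "real \<times> real \<Rightarrow> real"
    by (rule continuous_on_compose2[OF that]) (use assms in \<open>auto intro!: continuous_intros\<close>)
  show "continuous_on {a..b} (\<lambda>x. u x t)" "continuous_on {a..b} (\<lambda>x. ux x t)"
    "continuous_on {a..b} (\<lambda>x. ut x t)" "continuous_on {a..b} (\<lambda>x. w x t)"
    "continuous_on {a..b} (\<lambda>x. wx x t)" "continuous_on {a..b} (\<lambda>x. wt x t)"
    "continuous_on {a..b} (\<lambda>x. g (w x t))" "continuous_on {a..b} (\<lambda>x. g' (w x t))"
    using joint_cont(3-10)[THEN c] by simp_all
qed

definition mass_entropy :: "real \<Rightarrow> real"
  where "mass_entropy t = integral {a..b} (\<lambda>x. u x t * ln (d x * u x t))"

definition gradient_energy :: "real \<Rightarrow> real"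
  where "gradient_energy t = (1/2) * integral {a..b} (\<lambda>x. d x * (wx x t)\<^sup>2 / g (w x t))"

definition weighted_nutrient :: "real \<Rightarrow> real"
  where "weighted_nutrient t = integral {a..b} (\<lambda>x. (dx x)\<^sup>2 / d x * w x t)"

lemma mass_entropy_deriv:
  assumes t: "0 < t"
  shows "(mass_entropy has_real_derivative
    - integral {a..b} (\<lambda>x. (dx x * u x t + d x * ux x t) / (d x * u x t)
        * (dx x * u x t + d x * ux x t - d x * u x t * wx x t))) (at t)"
proof -
  have "(mass_entropy has_real_derivative
      integral {a..b} (\<lambda>x. (ln (d x * u x t) + 1) * ut x t)) (at t)"
    unfolding mass_entropy_def
  proof (rule has_derivative_integral_time[OF _ _ _ t])
    show "((\<lambda>s. u x s * ln (d x * u x s)) has_real_derivative (ln (d x * u x s) + 1) * ut x s) (at s)"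
      if "x \<in> {a..b}" "0 < s" for x s
      using u_pos[OF that] d_pos[OF that(1)]
      by (auto intro!: derivative_eq_intros u_t that simp: field_simps)
    show "continuous_on ({a..b} \<times> {0<..}) (\<lambda>(x, t). u x t * ln (d x * u x t))"
      "continuous_on ({a..b} \<times> {0<..}) (\<lambda>(x, t). (ln (d x * u x t) + 1) * ut x t)"
      unfolding split_beta' by (auto intro!: continuous_intros joint_cont simp: nonzero)
  qed
  also have "integral {a..b} (\<lambda>x. (ln (d x * u x t) + 1) * ut x t)
      = - integral {a..b} (\<lambda>x. (dx x * u x t + d x * ux x t) / (d x * u x t)
        * (dx x * u x t + d x * ux x t - d x * u x t * wx x t))"
  proof (rule ibp_vanishing_flux)
    show "((\<lambda>x. ln (d x * u x t) + 1) has_real_derivative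
        (dx x * u x t + d x * ux x t) / (d x * u x t)) (at x within {a..b})" if "x \<in> {a..b}" for x
      using u_pos[OF that t] d_pos[OF that]
      by (auto intro!: derivative_eq_intros u_x d_deriv that t simp: field_simps)
  qed (use ab t in \<open>auto intro!: u_flux continuous_intros slice_facts d_cont dx_cont
        simp: dx_bdry ux_bdry wx_bdry nonzero\<close>)
  finally show ?thesis .
qed

lemma weighted_nutrient_deriv:
  assumes t: "0 < t"
  shows "(weighted_nutrient has_real_derivative
    integral {a..b} (\<lambda>x. (dx x)\<^sup>2 / d x * wt x t)) (at t)"
  unfolding weighted_nutrient_def
proof (rule has_derivative_integral_time[OF _ _ _ t])
  show "continuous_on ({a..b} \<times> {0<..}) (\<lambda>(x, t). (dx x)\<^sup>2 / d x * w x t)"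
    "continuous_on ({a..b} \<times> {0<..}) (\<lambda>(x, t). (dx x)\<^sup>2 / d x * wt x t)"
    unfolding split_beta' by (auto intro!: continuous_intros joint_cont dest: nonzero)
  show "((\<lambda>s. (dx x)\<^sup>2 / d x * w x s) has_real_derivative (dx x)\<^sup>2 / d x * wt x s) (at s)"
    if "x \<in> {a..b}" "0 < s" for x s
    by (rule DERIV_cmult[OF w_t[OF that]])
qed

text \<open>
  In the variable \<open>z = Z(w)\<close> with \<open>Z' = 1 / \<surd>g\<close> the energy is \<open>1/2 \<integral> d z\<^sub>x\<^sup>2\<close> and the
  diffusion operator acting on \<open>w\<close> is \<open>\<epsilon> (d z\<^sub>x)\<^sub>x\<close>.
\<close>

lemma gradient_energy_deriv:
  assumes t: "0 < t"
  shows "(gradient_energy has_real_derivative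
    - integral {a..b} (\<lambda>x. (wt x t + u x t * g (w x t)) / \<epsilon> * (wt x t / sqrt (g (w x t))))) (at t)"
proof -
  have "\<exists>Z. \<forall>s::real. 0 < ereal s \<longrightarrow> ereal s < \<infinity> \<longrightarrow> (Z has_vector_derivative 1 / sqrt (g s)) (at s)"
  proof (rule einterval_antiderivative)
    show "isCont (\<lambda>s. 1 / sqrt (g s)) s" if "0 < ereal s" "ereal s < \<infinity>" for s
    proof -
      have "0 < s" using that by simp
      moreover have "isCont g s"
        using DERIV_isCont[OF g_deriv] \<open>0 < s\<close> by blast
      ultimately show ?thesis using g_pos[of s] by (intro continuous_intros) auto
    qed
  qed simp
  then obtain Z where Z: "\<And>s. 0 < s \<Longrightarrow> (Z has_real_derivative 1 / sqrt (g s)) (at s)"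
    by (auto simp: has_real_derivative_iff_has_vector_derivative)
  have Z_cont: "continuous_on {0<..} Z"
    by (rule DERIV_continuous_on[of _ _ "\<lambda>s. 1 / sqrt (g s)"])
      (auto intro: has_field_derivative_at_within Z)
  define \<Phi> where "\<Phi> s r = integral {a..b} (\<lambda>x. d x * (wx x s / sqrt (g (w x s))) * (wx x r / sqrt (g (w x r))))"
    for s r
  define \<Psi> where "\<Psi> s r = - integral {a..b} (\<lambda>x. (wt x s + u x s * g (w x s)) / \<epsilon> * (wt x r / sqrt (g (w x r))))"
    for s r
  have \<Phi>_ibp: "\<Phi> s r = - integral {a..b} (\<lambda>x. Z (w x r) * ((wt x s + u x s * g (w x s)) / \<epsilon>))"
    if s: "0 < s" and r: "0 < r" for s r
  proof -
    have "integral {a..b} (\<lambda>x. Z (w x r) * ((wt x s + u x s * g (w x s)) / \<epsilon>))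
        = - integral {a..b} (\<lambda>x. wx x r / sqrt (g (w x r)) * (d x * wx x s / sqrt (g (w x s))))"
    proof (rule ibp_vanishing_flux)
      show "((\<lambda>x. Z (w x r)) has_real_derivative wx x r / sqrt (g (w x r))) (at x within {a..b})"
        if "x \<in> {a..b}" for x
        using DERIV_chain2[OF Z w_x[OF that r]] w_pos[of x r] that r by (simp add: less_imp_le)
    qed (use ab s r eps in \<open>auto intro!: w_flux continuous_intros slice_facts d_cont dx_cont
        simp: wx_bdry nonzero less_imp_le\<close>)
    then show ?thesis unfolding \<Phi>_def by (simp add: mult_ac)
  qed
  have "((\<lambda>s. \<Phi> s s) has_real_derivative 2 * \<Psi> t t) (at t)"
  proof (rule symmetric_diagonal_derivative[where \<Phi> = \<Phi> and \<Psi> = \<Psi>, OF _ _ _ t])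
    show "\<Phi> s r = \<Phi> r s" for s r unfolding \<Phi>_def by (simp add: mult_ac)
    show "((\<lambda>r. \<Phi> s r) has_real_derivative \<Psi> s r) (at r)" if s: "0 < s" and r: "0 < r" for s r
    proof -
      define k where "k x = (wt x s + u x s * g (w x s)) / \<epsilon>" for x
      have "continuous_on {a..b} k" unfolding k_def
        using s eps by (auto intro!: continuous_intros slice_facts)
      then have k_cont: "continuous_on ({a..b} \<times> T) (\<lambda>z. k (fst z))" for T :: "real set"
        by (rule continuous_on_compose2) (auto intro!: continuous_intros)
      have Zw: "continuous_on ({a..b} \<times> {0<..}) (\<lambda>z. Z (w (fst z) (snd z)))"
        by (rule continuous_on_compose2[OF Z_cont]) (auto intro!: joint_cont w_pos)
      have "((\<lambda>r. integral {a..b} (\<lambda>x. Z (w x r) * k x)) has_real_derivative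
          integral {a..b} (\<lambda>x. wt x r / sqrt (g (w x r)) * k x)) (at r)"
      proof (rule has_derivative_integral_time[OF _ _ _ r])
        show "((\<lambda>s. Z (w x s) * k x) has_real_derivative wt x s / sqrt (g (w x s)) * k x) (at s)"
          if "x \<in> {a..b}" "0 < s" for x s
        proof -
          have "((\<lambda>s. Z (w x s)) has_real_derivative wt x s / sqrt (g (w x s))) (at s)"
            using DERIV_chain2[OF Z w_t[OF that]] w_pos[of x s] that by (simp add: less_imp_le)
          then show ?thesis by (rule DERIV_cmult_right)
        qed
        show "continuous_on ({a..b} \<times> {0<..}) (\<lambda>(x, t). Z (w x t) * k x)"
          unfolding split_beta' by (intro continuous_intros Zw k_cont)
        show "continuous_on ({a..b} \<times> {0<..}) (\<lambda>(x, t). wt x t / sqrt (g (w x t)) * k x)"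
          unfolding split_beta'
          by (auto intro!: continuous_intros joint_cont k_cont simp: nonzero less_imp_le)
      qed
      then have "((\<lambda>r. - integral {a..b} (\<lambda>x. Z (w x r) * k x)) has_real_derivative \<Psi> s r) (at r)"
        unfolding \<Psi>_def k_def by (intro DERIV_minus) (simp only: mult.commute)
      then show ?thesis
        by (rule has_field_derivative_transform_within_open[of _ _ _ "{0<..}"])
          (use s r in \<open>auto simp: \<Phi>_ibp k_def\<close>)
    qed
    show "continuous_on ({0<..} \<times> {0<..}) (\<lambda>(s, r). \<Psi> s r)"
    proof -
      have slot: "continuous_on ({a..b} \<times> ({0<..} \<times> {0<..})) (\<lambda>z. F (fst z, fst (snd z)))"
        "continuous_on ({a..b} \<times> ({0<..} \<times> {0<..})) (\<lambda>z. F (fst z, snd (snd z)))"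
        if "continuous_on ({a..b} \<times> {0<..}) F" for F :: "real \<times> real \<Rightarrow> real"
        by (rule continuous_on_compose2[OF that]; auto intro!: continuous_intros)+
      note slots = joint_cont(3-10)[THEN slot(1), simplified] joint_cont(3-10)[THEN slot(2), simplified]
      have "continuous_on ({0<..} \<times> {0<..}) (\<lambda>p. integral {a..b}
          (\<lambda>x. (wt x (fst p) + u x (fst p) * g (w x (fst p))) / \<epsilon> * (wt x (snd p) / sqrt (g (w x (snd p))))))"
        by (rule continuous_on_integral_time)
          (use eps in \<open>auto simp: split_beta' nonzero less_imp_le intro!: continuous_intros slots\<close>)
      then show ?thesis unfolding \<Psi>_def split_beta' by (intro continuous_intros)
    qed
  qed
  then have "((\<lambda>s. (1/2) * \<Phi> s s) has_real_derivative \<Psi> t t) (at t)"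
    by (auto intro!: derivative_eq_intros)
  then have "(gradient_energy has_real_derivative \<Psi> t t) (at t)"
  proof (rule has_field_derivative_transform_within_open[of _ _ _ "{0<..}"])
    fix s :: real assume "s \<in> {0<..}"
    then have "g (w x s) > 0" if "x \<in> {a..b}" for x using that g_pos[OF w_pos[of x s]] by auto
    then show "(1/2) * \<Phi> s s = gradient_energy s"
      unfolding gradient_energy_def \<Phi>_def
      by (intro arg_cong2[where f = "(*)"] refl integral_cong)
        (simp add: power2_eq_square field_simps less_imp_le)
  qed (use t in auto)
  then show ?thesis by (simp add: \<Psi>_def)
qed

definition energy :: "real \<Rightarrow> real"
  where "energy t = mass_entropy t + gradient_energy t + weighted_nutrient t / \<gamma>\<^sub>1"

text \<open>
  The gradient energy contributes the product of \<open>u \<surd>g(w)\<close> with \<open>(d w\<^sub>x / \<surd>g(w))\<^sub>x\<close>, and a second integration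
  by parts brings this term into the form in which it cancels against the entropy. The diffusion
  error left over is an integral of \<open>\<epsilon> d\<^sub>x\<^sup>4 / d\<^sup>2\<close>, which the choice of the approximate
  coefficients keeps bounded.
\<close>

lemma energy_deriv_le:
  assumes t: "0 < t" and W: "\<And>x. x \<in> {a..b} \<Longrightarrow> w x t \<le> W"
    and A: "\<epsilon> * integral {a..b} (\<lambda>x. dx x ^ 4 / (d x)\<^sup>2) \<le> 1"
  obtains e where "(energy has_real_derivative e) (at t)" "e \<le> sqrt (\<gamma>\<^sub>2 * W) / (4 * \<gamma>\<^sub>1\<^sup>2)"
proof -
  let ?r = "\<lambda>x. sqrt (g (w x t))"
  let ?Q = "\<lambda>x. (wt x t + u x t * g (w x t)) / \<epsilon>"
  let ?I1 = "\<lambda>x. (dx x * u x t + d x * ux x t) / (d x * u x t)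
        * (dx x * u x t + d x * ux x t - d x * u x t * wx x t)"
  let ?f' = "\<lambda>x. ux x t * ?r x + u x t * (g' (w x t) * wx x t / (2 * ?r x))"
  let ?q = "\<lambda>x. d x * wx x t / ?r x"
  let ?I2 = "\<lambda>x. \<epsilon> * (?Q x)\<^sup>2 / ?r x + ?q x * ?f' x"
  let ?I3 = "\<lambda>x. (dx x)\<^sup>2 / d x * wt x t"
  note [simp] = nonzero less_imp_le[OF t] t
  have gp: "0 < g (w x t)" "0 < w x t" "0 < ?r x" if "x \<in> {a..b}" for x
    using g_pos[OF w_pos[of x t]] w_pos[of x t] that by auto
  have ibp: "integral {a..b} (\<lambda>x. u x t * ?r x * ?Q x) = - integral {a..b} (\<lambda>x. ?f' x * ?q x)"
  proof (rule ibp_vanishing_flux)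
    show "((\<lambda>x. u x t * ?r x) has_real_derivative ?f' x) (at x within {a..b})" if x: "x \<in> {a..b}" for x
    proof -
      have g: "((\<lambda>x. g (w x t)) has_real_derivative g' (w x t) * wx x t) (at x within {a..b})"
        by (rule DERIV_chain2[OF g_deriv w_x]) (use gp x in auto)
      have "((\<lambda>x. ?r x) has_real_derivative inverse (?r x) / 2 * (g' (w x t) * wx x t)) (at x within {a..b})"
        by (rule DERIV_chain2[OF DERIV_real_sqrt g]) (use gp[OF x] in simp)
      from DERIV_mult[OF u_x[OF x t] this] show ?thesis
        by (simp add: field_simps)
    qed
  qed (use ab eps in \<open>auto intro!: w_flux continuous_intros slice_facts d_cont dx_cont
        simp: wx_bdry\<close>)
  have I2: "integral {a..b} (\<lambda>x. ?Q x * (wt x t / ?r x)) = integral {a..b} ?I2"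
  proof -
    have "integral {a..b} (\<lambda>x. ?Q x * (wt x t / ?r x))
        = integral {a..b} (\<lambda>x. \<epsilon> * (?Q x)\<^sup>2 / ?r x - u x t * ?r x * ?Q x)"
    proof (rule integral_cong)
      fix x assume x: "x \<in> {a..b}"
      have e: "wt x t = \<epsilon> * ?Q x - u x t * (?r x)\<^sup>2" using eps gp[OF x] by simp
      have "?Q x * (wt x t / ?r x) = ?Q x * ((\<epsilon> * ?Q x - u x t * (?r x)\<^sup>2) / ?r x)"
        using arg_cong[OF e, of "\<lambda>v. ?Q x * (v / ?r x)"] .
      also have "\<dots> = \<epsilon> * (?Q x)\<^sup>2 / ?r x - u x t * ?r x * ?Q x"
      proof -
        have "Q * ((\<epsilon> * Q - v * r\<^sup>2) / r) = \<epsilon> * Q\<^sup>2 / r - v * r * Q" if "r \<noteq> 0" for Q v r :: real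
          using that by (simp add: field_simps power2_eq_square)
        from this[of "?r x" "?Q x" "u x t"] gp(3)[OF x] show ?thesis by fastforce
      qed
      finally show "?Q x * (wt x t / ?r x) = \<epsilon> * (?Q x)\<^sup>2 / ?r x - u x t * ?r x * ?Q x" .
    qed
    also have "\<dots> = integral {a..b} (\<lambda>x. \<epsilon> * (?Q x)\<^sup>2 / ?r x) - integral {a..b} (\<lambda>x. u x t * ?r x * ?Q x)"
      by (rule integral_diff) (use eps in \<open>auto intro!: integrable_continuous_real
          continuous_intros slice_facts\<close>)
    also have "\<dots> = integral {a..b} (\<lambda>x. \<epsilon> * (?Q x)\<^sup>2 / ?r x) + integral {a..b} (\<lambda>x. ?q x * ?f' x)"
      unfolding ibp by (simp add: mult.commute)
    also have "\<dots> = integral {a..b} ?I2"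
      by (rule integral_add[symmetric]) (use eps in \<open>auto intro!: integrable_continuous_real
          continuous_intros slice_facts d_cont\<close>)
    finally show ?thesis .
  qed
  define e where "e = - integral {a..b} ?I1 + - integral {a..b} ?I2 + integral {a..b} ?I3 / \<gamma>\<^sub>1"
  have "(energy has_real_derivative e) (at t)"
    unfolding energy_def[abs_def] e_def I2[symmetric]
    by (intro DERIV_add DERIV_cdivide mass_entropy_deriv gradient_energy_deriv
        weighted_nutrient_deriv t)
  moreover have "e \<le> sqrt (\<gamma>\<^sub>2 * W) / (4 * \<gamma>\<^sub>1\<^sup>2)"
  proof -
    have "e = integral {a..b} (\<lambda>x. - ?I1 x - ?I2 x + ?I3 x / \<gamma>\<^sub>1)"
    proof -
      have "integral {a..b} (\<lambda>x. - ?I1 x - ?I2 x + ?I3 x / \<gamma>\<^sub>1)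
          = integral {a..b} (\<lambda>x. - ?I1 x - ?I2 x) + integral {a..b} (\<lambda>x. ?I3 x / \<gamma>\<^sub>1)"
        by (rule integral_add; rule integrable_continuous_real) (use \<gamma> eps in \<open>auto intro!: continuous_intros slice_facts d_cont dx_cont\<close>)
      also have "integral {a..b} (\<lambda>x. - ?I1 x - ?I2 x) = integral {a..b} (\<lambda>x. - ?I1 x) - integral {a..b} ?I2"
        by (rule integral_diff; rule integrable_continuous_real)
          (use eps in \<open>auto intro!: continuous_intros slice_facts d_cont dx_cont\<close>)
      finally show ?thesis unfolding e_def by (simp only: integral_neg integral_divide)
    qed
    also have "\<dots> \<le> integral {a..b} (\<lambda>x. \<epsilon> / (4 * \<gamma>\<^sub>1\<^sup>2) * (dx x ^ 4 / (d x)\<^sup>2 * sqrt (\<gamma>\<^sub>2 * W)))"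
    proof (rule integral_mono_cont)
      fix x assume x: "x \<in> {a..b}"
      have "- ?I1 x - ?I2 x + ?I3 x / \<gamma>\<^sub>1 \<le> \<epsilon> / (4 * \<gamma>\<^sub>1\<^sup>2) * (dx x ^ 4 / (d x)\<^sup>2 * ?r x)"
        using gp[OF x] x eps \<gamma> by (intro energy_integrand_le) (auto intro: d_pos u_pos g'_lower)
      also have "\<dots> \<le> \<epsilon> / (4 * \<gamma>\<^sub>1\<^sup>2) * (dx x ^ 4 / (d x)\<^sup>2 * sqrt (\<gamma>\<^sub>2 * W))"
      proof -
        have "\<gamma>\<^sub>2 * w x t \<le> \<gamma>\<^sub>2 * W" using W[OF x] \<gamma> by (intro mult_left_mono) auto
        then have "g (w x t) \<le> \<gamma>\<^sub>2 * W" using g_bounds(2)[OF gp(2)[OF x]] by linarith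
        then show ?thesis using \<gamma> eps by (intro mult_left_mono real_sqrt_le_mono) auto
      qed
      finally show "- ?I1 x - ?I2 x + ?I3 x / \<gamma>\<^sub>1 \<le> \<epsilon> / (4 * \<gamma>\<^sub>1\<^sup>2) * (dx x ^ 4 / (d x)\<^sup>2 * sqrt (\<gamma>\<^sub>2 * W))" .
    qed (use \<gamma> eps in \<open>auto intro!: continuous_intros slice_facts d_cont dx_cont\<close>)
    also have "\<dots> = (\<epsilon> * integral {a..b} (\<lambda>x. dx x ^ 4 / (d x)\<^sup>2)) * (sqrt (\<gamma>\<^sub>2 * W) / (4 * \<gamma>\<^sub>1\<^sup>2))"
      by (simp flip: integral_mult_right add: field_simps)
    also have "\<dots> \<le> 1 * (sqrt (\<gamma>\<^sub>2 * W) / (4 * \<gamma>\<^sub>1\<^sup>2))"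
    proof (rule mult_right_mono[OF A])
      have "0 \<le> W" using W[of a] w_pos[of a t] ab t by force
      then show "0 \<le> sqrt (\<gamma>\<^sub>2 * W) / (4 * \<gamma>\<^sub>1\<^sup>2)" using \<gamma> by simp
    qed
    finally show ?thesis by simp
  qed
  ultimately show ?thesis by (rule that)
qed

text \<open>
  The energy bounds its second term because the other two are bounded below: \<open>v ln v \<ge> -1\<close> gives
  \<open>\<integral> u ln (d u) \<ge> - \<integral> 1/d\<close>.
\<close>

lemma gradient_energy_le:
  assumes s: "0 < s" "s \<le> t" and W: "\<And>x r. x \<in> {a..b} \<Longrightarrow> s \<le> r \<Longrightarrow> r \<le> t \<Longrightarrow> w x r \<le> W"
    and A: "\<epsilon> * integral {a..b} (\<lambda>x. dx x ^ 4 / (d x)\<^sup>2) \<le> 1"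
  shows "gradient_energy t \<le> energy s + sqrt (\<gamma>\<^sub>2 * W) / (4 * \<gamma>\<^sub>1\<^sup>2) * (t - s)
    + integral {a..b} (\<lambda>x. 1 / d x)"
proof -
  have "\<exists>e. \<forall>r\<in>{s..t}. (energy has_real_derivative e r) (at r) \<and> e r \<le> sqrt (\<gamma>\<^sub>2 * W) / (4 * \<gamma>\<^sub>1\<^sup>2)"
  proof (intro bchoice ballI)
    fix r assume r: "r \<in> {s..t}"
    show "\<exists>e. (energy has_real_derivative e) (at r) \<and> e \<le> sqrt (\<gamma>\<^sub>2 * W) / (4 * \<gamma>\<^sub>1\<^sup>2)"
      by (rule energy_deriv_le[of r W]) (use r s W A in auto)
  qed
  then obtain e where "\<And>r. s \<le> r \<Longrightarrow> r \<le> t \<Longrightarrow> (energy has_real_derivative e r) (at r)"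
    "\<And>r. s \<le> r \<Longrightarrow> r \<le> t \<Longrightarrow> e r \<le> sqrt (\<gamma>\<^sub>2 * W) / (4 * \<gamma>\<^sub>1\<^sup>2)"
    by (metis atLeastAtMost_iff)
  from increment_le_of_deriv_le[OF s(2) this]
  have 1: "energy t \<le> energy s + sqrt (\<gamma>\<^sub>2 * W) / (4 * \<gamma>\<^sub>1\<^sup>2) * (t - s)" .
  have t: "0 < t" using s by simp
  have 2: "- integral {a..b} (\<lambda>x. 1 / d x) \<le> mass_entropy t"
  proof -
    have "integral {a..b} (\<lambda>x. - (1 / d x)) \<le> mass_entropy t" unfolding mass_entropy_def
    proof (rule integral_mono_cont)
      fix x assume x: "x \<in> {a..b}"
      have p: "0 < d x" "0 < u x t" using d_pos u_pos x t by auto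
      have "- ln (d x * u x t) \<le> 1 / (d x * u x t) - 1"
        using ln_le_minus_one[of "1 / (d x * u x t)"] p by (simp add: ln_div)
      then have "- (d x * u x t) * ln (d x * u x t) \<le> 1 - d x * u x t"
        using p mult_left_mono[of "- ln (d x * u x t)" "1 / (d x * u x t) - 1" "d x * u x t"]
        by (simp add: algebra_simps)
      also have "\<dots> \<le> 1" using p by simp
      finally show "- (1 / d x) \<le> u x t * ln (d x * u x t)" using p by (simp add: field_simps)
    qed (use t in \<open>auto intro!: continuous_intros slice_facts d_cont simp: nonzero\<close>)
    then show ?thesis by simp
  qed
  have 3: "0 \<le> weighted_nutrient t / \<gamma>\<^sub>1"
    unfolding weighted_nutrient_def using t \<gamma> d_pos w_pos
    by (intro divide_nonneg_nonneg integral_nonneg_cont continuous_intros slice_facts d_cont dx_cont)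
      (auto simp: nonzero less_imp_le)
  show ?thesis using 1 2 3 unfolding energy_def by linarith
qed

end

section \<open>The quotient of the nutrient and the diffusion coefficient\<close>

lemma exponential_growth_bound:
  fixes f e :: "real \<Rightarrow> real"
  assumes t: "0 \<le> t" and cf: "continuous_on {0..t} f"
    and f: "\<And>r. 0 < r \<Longrightarrow> r < t \<Longrightarrow> (f has_real_derivative e r) (at r)"
    and e: "\<And>r. 0 < r \<Longrightarrow> r < t \<Longrightarrow> e r \<le> k * f r"
  shows "f t \<le> f 0 * exp (k * t)"
proof (cases "t = 0")
  case False
  have "f t * exp (- k * t) \<le> f 0 * exp (- k * 0)"
  proof (rule DERIV_nonpos_imp_decreasing_open[where a = 0 and b = t and f = "\<lambda>r. f r * exp (- k * r)"])
    show "\<exists>y. ((\<lambda>r. f r * exp (- k * r)) has_real_derivative y) (at r) \<and> y \<le> 0"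
      if "0 < r" "r < t" for r
    proof (intro exI conjI)
      show "((\<lambda>r. f r * exp (- k * r)) has_real_derivative (e r - k * f r) * exp (- k * r)) (at r)"
        by (auto intro!: derivative_eq_intros f that simp: algebra_simps)
      show "(e r - k * f r) * exp (- k * r) \<le> 0"
        using e[OF that] by (simp add: mult_nonpos_nonneg)
    qed
  qed (use t in \<open>auto intro!: continuous_intros cf\<close>)
  then show ?thesis by (simp add: exp_minus field_simps)
qed simp

text \<open>
  The integrand in the time derivative of \<open>\<integral> (w / d)\<^sup>p\<close> for \<open>p = n + 2\<close>. The diffusion term
  contains a good multiple of \<open>w\<^sub>x\<^sup>2\<close> that absorbs the mixed term \<open>d\<^sub>x w\<^sub>x\<close> by Young's
  inequality. The remainder is a multiple of \<open>\<epsilon> d\<^sub>x\<^sup>2 / (d \<surd>g)\<close>, where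
  \<open>\<epsilon> d\<^sub>x\<^sup>2 \<le> \<surd>\<epsilon> d\<^sup>2\<close> and \<open>\<surd>g \<ge> \<surd>(\<gamma> w)\<close>; it thus carries the small factor
  \<open>e\<^sup>2 = \<surd>\<epsilon>\<close>, and the half power of \<open>w / d\<close> lost to \<open>\<surd>g\<close> only lowers the exponent.
\<close>

lemma ratio_integrand_le:
  fixes d dx u w wx g \<epsilon> \<gamma> D e :: real and n :: nat
  assumes pos: "0 < d" "0 < u" "0 < w" "0 < \<gamma>" "0 < e" and \<epsilon>: "\<epsilon> = e ^ 4" and D: "d \<le> D"
    and g: "\<gamma> * w \<le> g" and dx: "e * \<bar>dx\<bar> \<le> d"
  shows "- (\<epsilon> * (real (n + 2) * (w / d) ^ n / d\<^sup>2 * (real (n + 1) * wx - real (n + 2) * (w / d) * dx)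
        * (d * wx / sqrt g)))
      - real (n + 2) * (w / d) ^ (n + 1) / d * (u * g)
    \<le> (real (n + 2))\<^sup>2 / 2 * e\<^sup>2 * sqrt (D / \<gamma>) * (1 + (w / d) ^ (n + 2))"
proof -
  define R m where "R = w / d" and "m = real n + 1"
  have R: "0 < R" and m: "1 \<le> m" using pos by (auto simp: R_def m_def)
  have g0: "0 < g" using g pos by (meson less_le_trans mult_pos_pos)
  have sq: "0 < sqrt g" using g0 by simp
  have 1: "- (real (n + 2) * R ^ n / d\<^sup>2 * (real (n + 1) * wx - real (n + 2) * R * dx) * (d * wx / sqrt g))
      \<le> (real (n + 2))\<^sup>2 / 2 * R ^ (n + 2) * dx\<^sup>2 / (d * sqrt g)"
  proof -
    have "(m + 1) * R * dx * wx - m * wx\<^sup>2 \<le> (m + 1) / 2 * R\<^sup>2 * dx\<^sup>2"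
    proof -
      define X where "X = R * dx"
      have "m * ((m + 1) * X * wx - m * wx\<^sup>2) = ((m + 1) / 2 * X)\<^sup>2 - (m * wx - (m + 1) / 2 * X)\<^sup>2"
        by (simp add: power2_eq_square field_simps)
      also have "\<dots> \<le> ((m + 1) / 2 * X)\<^sup>2" by simp
      also have "\<dots> \<le> m * ((m + 1) / 2 * X\<^sup>2)"
      proof -
        have "m * ((m + 1) / 2 * X\<^sup>2) - ((m + 1) / 2 * X)\<^sup>2 = (m + 1) * (m - 1) / 4 * X\<^sup>2"
          by (simp add: power2_eq_square field_simps)
        moreover have "0 \<le> (m + 1) * (m - 1) / 4 * X\<^sup>2" using m by simp
        ultimately show ?thesis by linarith
      qed
      finally have "(m + 1) * X * wx - m * wx\<^sup>2 \<le> (m + 1) / 2 * X\<^sup>2"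
        using m by (simp add: mult_le_cancel_left)
      then show ?thesis by (simp add: X_def power_mult_distrib mult_ac)
    qed
    then have "(m + 1) * R ^ n / (d * sqrt g) * ((m + 1) * R * dx * wx - m * wx\<^sup>2)
        \<le> (m + 1) * R ^ n / (d * sqrt g) * ((m + 1) / 2 * R\<^sup>2 * dx\<^sup>2)"
      using m R pos sq by (intro mult_left_mono) auto
    moreover have "- ((m + 1) * R ^ n / d\<^sup>2 * (m * wx - (m + 1) * R * dx) * (d * wx / sqrt g))
        = (m + 1) * R ^ n / (d * sqrt g) * ((m + 1) * R * dx * wx - m * wx\<^sup>2)"
      using pos sq by (simp add: power2_eq_square field_simps)
    moreover have "(m + 1)\<^sup>2 / 2 * R ^ (n + 2) * dx\<^sup>2 / (d * sqrt g)
        = (m + 1) * R ^ n / (d * sqrt g) * ((m + 1) / 2 * R\<^sup>2 * dx\<^sup>2)"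
      by (simp add: power2_eq_square mult_ac)
    moreover have "real (n + 2) = m + 1" "real (n + 1) = m" by (simp_all add: m_def)
    ultimately show ?thesis by metis
  qed
  have 2: "\<epsilon> * dx\<^sup>2 \<le> e\<^sup>2 * d\<^sup>2"
  proof -
    have "(e * \<bar>dx\<bar>)\<^sup>2 \<le> d\<^sup>2" using dx pos by (intro power_mono) auto
    then have "e\<^sup>2 * (e\<^sup>2 * dx\<^sup>2) \<le> e\<^sup>2 * d\<^sup>2" by (intro mult_left_mono) (auto simp: power_mult_distrib)
    then show ?thesis by (simp add: \<epsilon> power2_eq_square power4_eq_xxxx mult_ac)
  qed
  have 3: "R ^ (n + 2) * d / sqrt g \<le> sqrt (D / \<gamma>) * (1 + R ^ (n + 2))"
  proof -
    have "sqrt (\<gamma> * (R * d)) \<le> sqrt g" using g pos by (simp add: R_def)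
    then have "d / sqrt g \<le> d / sqrt (\<gamma> * (R * d))"
      using pos R sq by (intro divide_left_mono) auto
    also have "\<dots> = sqrt (d / \<gamma>) / sqrt R"
      using pos R by (simp add: real_sqrt_mult real_sqrt_divide field_simps)
    also have "\<dots> \<le> sqrt (D / \<gamma>) / sqrt R"
      using pos R D by (intro divide_right_mono real_sqrt_le_mono) auto
    finally have "R ^ (n + 2) * (d / sqrt g) \<le> R ^ (n + 2) * (sqrt (D / \<gamma>) / sqrt R)"
      using R by (intro mult_left_mono) auto
    also have "\<dots> = sqrt (D / \<gamma>) * (R ^ (n + 1) * sqrt R)"
      using R by (simp add: field_simps)
    also have "\<dots> \<le> sqrt (D / \<gamma>) * (1 + R ^ (n + 2))"
    proof (rule mult_left_mono)
      show "R ^ (n + 1) * sqrt R \<le> 1 + R ^ (n + 2)"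
      proof (cases "R \<le> 1")
        case True
        have "R ^ (n + 1) * sqrt R \<le> 1 * 1"
          using True R by (intro mult_mono power_le_one) (auto simp: real_sqrt_le_1_iff)
        moreover have "0 \<le> R ^ (n + 2)" using R by simp
        ultimately show ?thesis by linarith
      next
        case False
        have "R * 1 \<le> R * R" using False by (intro mult_left_mono) auto
        then have "sqrt R \<le> sqrt (R * R)" by (intro real_sqrt_le_mono) simp
        then have "sqrt R \<le> R" using R by simp
        then have "R ^ (n + 1) * sqrt R \<le> R ^ (n + 1) * R" using R by (intro mult_left_mono) auto
        then show ?thesis by (simp add: mult_ac)
      qed
    qed (use pos D in simp)
    finally show ?thesis by simp
  qed
  have "\<epsilon> * (- (real (n + 2) * R ^ n / d\<^sup>2 * (real (n + 1) * wx - real (n + 2) * R * dx) * (d * wx / sqrt g)))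
      \<le> \<epsilon> * ((real (n + 2))\<^sup>2 / 2 * R ^ (n + 2) * dx\<^sup>2 / (d * sqrt g))"
    using 1 pos by (intro mult_left_mono) (auto simp: \<epsilon>)
  also have "\<dots> = (real (n + 2))\<^sup>2 / 2 * R ^ (n + 2) / (d * sqrt g) * (\<epsilon> * dx\<^sup>2)" by simp
  also have "\<dots> \<le> (real (n + 2))\<^sup>2 / 2 * R ^ (n + 2) / (d * sqrt g) * (e\<^sup>2 * d\<^sup>2)"
    using 2 R pos sq by (intro mult_left_mono) auto
  also have "\<dots> = (real (n + 2))\<^sup>2 / 2 * e\<^sup>2 * (R ^ (n + 2) * d / sqrt g)"
    using pos by (simp add: power2_eq_square)
  also have "\<dots> \<le> (real (n + 2))\<^sup>2 / 2 * e\<^sup>2 * (sqrt (D / \<gamma>) * (1 + R ^ (n + 2)))"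
    using 3 by (intro mult_left_mono) auto
  finally have "\<epsilon> * (- (real (n + 2) * R ^ n / d\<^sup>2 * (real (n + 1) * wx - real (n + 2) * R * dx) * (d * wx / sqrt g)))
    \<le> (real (n + 2))\<^sup>2 / 2 * e\<^sup>2 * sqrt (D / \<gamma>) * (1 + R ^ (n + 2))" by (simp add: mult.assoc)
  moreover have "0 \<le> real (n + 2) * R ^ (n + 1) / d * (u * g)" using R pos g0 by simp
  ultimately show ?thesis unfolding R_def by simp
qed

context taxis_solution
begin

text \<open>
  A comparison of \<open>w\<close> with multiples of \<open>d\<close> would need a bound on the second derivative of
  \<open>d\<close>, of which nothing is known. The integrals of \<open>(w / d)\<^sup>p\<close> however grow only with a rate
  proportional to \<open>p\<^sup>2 \<surd>\<epsilon>\<close>, so for \<open>p \<le> 1 / \<surd>\<epsilon>\<close> the norm of \<open>w / d\<close> in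
  \<open>L\<^sup>p\<close> stays bounded uniformly in \<open>\<epsilon>\<close> if it is at time \<open>0\<close>. The length \<open>b - a\<close> is added on both sides to make the
  differential inequality for the integral homogeneous.
\<close>

lemma ratio_power_le:
  fixes n :: nat
  assumes t: "0 \<le> t" and e: "0 < e" "\<epsilon> = e ^ 4"
    and D: "\<And>x. x \<in> {a..b} \<Longrightarrow> d x \<le> D" and dxd: "\<And>x. x \<in> {a..b} \<Longrightarrow> e * \<bar>dx x\<bar> \<le> d x"
  shows "integral {a..b} (\<lambda>x. (w x t / d x) ^ (n + 2)) + (b - a)
    \<le> (integral {a..b} (\<lambda>x. (w x 0 / d x) ^ (n + 2)) + (b - a))
      * exp ((real (n + 2))\<^sup>2 / 2 * e\<^sup>2 * sqrt (D / \<gamma>\<^sub>1) * t)"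
proof -
  let ?y = "\<lambda>t. integral {a..b} (\<lambda>x. (w x t / d x) ^ (n + 2))"
  let ?k = "(real (n + 2))\<^sup>2 / 2 * e\<^sup>2 * sqrt (D / \<gamma>\<^sub>1)"
  let ?f = "\<lambda>t x. real (n + 2) * (w x t / d x) ^ (n + 1) / d x"
  let ?Q = "\<lambda>t x. (wt x t + u x t * g (w x t)) / \<epsilon>"
  let ?f' = "\<lambda>t x. real (n + 2) * (w x t / d x) ^ n / (d x)\<^sup>2
        * (real (n + 1) * wx x t - real (n + 2) * (w x t / d x) * dx x)"
  let ?q = "\<lambda>t x. d x * wx x t / sqrt (g (w x t))"
  show ?thesis
  proof (rule exponential_growth_bound[where f = "\<lambda>t. ?y t + (b - a)"
        and e = "\<lambda>t. integral {a..b} (\<lambda>x. ?f t x * wt x t)"])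
    have "continuous_on {0..} ?y"
      by (rule continuous_on_integral_time)
        (auto simp: split_beta' nonzero intro!: continuous_intros joint_cont0)
    then show "continuous_on {0..t} (\<lambda>t. ?y t + (b - a))"
      by (intro continuous_intros) (auto elim: continuous_on_subset)
    fix r :: real assume r: "0 < r"
    note [simp] = nonzero less_imp_le[OF r] r
    have "(?y has_real_derivative integral {a..b} (\<lambda>x. ?f r x * wt x r)) (at r)"
    proof (rule has_derivative_integral_time[OF _ _ _ r])
      show "((\<lambda>s. (w x s / d x) ^ (n + 2)) has_real_derivative ?f s x * wt x s) (at s)"
        if "x \<in> {a..b}" "0 < s" for x s
        using DERIV_power[OF DERIV_cdivide[OF w_t[OF that]], of "d x" "n + 2"] by (simp add: mult_ac)
    qed (auto simp: split_beta' nonzero intro!: continuous_intros joint_cont)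
    then show "((\<lambda>t. ?y t + (b - a)) has_real_derivative integral {a..b} (\<lambda>x. ?f r x * wt x r)) (at r)"
      by (auto intro!: derivative_eq_intros)
    have ibp: "integral {a..b} (\<lambda>x. ?f r x * ?Q r x) = - integral {a..b} (\<lambda>x. ?f' r x * ?q r x)"
    proof (rule ibp_vanishing_flux)
      show "(?f r has_real_derivative ?f' r x) (at x within {a..b})" if x: "x \<in> {a..b}" for x
      proof -
        have R: "((\<lambda>x. w x r / d x) has_real_derivative wx x r / d x - w x r * dx x / (d x)\<^sup>2) (at x within {a..b})"
          using x d_pos[OF x]
          by (auto intro!: derivative_eq_intros w_x d_deriv simp: field_simps power2_eq_square)
        have alg: "(N * (k * ((\<omega>x / \<delta> - \<omega> * \<delta>x / \<delta>\<^sup>2) * P)) * \<delta> - N * Q * \<delta>x) / (\<delta> * \<delta>)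
            = N * P / \<delta>\<^sup>2 * (k * \<omega>x - N * (\<omega> / \<delta>) * \<delta>x)"
          if "\<delta> \<noteq> 0" "N = k + 1" "Q = P * (\<omega> / \<delta>)" for N k P Q \<omega> \<omega>x \<delta> \<delta>x :: real
          unfolding that(2,3) using that(1) by (simp add: field_simps power2_eq_square)
        show ?thesis
          by (rule DERIV_cong[OF DERIV_divide[OF DERIV_cmult[OF DERIV_power[OF R]] d_deriv[OF x]]],
              use x in simp, unfold One_nat_def add_diff_cancel_right', rule alg) (use x in auto)
      qed
    qed (use ab eps in \<open>auto intro!: w_flux continuous_intros slice_facts d_cont dx_cont
          simp: wx_bdry\<close>)
    have "integral {a..b} (\<lambda>x. ?f r x * wt x r)
        = integral {a..b} (\<lambda>x. \<epsilon> * (?f r x * ?Q r x) - ?f r x * (u x r * g (w x r)))"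
      by (rule integral_cong) (use eps in \<open>simp add: field_simps\<close>)
    also have "\<dots> = integral {a..b} (\<lambda>x. \<epsilon> * (?f r x * ?Q r x)) - integral {a..b} (\<lambda>x. ?f r x * (u x r * g (w x r)))"
      by (rule integral_diff; rule integrable_continuous_real)
        (use eps in \<open>auto intro!: continuous_intros slice_facts d_cont\<close>)
    also have "integral {a..b} (\<lambda>x. \<epsilon> * (?f r x * ?Q r x)) = integral {a..b} (\<lambda>x. - (\<epsilon> * (?f' r x * ?q r x)))"
      using arg_cong[OF ibp, of "\<lambda>v. \<epsilon> * v"] by (simp only: integral_mult_right integral_neg mult_minus_right)
    also have "\<dots> - integral {a..b} (\<lambda>x. ?f r x * (u x r * g (w x r)))
        = integral {a..b} (\<lambda>x. - (\<epsilon> * (?f' r x * ?q r x)) - ?f r x * (u x r * g (w x r)))"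
      by (rule integral_diff[symmetric]; rule integrable_continuous_real)
        (auto intro!: continuous_intros slice_facts d_cont dx_cont)
    also have "\<dots> \<le> integral {a..b} (\<lambda>x. ?k * (1 + (w x r / d x) ^ (n + 2)))"
    proof (rule integral_mono_cont)
      show "- (\<epsilon> * (?f' r x * ?q r x)) - ?f r x * (u x r * g (w x r))
          \<le> ?k * (1 + (w x r / d x) ^ (n + 2))" if x: "x \<in> {a..b}" for x
        using x by (intro ratio_integrand_le d_pos u_pos w_pos \<gamma> e D g_bounds dxd) auto
    qed (auto intro!: continuous_intros slice_facts d_cont dx_cont)
    also have "\<dots> = ?k * (?y r + (b - a))"
    proof -
      have "integral {a..b} (\<lambda>x. 1 + (w x r / d x) ^ (n + 2)) = (b - a) + ?y r"
        using ab by (subst integral_add)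
          (auto intro!: integrable_continuous_real continuous_intros slice_facts d_cont)
      then show ?thesis by (simp add: add.commute)
    qed
    finally show "integral {a..b} (\<lambda>x. ?f r x * wt x r) \<le> ?k * (?y r + (b - a))" .
  qed (use t in auto)
qed

text \<open>
  The factors of the bound for \<open>w / d\<close>: the first one is the growth of the \<open>L\<^sup>p\<close> norm up to time
  \<open>T\<close>, the last one comes from the length of the interval on which \<open>w / d\<close> is at least half of
  its value at a given point, and \<open>8\<close> accounts for this half and for the \<open>p\<close>-th root of
  \<open>1 / \<epsilon> \<le> 4\<^sup>p\<close>.
\<close>

definition ratio_bound :: "real \<Rightarrow> real \<Rightarrow> real \<Rightarrow> real \<Rightarrow> real \<Rightarrow> real"
  where "ratio_bound T D M0 W E = 8 * (max 1 M0 * exp (T * sqrt (D / \<gamma>\<^sub>1) / 2)) * max 1 (2 * (b - a)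
    / min (1 / (4 * (4 * E * \<gamma>\<^sub>2 * W + 2 * W\<^sup>2 * (b - a) + 1))) ((b - a) / 2))"

text \<open>
  The gradient energy bounds \<open>w / d\<close> in a Hoelder norm that may blow up like a power of
  \<open>1 / \<epsilon>\<close>. Since the exponent \<open>p\<close> is larger than a power of \<open>1 / \<epsilon>\<close>, this power is
  harmless after taking the \<open>p\<close>-th root, and the bounds on the integrals turn into a pointwise
  bound that does not depend on \<open>\<epsilon>\<close>.
\<close>

lemma ratio_le:
  assumes t: "0 < t" "t \<le> T" and e: "0 < e" "\<epsilon> = e ^ 4" "2 * e\<^sup>2 \<le> 1"
    and D: "\<And>x. x \<in> {a..b} \<Longrightarrow> d x \<le> D" and d_lower: "\<And>x. x \<in> {a..b} \<Longrightarrow> e \<le> d x"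
    and dxd: "\<And>x. x \<in> {a..b} \<Longrightarrow> e * \<bar>dx x\<bar> \<le> d x"
    and M0: "integral {a..b} (\<lambda>x. (w x 0 / d x) ^ nat \<lfloor>1 / e\<^sup>2\<rfloor>) \<le> (b - a) * (max 1 M0) ^ nat \<lfloor>1 / e\<^sup>2\<rfloor>"
    and W: "\<And>x. x \<in> {a..b} \<Longrightarrow> w x t \<le> W" and E: "gradient_energy t \<le> E"
    and x: "x \<in> {a..b}"
  shows "w x t / d x \<le> ratio_bound T D M0 W E"
proof -
  define H c B C0 where "H = 4 * E * \<gamma>\<^sub>2 * W + 2 * W\<^sup>2 * (b - a)"
    and "c = min (1 / (4 * (H + 1))) ((b - a) / 2)"
    and "B = max 1 M0 * exp (T * sqrt (D / \<gamma>\<^sub>1) / 2)"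
    and "C0 = max 1 (2 * (b - a) / c)"
  note [simp] = nonzero t(1) less_imp_le[OF t(1)]
  have gp: "0 < g (w x t)" "0 < w x t" if "x \<in> {a..b}" for x
    using g_pos[OF w_pos[of x t]] w_pos[of x t] that by auto
  have T0: "0 < T" using t by (rule less_le_trans)
  have W0: "0 < W" using W[of a] w_pos[of a t] ab by force
  have D0: "0 < D" using D[of a] d_pos[of a] ab by force
  \<comment> \<open>the largest exponent for which \<open>p\<^sup>2 \<surd>\<epsilon>\<close> is at most \<open>p\<close>, the growth that a
     \<open>p\<close>-th root turns into a constant\<close>
  define p where "p = nat \<lfloor>1 / e\<^sup>2\<rfloor>"
  have e2: "2 \<le> 1 / e\<^sup>2" using e by (simp add: field_simps)
  have p2: "2 \<le> p" unfolding p_def using e2 by (simp add: le_nat_iff le_floor_iff)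
  have pe: "real p * e\<^sup>2 \<le> 1"
  proof -
    have "real p \<le> 1 / e\<^sup>2" unfolding p_def using e2 by linarith
    then show ?thesis using e by (simp add: field_simps)
  qed
  have e4: "1 / \<epsilon> \<le> 4 ^ p"
  proof -
    have p2': "real p + 1 \<le> 2 ^ p"
      using Suc_leI[OF less_exp[of p]] by (metis Suc_eq_plus1 of_nat_1 of_nat_add of_nat_le_iff of_nat_numeral of_nat_power)
    have "1 / e\<^sup>2 \<le> real p + 1" unfolding p_def using e2 by linarith
    also note p2'
    finally have "(1 / e\<^sup>2)\<^sup>2 \<le> (2 ^ p)\<^sup>2" by (intro power_mono) auto
    also have "((2::real) ^ p)\<^sup>2 = 4 ^ p" by (simp add: power2_eq_square flip: power_mult_distrib)
    finally show ?thesis by (simp add: e(2) power_divide flip: power_mult)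
  qed
  have E0: "0 \<le> E"
  proof -
    have "0 \<le> gradient_energy t" unfolding gradient_energy_def using gp d_pos
      by (intro mult_nonneg_nonneg integral_nonneg_cont continuous_intros slice_facts d_cont)
        (auto simp: less_imp_le)
    then show ?thesis using E by simp
  qed
  have H0: "0 \<le> H" unfolding H_def using E0 W0 \<gamma> ab by (intro add_nonneg_nonneg mult_nonneg_nonneg) auto
  have c0: "0 < c" "c * H \<le> 1 / 4" "c \<le> (b - a) / 2"
  proof -
    show "0 < c" using H0 ab by (auto simp: c_def)
    show "c \<le> (b - a) / 2" unfolding c_def by (rule min.cobounded2)
    have "c * H \<le> 1 / (4 * (H + 1)) * H" using H0 by (intro mult_right_mono) (auto simp: c_def)
    also have "\<dots> \<le> 1 / 4" using H0 by (simp add: field_simps)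
    finally show "c * H \<le> 1 / 4" .
  qed
  have B1: "1 \<le> B"
  proof -
    have "1 * 1 \<le> max 1 M0 * exp (T * sqrt (D / \<gamma>\<^sub>1) / 2)"
      using T0 D0 \<gamma> by (intro mult_mono) auto
    then show ?thesis by (simp add: B_def)
  qed
  have eps1: "\<epsilon> \<le> 1"
  proof -
    have "(e\<^sup>2)\<^sup>2 \<le> 1\<^sup>2" using e by (intro power_mono) auto
    then show ?thesis by (simp add: e(2) flip: power_mult)
  qed
  have goal: "ratio_bound T D M0 W E = 8 * B * C0"
    unfolding ratio_bound_def B_def C0_def c_def H_def by simp
  have int_p: "integral {a..b} (\<lambda>x. (w x t / d x) ^ p) \<le> 2 * (b - a) * B ^ p"
  proof -
    obtain n where n: "p = n + 2" using p2 le_Suc_ex[of 2 p] by (metis add.commute)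
    have "integral {a..b} (\<lambda>x. (w x t / d x) ^ p) \<le> integral {a..b} (\<lambda>x. (w x t / d x) ^ p) + (b - a)"
      using ab by simp
    also have "\<dots> \<le> (integral {a..b} (\<lambda>x. (w x 0 / d x) ^ p) + (b - a))
        * exp ((real p)\<^sup>2 / 2 * e\<^sup>2 * sqrt (D / \<gamma>\<^sub>1) * t)"
      unfolding n by (rule ratio_power_le[OF _ e(1,2) D dxd]) auto
    also have "\<dots> \<le> (2 * (b - a) * (max 1 M0) ^ p) * exp (T * sqrt (D / \<gamma>\<^sub>1) / 2) ^ p"
    proof (rule mult_mono)
      have M1: "(b - a) * 1 \<le> (b - a) * (max 1 M0) ^ p"
        using ab by (intro mult_left_mono one_le_power) auto
      show "integral {a..b} (\<lambda>x. (w x 0 / d x) ^ p) + (b - a) \<le> 2 * (b - a) * (max 1 M0) ^ p"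
      proof -
        have "I + c \<le> 2 * c * K" if "c * 1 \<le> c * K" "I \<le> c * K" for I c K :: real
          using that by (simp add: mult.assoc)
        from this[OF M1] M0 show ?thesis
          unfolding p_def by blast
      qed
      have "(real p * (real p * e\<^sup>2)) * (sqrt (D / \<gamma>\<^sub>1) * t) \<le> (real p * 1) * (sqrt (D / \<gamma>\<^sub>1) * T)"
        using pe t D0 \<gamma> by (intro mult_mono) auto
      then have "(real p)\<^sup>2 / 2 * e\<^sup>2 * sqrt (D / \<gamma>\<^sub>1) * t \<le> real p * (T * sqrt (D / \<gamma>\<^sub>1) / 2)"
        by (simp add: power2_eq_square mult_ac)
      then show "exp ((real p)\<^sup>2 / 2 * e\<^sup>2 * sqrt (D / \<gamma>\<^sub>1) * t) \<le> exp (T * sqrt (D / \<gamma>\<^sub>1) / 2) ^ p"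
        by (simp flip: exp_of_nat_mult)
    qed (use ab in auto)
    also have "\<dots> = 2 * (b - a) * B ^ p" by (simp add: B_def power_mult_distrib)
    finally show ?thesis .
  qed
  let ?R = "\<lambda>x. w x t / d x"
  let ?Rx = "\<lambda>x. wx x t / d x - w x t * dx x / (d x)\<^sup>2"
  have Rx_cont: "continuous_on {a..b} ?Rx" by (auto intro!: continuous_intros slice_facts d_cont dx_cont)
  have R_deriv: "(?R has_real_derivative ?Rx x) (at x within {a..b})" if x: "x \<in> {a..b}" for x
    using x d_pos[OF x] by (auto intro!: derivative_eq_intros w_x d_deriv simp: field_simps power2_eq_square)
  have int_Rx: "integral {a..b} (\<lambda>x. (?Rx x)\<^sup>2) \<le> H / \<epsilon>"
  proof -
    have "integral {a..b} (\<lambda>x. (?Rx x)\<^sup>2)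
        \<le> integral {a..b} (\<lambda>x. 2 * \<gamma>\<^sub>2 * W / \<epsilon> * (d x * (wx x t)\<^sup>2 / g (w x t)) + 2 * W\<^sup>2 / \<epsilon>)"
    proof (rule integral_mono_cont)
      fix x assume x: "x \<in> {a..b}"
      note dp = d_pos[OF x] and de = d_lower[OF x]
      have gW: "g (w x t) \<le> \<gamma>\<^sub>2 * W"
      proof -
        have "\<gamma>\<^sub>2 * w x t \<le> \<gamma>\<^sub>2 * W" using W[OF x] \<gamma> by (intro mult_left_mono) auto
        then show ?thesis using g_bounds(2)[OF gp(2)[OF x]] by linarith
      qed
      have "(?Rx x)\<^sup>2 \<le> 2 * (wx x t / d x)\<^sup>2 + 2 * (w x t * dx x / (d x)\<^sup>2)\<^sup>2"
      proof -
        have "(X - Y)\<^sup>2 \<le> 2 * X\<^sup>2 + 2 * Y\<^sup>2" for X Y :: real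
          using zero_le_power2[of "X + Y"] by (simp add: power2_eq_square algebra_simps)
        then show ?thesis .
      qed
      moreover have "(wx x t / d x)\<^sup>2 \<le> \<gamma>\<^sub>2 * W / \<epsilon> * (d x * (wx x t)\<^sup>2 / g (w x t))"
      proof -
        have "e \<le> 1"
        proof (rule ccontr)
          assume "\<not> e \<le> 1"
          then have "1\<^sup>2 < e\<^sup>2" by (intro power_strict_mono) auto
          then show False using e(3) by simp
        qed
        then have "\<epsilon> \<le> e ^ 3" unfolding e(2) using e(1) by (intro power_decreasing) auto
        also have "\<dots> \<le> d x ^ 3" using de e by (intro power_mono) auto
        finally have "g (w x t) * \<epsilon> \<le> \<gamma>\<^sub>2 * W * d x ^ 3"
          using gW gp(1)[OF x] eps \<gamma> W0 by (intro mult_mono) auto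
        then have "g (w x t) * \<epsilon> * (wx x t)\<^sup>2 \<le> \<gamma>\<^sub>2 * W * d x ^ 3 * (wx x t)\<^sup>2"
          by (rule mult_right_mono) simp
        then show ?thesis using dp gp(1)[OF x] eps
          by (simp add: field_simps power2_eq_square power3_eq_cube)
      qed
      moreover have "(w x t * dx x / (d x)\<^sup>2)\<^sup>2 \<le> W\<^sup>2 / \<epsilon>"
      proof -
        have "e\<^sup>2 * \<bar>w x t * dx x / (d x)\<^sup>2\<bar> = w x t * (e * \<bar>dx x\<bar> / d x) * (e / d x)"
          using gp(2)[OF x] dp by (simp add: abs_mult power2_eq_square)
        also have "\<dots> \<le> W * 1 * 1"
          using dxd[OF x] de dp e W[OF x] gp(2)[OF x] W0 by (intro mult_mono) auto
        finally have "(e\<^sup>2 * \<bar>w x t * dx x / (d x)\<^sup>2\<bar>)\<^sup>2 \<le> W\<^sup>2" by (intro power_mono) auto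
        then show ?thesis using e(1) by (simp add: e(2) power_mult_distrib field_simps flip: power_mult)
      qed
      moreover have "r \<le> 2 * \<gamma>\<^sub>2 * W / \<epsilon> * Z + 2 * W\<^sup>2 / \<epsilon>"
        if "r \<le> 2 * A + 2 * B" "A \<le> \<gamma>\<^sub>2 * W / \<epsilon> * Z" "B \<le> W\<^sup>2 / \<epsilon>" for r A B Z
      proof -
        have "2 * \<gamma>\<^sub>2 * W / \<epsilon> * Z + 2 * W\<^sup>2 / \<epsilon> = 2 * (\<gamma>\<^sub>2 * W / \<epsilon> * Z) + 2 * (W\<^sup>2 / \<epsilon>)" by simp
        then show ?thesis using that by linarith
      qed
      ultimately show "(?Rx x)\<^sup>2 \<le> 2 * \<gamma>\<^sub>2 * W / \<epsilon> * (d x * (wx x t)\<^sup>2 / g (w x t)) + 2 * W\<^sup>2 / \<epsilon>"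
        by blast
    qed (use eps in \<open>auto intro!: continuous_intros slice_facts d_cont dx_cont\<close>)
    also have "\<dots> = 2 * \<gamma>\<^sub>2 * W / \<epsilon> * (2 * gradient_energy t) + 2 * W\<^sup>2 / \<epsilon> * (b - a)"
    proof -
      have "integral {a..b} (\<lambda>x. 2 * \<gamma>\<^sub>2 * W / \<epsilon> * (d x * (wx x t)\<^sup>2 / g (w x t)) + 2 * W\<^sup>2 / \<epsilon>)
          = integral {a..b} (\<lambda>x. 2 * \<gamma>\<^sub>2 * W / \<epsilon> * (d x * (wx x t)\<^sup>2 / g (w x t)))
            + integral {a..b} (\<lambda>x. 2 * W\<^sup>2 / \<epsilon>)"
        by (rule integral_add; rule integrable_continuous_real)
          (use eps in \<open>auto intro!: continuous_intros slice_facts d_cont\<close>)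
      also have "integral {a..b} (\<lambda>x. 2 * \<gamma>\<^sub>2 * W / \<epsilon> * (d x * (wx x t)\<^sup>2 / g (w x t)))
          = 2 * \<gamma>\<^sub>2 * W / \<epsilon> * (2 * gradient_energy t)"
        unfolding gradient_energy_def by (subst integral_mult_right) simp
      finally show ?thesis using ab by (simp add: mult.commute)
    qed
    also have "\<dots> \<le> 2 * \<gamma>\<^sub>2 * W / \<epsilon> * (2 * E) + 2 * W\<^sup>2 / \<epsilon> * (b - a)"
      using E \<gamma> W0 eps by (intro add_mono mult_left_mono) auto
    also have "\<dots> = H / \<epsilon>" by (simp add: H_def add_divide_distrib mult_ac)
    finally show ?thesis .
  qed
  show ?thesis
  proof (cases "?R x \<le> 1")
    case True
    have "1 * 1 * 1 \<le> 8 * B * C0" using B1 by (intro mult_mono) (auto simp: C0_def)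
    then show ?thesis using True goal by simp
  next
    case False
    \<comment> \<open>on an interval of this length the oscillation of \<open>w / d\<close> is at most \<open>1/2\<close>,
       by the bound \<open>H / \<epsilon>\<close> on the integral of the squared derivative\<close>
    define l where "l = c * \<epsilon>"
    have l: "0 < l" "l \<le> (b - a) / 2"
    proof -
      show "0 < l" using c0 eps by (simp add: l_def)
      have "c * \<epsilon> \<le> c * 1" using c0 eps1 by (intro mult_left_mono) auto
      then show "l \<le> (b - a) / 2" using c0(3) unfolding l_def by linarith
    qed
    obtain s where s: "{s..s + l} \<subseteq> {a..b}" "\<And>y. y \<in> {s..s + l} \<Longrightarrow> \<bar>x - y\<bar> \<le> l"
      using half_interval_at[OF x less_imp_le[OF l(1)] l(2)] by metis
    have big: "?R x / 2 \<le> ?R y" if y: "y \<in> {s..s + l}" for y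
    proof -
      have "(?R x - ?R y)\<^sup>2 \<le> \<bar>x - y\<bar> * integral {a..b} (\<lambda>x. (?Rx x)\<^sup>2)"
        using s(1) y by (intro square_increment_le[OF R_deriv Rx_cont x]) auto
      also have "\<dots> \<le> l * (H / \<epsilon>)"
        by (rule mult_mono[OF s(2)[OF y] int_Rx])
          (use l Rx_cont in \<open>auto intro!: integral_nonneg_cont continuous_intros\<close>)
      also have "\<dots> \<le> (1 / 2)\<^sup>2" using c0(2) eps by (simp add: l_def power2_eq_square)
      finally have "\<bar>?R x - ?R y\<bar> \<le> 1 / 2" by (simp add: abs_le_square_iff[symmetric])
      moreover have "\<bar>X - Y\<bar> \<le> 1 / 2 \<Longrightarrow> \<not> X \<le> 1 \<Longrightarrow> X / 2 \<le> Y" for X Y :: real by linarith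
      ultimately show ?thesis using False by blast
    qed
    have "l * (?R x / 2) ^ p = integral {s..s + l} (\<lambda>y. (?R x / 2) ^ p)" using l by simp
    also have "\<dots> \<le> integral {s..s + l} (\<lambda>y. (?R y) ^ p)"
    proof (rule integral_mono_cont)
      show "continuous_on {s..s + l} (\<lambda>y. ?R y ^ p)"
        by (rule continuous_on_subset[OF _ s(1)]) (auto intro!: continuous_intros slice_facts d_cont)
      show "(?R x / 2) ^ p \<le> ?R y ^ p" if "y \<in> {s..s + l}" for y
        by (rule power_mono[OF big[OF that]]) (use False in simp)
    qed auto
    also have "\<dots> \<le> integral {a..b} (\<lambda>y. (?R y) ^ p)"
    proof (rule integral_subset_le[OF s(1)])
      have c: "continuous_on {a..b} (\<lambda>y. ?R y ^ p)" by (auto intro!: continuous_intros slice_facts d_cont)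
      then show "(\<lambda>y. ?R y ^ p) integrable_on {a..b}" "(\<lambda>y. ?R y ^ p) integrable_on {s..s + l}"
        using continuous_on_subset[OF c s(1)] by (auto intro: integrable_continuous_real)
      show "\<forall>y\<in>{a..b}. 0 \<le> ?R y ^ p"
        using d_pos gp(2) by (simp add: less_imp_le)
    qed
    also note int_p
    finally have "(?R x / 2) ^ p \<le> 2 * (b - a) / c * (1 / \<epsilon>) * B ^ p"
      using l c0 eps by (simp add: l_def field_simps)
    also have "\<dots> \<le> C0 ^ p * 4 ^ p * B ^ p"
    proof (intro mult_mono e4)
      have "2 * (b - a) / c \<le> C0 ^ 1" by (simp add: C0_def)
      also have "\<dots> \<le> C0 ^ p" using p2 by (intro power_increasing) (auto simp: C0_def)
      finally show "2 * (b - a) / c \<le> C0 ^ p" .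
    qed (use B1 eps in \<open>auto simp: C0_def\<close>)
    also have "\<dots> = (4 * B * C0) ^ p" by (simp add: power_mult_distrib)
    finally have "?R x / 2 \<le> 4 * B * C0"
      using B1 p2 by (subst (asm) power_mono_iff) (use False in \<open>auto simp: C0_def intro!: mult_nonneg_nonneg\<close>)
    then show ?thesis using goal by simp
  qed
qed

end

section \<open>The logarithmic estimate\<close>

text \<open>
  Solutions of \<open>y' \<ge> c y\<^sup>2 - k\<close> come back from \<open>-\<infinity>\<close> in finite time, so that after time \<open>h\<close>
  a lower bound holds whatever the initial value is.
\<close>

lemma riccati_lower_bound:
  fixes y y' :: "real \<Rightarrow> real"
  assumes h: "0 < h" and c: "0 < c" and k: "0 \<le> k" and A: "0 \<le> A"
    and y: "\<And>s. t - h \<le> s \<Longrightarrow> s \<le> t \<Longrightarrow> (y has_real_derivative y' s) (at s)"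
    and lower: "\<And>s. t - h \<le> s \<Longrightarrow> s \<le> t \<Longrightarrow> - k \<le> y' s"
    and quad: "\<And>s. t - h \<le> s \<Longrightarrow> s \<le> t \<Longrightarrow> y s \<le> - A \<Longrightarrow> c * (y s)\<^sup>2 - k \<le> y' s"
  shows "- (2 * A + 2 * k * h + 4 / (c * h)) \<le> y t"
proof (rule ccontr)
  assume neg: "\<not> ?thesis"
  \<comment> \<open>adding a linear function turns \<open>y' \<ge> -k\<close> into monotonicity and \<open>y' \<ge> c y\<^sup>2 - k\<close> into
     \<open>\<eta>' \<ge> c \<eta>\<^sup>2 / 4\<close>; then \<open>1 / \<eta>\<close> decreases at a fixed rate while remaining negative\<close>
  define \<eta> where "\<eta> s = y s + k * (s - t)" for s
  have d\<eta>: "(\<eta> has_real_derivative y' s + k) (at s)" if "t - h \<le> s" "s \<le> t" for s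
    unfolding \<eta>_def by (auto intro!: derivative_eq_intros y that)
  have ch: "0 < 4 / (c * h)" using c h by simp
  have neg': "y t < - (2 * A + 2 * k * h + 4 / (c * h))" using neg by simp
  have \<eta>_le: "\<eta> s \<le> y t" if s: "t - h \<le> s" "s \<le> t" for s
  proof -
    have "\<eta> s \<le> \<eta> t" using s(2)
    proof (rule DERIV_nonneg_imp_nondecreasing)
      fix r assume "s \<le> r" "r \<le> t"
      then show "\<exists>z. (\<eta> has_real_derivative z) (at r) \<and> 0 \<le> z"
        using d\<eta>[of r] lower[of r] s by (intro exI[of _ "y' r + k"]) auto
    qed
    then show ?thesis by (simp add: \<eta>_def)
  qed
  have kh: "0 \<le> k * h" using k h by simp
  have \<eta>_neg: "\<eta> s < 0" if s: "t - h \<le> s" "s \<le> t" for s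
    using \<eta>_le[OF s] neg' A kh ch by linarith
  have "1 / \<eta> t \<le> 1 / \<eta> (t - h) + - (c / 4) * (t - (t - h))"
  proof (rule increment_le_of_deriv_le[where f = "\<lambda>s. 1 / \<eta> s" and f' = "\<lambda>s. - ((y' s + k) / (\<eta> s)\<^sup>2)"])
    fix s assume s: "t - h \<le> s" "s \<le> t"
    show "((\<lambda>s. 1 / \<eta> s) has_real_derivative - ((y' s + k) / (\<eta> s)\<^sup>2)) (at s)"
      using \<eta>_neg[OF s] by (auto intro!: derivative_eq_intros d\<eta> s
          simp: power2_eq_square minus_divide_left)
    have "k * (t - s) \<le> k * h" using k s by (intro mult_left_mono) auto
    then have "y s \<le> \<eta> s + k * h" by (simp add: \<eta>_def algebra_simps)
    then have ys: "y s \<le> \<eta> s / 2" "\<eta> s / 2 \<le> - A"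
      using \<eta>_le[OF s] neg' A kh ch by linarith+
    have "(\<eta> s / 2)\<^sup>2 \<le> (y s)\<^sup>2"
      using ys(1) \<eta>_neg[OF s] abs_le_square_iff[of "\<eta> s / 2" "y s"] by linarith
    then have "c * (\<eta> s / 2)\<^sup>2 \<le> c * (y s)\<^sup>2" using c by (intro mult_left_mono) auto
    moreover have "y s \<le> - A" using ys by linarith
    ultimately have "c * (\<eta> s / 2)\<^sup>2 \<le> y' s + k" using quad[OF s] by linarith
    moreover have "0 < (\<eta> s)\<^sup>2" using \<eta>_neg[OF s] by simp
    ultimately show "- ((y' s + k) / (\<eta> s)\<^sup>2) \<le> - (c / 4)"
      using pos_le_divide_eq[of "(\<eta> s)\<^sup>2" "c / 4" "y' s + k"] by (simp add: power_divide)
  qed (use h in auto)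
  moreover have "1 / \<eta> (t - h) < 0" using \<eta>_neg[of "t - h"] h by simp
  moreover have "- (c / 4) * (t - (t - h)) = - (c * h / 4)" by simp
  ultimately have "1 / \<eta> t < - (c * h / 4)" by linarith
  moreover have "\<eta> t = y t" by (simp add: \<eta>_def)
  moreover have "y t < 0" using \<eta>_neg[of t] h \<open>\<eta> t = y t\<close> by simp
  ultimately have "- (4 / (c * h)) < y t"
    using c h by (simp add: field_simps)
  then show False using neg' A kh by linarith
qed

context taxis_solution
begin

text \<open>
  If \<open>w \<le> M d\<close>, then \<open>g(w) \<le> \<gamma>\<^sub>2 M d\<close>, so the weight \<open>d / g(w)\<close> in the gradient energy is
  bounded below where \<open>d\<close> alone would degenerate.
\<close>

lemma nutrient_gradient_le:
  assumes t: "0 < t" and M: "\<And>x. x \<in> {a..b} \<Longrightarrow> w x t / d x \<le> M" and E: "gradient_energy t \<le> E"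
  shows "integral {a..b} (\<lambda>x. (wx x t)\<^sup>2) \<le> 2 * \<gamma>\<^sub>2 * M * E"
proof -
  note [simp] = nonzero t less_imp_le[OF t]
  have M0: "0 < M"
    using M[of a] divide_pos_pos[OF w_pos[of a t] d_pos[of a]] ab by force
  have "integral {a..b} (\<lambda>x. (wx x t)\<^sup>2) \<le> integral {a..b} (\<lambda>x. \<gamma>\<^sub>2 * M * (d x * (wx x t)\<^sup>2 / g (w x t)))"
  proof (rule integral_mono_cont)
    fix x assume x: "x \<in> {a..b}"
    have p: "0 < d x" "0 < w x t" "0 < g (w x t)" using d_pos w_pos g_pos x by auto
    have "w x t \<le> M * d x" using M[OF x] p by (simp add: field_simps)
    then have "\<gamma>\<^sub>2 * w x t \<le> \<gamma>\<^sub>2 * (M * d x)" using \<gamma> by (intro mult_left_mono) auto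
    then have "g (w x t) \<le> \<gamma>\<^sub>2 * M * d x" using g_bounds(2)[OF p(2)] by (simp add: mult.assoc)
    then have "g (w x t) * (wx x t)\<^sup>2 \<le> \<gamma>\<^sub>2 * M * d x * (wx x t)\<^sup>2" by (rule mult_right_mono) simp
    then show "(wx x t)\<^sup>2 \<le> \<gamma>\<^sub>2 * M * (d x * (wx x t)\<^sup>2 / g (w x t))"
      using p by (simp add: field_simps)
  qed (auto intro!: continuous_intros slice_facts d_cont)
  also have "\<dots> = 2 * \<gamma>\<^sub>2 * M * gradient_energy t"
    by (subst integral_mult_right) (simp add: gradient_energy_def)
  also have "\<dots> \<le> 2 * \<gamma>\<^sub>2 * M * E" using E \<gamma> M0 by (intro mult_left_mono) auto
  finally show ?thesis .
qed

lemma mass_conserved: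
  assumes t: "0 \<le> t"
  shows "integral {a..b} (\<lambda>x. u x t) = integral {a..b} (\<lambda>x. u x 0)"
proof (cases "t = 0")
  case False
  let ?m = "\<lambda>t. integral {a..b} (\<lambda>x. u x t)"
  have "continuous_on {0..} ?m"
    by (rule continuous_on_integral_time[OF u_cont])
  then have "continuous_on {0..t} ?m" by (rule continuous_on_subset) auto
  moreover have "(?m has_real_derivative 0) (at r)" if r: "0 < r" for r
  proof -
    have "(?m has_real_derivative integral {a..b} (\<lambda>x. ut x r)) (at r)"
      by (rule has_derivative_integral_time[OF _ _ _ r])
        (auto intro: u_t ut_cont continuous_on_subset[OF u_cont])
    moreover have "integral {a..b} (\<lambda>x. 1 * ut x r)
        = - integral {a..b} (\<lambda>x. 0 * (dx x * u x r + d x * ux x r - d x * u x r * wx x r))"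
      by (rule ibp_vanishing_flux) (use ab r in \<open>auto intro!: u_flux slice_facts
        simp: dx_bdry ux_bdry wx_bdry\<close>)
    ultimately show ?thesis by simp
  qed
  ultimately show ?thesis
    using False t by (intro DERIV_isconst_end[of 0 t ?m]) auto
qed simp

abbreviation lgrad :: "real \<Rightarrow> real \<Rightarrow> real"
  where "lgrad x t \<equiv> (dx x * u x t + d x * ux x t) / (d x * u x t)"

lemma ln_deriv:
  assumes "x \<in> {a..b}" "0 < t"
  shows "((\<lambda>x. ln (d x * u x t)) has_real_derivative lgrad x t) (at x within {a..b})"
  using u_pos[OF assms] d_pos[OF assms(1)]
  by (auto intro!: derivative_eq_intros u_x d_deriv assms simp: field_simps)

text \<open>
  The derivative of the test function \<open>1 / (d u)\<close> carries a factor \<open>1 / (d u)\<close>, and this cancels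
  the factor \<open>d u\<close> of the flux: the right-hand side has no degenerate coefficient.
\<close>

lemma log_integral_deriv:
  assumes t: "0 < t"
  shows "((\<lambda>t. integral {a..b} (\<lambda>x. ln (d x * u x t) / d x)) has_real_derivative
    integral {a..b} (\<lambda>x. lgrad x t * (lgrad x t - wx x t))) (at t)"
proof -
  note [simp] = nonzero t less_imp_le[OF t]
  have "((\<lambda>t. integral {a..b} (\<lambda>x. ln (d x * u x t) / d x)) has_real_derivative
    integral {a..b} (\<lambda>x. 1 / (d x * u x t) * ut x t)) (at t)"
  proof (rule has_derivative_integral_time[OF _ _ _ t])
    show "((\<lambda>s. ln (d x * u x s) / d x) has_real_derivative 1 / (d x * u x s) * ut x s) (at s)"
      if "x \<in> {a..b}" "0 < s" for x s
      using u_pos[OF that] d_pos[OF that(1)]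
      by (auto intro!: derivative_eq_intros u_t that simp: field_simps)
  qed (auto simp: split_beta' intro!: continuous_intros joint_cont)
  also have "integral {a..b} (\<lambda>x. 1 / (d x * u x t) * ut x t)
      = - integral {a..b} (\<lambda>x. - (lgrad x t / (d x * u x t))
        * (dx x * u x t + d x * ux x t - d x * u x t * wx x t))"
  proof (rule ibp_vanishing_flux)
    show "((\<lambda>x. 1 / (d x * u x t)) has_real_derivative - (lgrad x t / (d x * u x t))) (at x within {a..b})"
      if x: "x \<in> {a..b}" for x
      using u_pos[OF x t] d_pos[OF x]
      by (auto intro!: derivative_eq_intros u_x d_deriv x simp: field_simps power2_eq_square)
  qed (use ab in \<open>auto intro!: u_flux continuous_intros slice_facts d_cont dx_cont
        simp: dx_bdry ux_bdry wx_bdry\<close>)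
  also have "\<dots> = integral {a..b} (\<lambda>x. lgrad x t / (d x * u x t)
        * (dx x * u x t + d x * ux x t - d x * u x t * wx x t))"
    by (simp flip: integral_neg)
  also have "\<dots> = integral {a..b} (\<lambda>x. lgrad x t * (lgrad x t - wx x t))"
    by (rule integral_cong) (simp add: field_simps)
  finally show ?thesis .
qed

lemma log_gradient_cont: "continuous_on {0<..} (\<lambda>t. integral {a..b} (\<lambda>x. (lgrad x t)\<^sup>2))"
  by (rule continuous_on_integral_time)
    (auto simp: split_beta' nonzero intro!: continuous_intros joint_cont)

text \<open>
  The bound of \<open>riccati_lower_bound\<close> for \<open>A = 2 L \<bar>ln (m / L)\<bar>\<close>, \<open>k = K/2\<close>, \<open>h = \<tau>/2\<close> and
  \<open>c = 1 / (8 L\<^sup>2 (b - a))\<close>.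
\<close>

definition log_lower :: "real \<Rightarrow> real \<Rightarrow> real \<Rightarrow> real \<Rightarrow> real"
  where "log_lower \<tau> K L m = 4 * L * \<bar>ln (m / L)\<bar> + K * \<tau> / 2
    + 64 * L\<^sup>2 * (b - a) / \<tau>"

text \<open>
  With \<open>v = d u\<close> and \<open>y = \<integral> (ln v) / d\<close>: conservation of mass gives a point where
  \<open>v \<ge> m / L\<close>, and from there the Hoelder bound for \<open>ln v\<close> yields a lower bound of \<open>y\<close> in terms
  of \<open>\<integral> (ln v)\<^sub>x\<^sup>2\<close>. Read in the other direction, this is the quadratic growth that the Riccati
  argument needs. The upper bound \<open>y \<le> m\<close> is \<open>ln v \<le> v\<close>. Both together bound the time
  integral of \<open>y'\<close>; the lower one also bounds \<open>\<integral> \<bar>ln v\<bar> / d\<close>, since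
  \<open>\<bar>ln v\<bar> \<le> 2 v - ln v\<close>.
\<close>

lemma log_estimate:
  assumes \<tau>: "0 < \<tau>" "\<tau> < T"
    and K: "\<And>t. 0 < t \<Longrightarrow> t \<le> T \<Longrightarrow> integral {a..b} (\<lambda>x. (wx x t)\<^sup>2) \<le> K"
    and L: "integral {a..b} (\<lambda>x. 1 / d x) \<le> L"
    and m: "integral {a..b} (\<lambda>x. u x 0) = m" "0 < m"
    and D: "\<And>x. x \<in> {a..b} \<Longrightarrow> d x \<le> D"
  defines "Y \<equiv> log_lower \<tau> K L m"
  shows "integral {\<tau>..T} (\<lambda>t. integral {a..b} (\<lambda>x. (lgrad x t)\<^sup>2)) \<le> 2 * (m + Y) + K * (T - \<tau>)"
    and "\<And>x t. x \<in> {a..b} \<Longrightarrow> \<tau> \<le> t \<Longrightarrow> t \<le> T \<Longrightarrow> \<bar>ln (d x * u x t)\<bar> ^ 3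
      \<le> 8 * (D * (2 * m + Y)) * integral {a..b} (\<lambda>x. (lgrad x t)\<^sup>2)
        + 64 * (D * (2 * m + Y)) ^ 3 / (b - a) ^ 3"
proof -
  let ?y = "\<lambda>t. integral {a..b} (\<lambda>x. ln (d x * u x t) / d x)"
  let ?y' = "\<lambda>t. integral {a..b} (\<lambda>x. lgrad x t * (lgrad x t - wx x t))"
  let ?Q = "\<lambda>t. integral {a..b} (\<lambda>x. (lgrad x t)\<^sup>2)"
  have vp: "0 < d x" "0 < u x t" "0 < d x * u x t" if "x \<in> {a..b}" "0 < t" for x t
    using d_pos u_pos that by auto
  have lgc: "continuous_on {a..b} (\<lambda>x. lgrad x t)" and lnc: "continuous_on {a..b} (\<lambda>x. ln (d x * u x t))"
    if "0 < t" for t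
    using that by (auto intro!: continuous_intros slice_facts d_cont dx_cont simp: nonzero)
  have L0: "0 < L"
  proof -
    have "0 < integral {a..b} (\<lambda>x. 1 / d x)"
    proof -
      obtain x1 where x1: "x1 \<in> {a..b}" "\<And>x. x \<in> {a..b} \<Longrightarrow> d x \<le> d x1"
        using continuous_attains_sup[of "{a..b}" d] d_cont ab by auto
      have "0 < (b - a) * (1 / d x1)" using ab d_pos[OF x1(1)] by simp
      also have "\<dots> = integral {a..b} (\<lambda>x. 1 / d x1)" using ab by simp
      also have "\<dots> \<le> integral {a..b} (\<lambda>x. 1 / d x)"
        using x1 d_pos by (intro integral_mono_cont) (auto intro!: continuous_intros d_cont
            divide_left_mono simp: nonzero)
      finally show ?thesis .
    qed
    then show ?thesis using L by simp
  qed
  have mass: "integral {a..b} (\<lambda>x. u x t) = m" if "0 < t" for t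
    using mass_conserved[of t] that m(1) by simp
  have y'_ge: "?Q t / 2 - K / 2 \<le> ?y' t" if t: "0 < t" "t \<le> T" for t
  proof -
    have "?Q t / 2 - K / 2 \<le> ?Q t / 2 - integral {a..b} (\<lambda>x. (wx x t)\<^sup>2) / 2"
      using K[OF t] by simp
    also have "\<dots> = integral {a..b} (\<lambda>x. (lgrad x t)\<^sup>2 / 2 - (wx x t)\<^sup>2 / 2)"
      using t by (subst integral_diff)
        (auto intro!: integrable_continuous_real continuous_intros slice_facts d_cont dx_cont simp: nonzero)
    also have "\<dots> \<le> ?y' t"
    proof (rule integral_mono_cont)
      show "(lgrad x t)\<^sup>2 / 2 - (wx x t)\<^sup>2 / 2 \<le> lgrad x t * (lgrad x t - wx x t)" for x
      proof -
        have "X\<^sup>2 / 2 - P\<^sup>2 / 2 \<le> X * (X - P)" for X P :: real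
          using zero_le_power2[of "X - P"] by (simp add: power2_eq_square field_simps)
        then show ?thesis .
      qed
    qed (use t in \<open>auto intro!: continuous_intros slice_facts d_cont dx_cont simp: nonzero\<close>)
    finally show ?thesis .
  qed
  have Q0: "0 \<le> ?Q t" if "0 < t" for t
    by (rule integral_nonneg_cont[OF continuous_on_power[OF lgc[OF that]]]) simp
  have K0: "0 \<le> K"
    by (rule order_trans[OF _ K[of \<tau>]], rule integral_nonneg_cont)
      (use \<tau> in \<open>auto intro!: continuous_intros slice_facts\<close>)
  have y_lower: "- (L * (\<bar>ln (m / L)\<bar> + sqrt ((b - a) * ?Q t))) \<le> ?y t" if t: "0 < t" for t
  proof -
    have "\<exists>x1\<in>{a..b}. m / L \<le> d x1 * u x1 t"
    proof (rule ccontr)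
      assume "\<not> ?thesis"
      then have less: "d x * u x t < m / L" if "x \<in> {a..b}" for x using that by force
      obtain x1 where x1: "x1 \<in> {a..b}" "\<And>x. x \<in> {a..b} \<Longrightarrow> d x * u x t \<le> d x1 * u x1 t"
      proof -
        have "continuous_on {a..b} (\<lambda>x. d x * u x t)" by (intro continuous_intros d_cont slice_facts t)
        from continuous_attains_sup[OF compact_Icc _ this] ab that show ?thesis by force
      qed
      have "m = integral {a..b} (\<lambda>x. u x t)" using mass[OF t] by simp
      also have "\<dots> \<le> integral {a..b} (\<lambda>x. d x1 * u x1 t * (1 / d x))"
        using x1 vp[OF _ t] t by (intro integral_mono_cont)
          (auto intro!: continuous_intros d_cont slice_facts simp: nonzero field_simps)
      also have "\<dots> = d x1 * u x1 t * integral {a..b} (\<lambda>x. 1 / d x)" by (rule integral_mult_right)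
      also have "\<dots> \<le> d x1 * u x1 t * L"
        using L vp[OF x1(1) t] by (intro mult_left_mono) auto
      also have "\<dots> < m / L * L"
        using less[OF x1(1)] L0 by (intro mult_strict_right_mono) auto
      finally show False using L0 by simp
    qed
    then obtain x1 where x1: "x1 \<in> {a..b}" "m / L \<le> d x1 * u x1 t" by blast
    define B where "B = \<bar>ln (m / L)\<bar> + sqrt ((b - a) * ?Q t)"
    have B0: "0 \<le> B" using Q0[OF t] ab by (simp add: B_def)
    have lnB: "- B \<le> ln (d x * u x t)" if x: "x \<in> {a..b}" for x
    proof -
      have "(ln (d x * u x t) - ln (d x1 * u x1 t))\<^sup>2 \<le> \<bar>x - x1\<bar> * ?Q t"
        by (rule square_increment_le[OF ln_deriv[OF _ t] lgc[OF t] x x1(1)])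
      also have "\<dots> \<le> (b - a) * ?Q t"
        using x x1(1) Q0[OF t] by (intro mult_right_mono) auto
      finally have "\<bar>ln (d x * u x t) - ln (d x1 * u x1 t)\<bar> \<le> sqrt ((b - a) * ?Q t)"
        by (intro real_le_rsqrt) simp
      moreover have "ln (m / L) \<le> ln (d x1 * u x1 t)"
        using x1(2) m L0 vp(3)[OF x1(1) t] by (subst ln_le_cancel_iff) auto
      moreover have "- (\<bar>Z\<bar> + S) \<le> X" if "\<bar>X - Y\<bar> \<le> S" "Z \<le> Y" for X Y Z S :: real
        using that by linarith
      ultimately show ?thesis unfolding B_def by blast
    qed
    have "- (L * B) \<le> - (integral {a..b} (\<lambda>x. 1 / d x) * B)"
      using L B0 by (simp add: mult_right_mono)
    also have "\<dots> = integral {a..b} (\<lambda>x. - (B * (1 / d x)))"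
      by (simp only: integral_neg integral_mult_right mult.commute)
    also have "\<dots> \<le> ?y t"
    proof (rule integral_mono_cont)
      show "- (B * (1 / d x)) \<le> ln (d x * u x t) / d x" if x: "x \<in> {a..b}" for x
        using lnB[OF x] vp(1)[OF x t] by (simp add: field_simps)
    qed (use lnc[OF t] in \<open>auto intro!: continuous_intros d_cont simp: nonzero\<close>)
    finally show ?thesis by (simp add: B_def)
  qed
  have Y: "- Y \<le> ?y t" if t: "\<tau> \<le> t" "t \<le> T" for t
  proof -
    define A where "A = 2 * L * \<bar>ln (m / L)\<bar>"
    define c where "c = 1 / (8 * L\<^sup>2 * (b - a))"
    have c0: "0 < c" using L0 ab by (simp add: c_def)
    have "- (2 * A + 2 * (K / 2) * (\<tau> / 2) + 4 / (c * (\<tau> / 2))) \<le> ?y t"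
    proof (rule riccati_lower_bound[where y = ?y and y' = ?y' and t = t])
      fix s assume "t - \<tau> / 2 \<le> s" "s \<le> t"
      then have s: "0 < s" "s \<le> T" using t \<tau> by auto
      show "(?y has_real_derivative ?y' s) (at s)" by (rule log_integral_deriv[OF s(1)])
      show "- (K / 2) \<le> ?y' s" using y'_ge[OF s] Q0[OF s(1)] by linarith
      assume ys: "?y s \<le> - A"
      have "- ?y s / 2 \<le> L * sqrt ((b - a) * ?Q s)"
        using y_lower[OF s(1)] ys by (simp add: A_def algebra_simps)
      moreover have "0 \<le> - ?y s / 2" using ys L0 by (simp add: A_def) (smt (verit) mult_nonneg_nonneg)
      ultimately have "(- ?y s / 2)\<^sup>2 \<le> (L * sqrt ((b - a) * ?Q s))\<^sup>2" by (intro power_mono)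
      also have "\<dots> = L\<^sup>2 * ((b - a) * ?Q s)"
        using Q0[OF s(1)] ab by (simp add: power_mult_distrib)
      finally have "(?y s)\<^sup>2 / 4 \<le> L\<^sup>2 * ((b - a) * ?Q s)" by (simp add: power_divide)
      then have "c * (?y s)\<^sup>2 \<le> ?Q s / 2" using L0 ab by (simp add: c_def field_simps)
      then show "c * (?y s)\<^sup>2 - K / 2 \<le> ?y' s" using y'_ge[OF s] by linarith
    qed (use \<tau> c0 K0 L0 in \<open>auto simp: A_def\<close>)
    moreover have "Y = 2 * A + 2 * (K / 2) * (\<tau> / 2) + 4 / (c * (\<tau> / 2))"
      using L0 ab \<tau> by (simp add: Y_def log_lower_def A_def c_def field_simps)
    ultimately show ?thesis by simp
  qed
  have ln_le: "ln (d x * u x t) \<le> d x * u x t" if "x \<in> {a..b}" "0 < t" for x t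
    using ln_le_minus_one[OF vp(3)[OF that]] by simp
  have y_upper: "?y t \<le> m" if t: "0 < t" for t
  proof -
    have "?y t \<le> integral {a..b} (\<lambda>x. u x t)"
    proof (rule integral_mono_cont)
      show "ln (d x * u x t) / d x \<le> u x t" if x: "x \<in> {a..b}" for x
        using ln_le[OF x t] vp(1)[OF x t] by (simp add: field_simps)
    qed (use t lnc[OF t] in \<open>auto intro!: continuous_intros d_cont slice_facts simp: nonzero\<close>)
    then show ?thesis using mass[OF t] by simp
  qed
  have yy: "(?y' has_integral (?y T - ?y \<tau>)) {\<tau>..T}"
  proof (rule fundamental_theorem_of_calculus)
    show "(?y has_vector_derivative ?y' t) (at t within {\<tau>..T})" if "t \<in> {\<tau>..T}" for t
      unfolding has_real_derivative_iff_has_vector_derivative[symmetric]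
      using that \<tau> by (intro has_field_derivative_at_within[OF log_integral_deriv]) auto
  qed (use \<tau> in auto)
  have Qc: "continuous_on {\<tau>..T} ?Q"
    by (rule continuous_on_subset[OF log_gradient_cont]) (use \<tau> in auto)
  have "integral {\<tau>..T} (\<lambda>t. ?Q t / 2 - K / 2) \<le> integral {\<tau>..T} ?y'"
  proof (rule integral_le)
    show "(\<lambda>t. ?Q t / 2 - K / 2) integrable_on {\<tau>..T}"
      by (rule integrable_continuous_real) (intro continuous_intros Qc, auto)
    show "?y' integrable_on {\<tau>..T}" using yy by blast
    show "?Q t / 2 - K / 2 \<le> ?y' t" if "t \<in> {\<tau>..T}" for t
      using that \<tau> by (intro y'_ge) auto
  qed
  also have "\<dots> = ?y T - ?y \<tau>" using yy by (rule integral_unique)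
  also have "\<dots> \<le> m + Y" using y_upper[of T] Y[of \<tau>] \<tau> by simp
  finally have "integral {\<tau>..T} (\<lambda>t. ?Q t / 2 - K / 2) \<le> m + Y" .
  moreover have "integral {\<tau>..T} (\<lambda>t. ?Q t / 2 - K / 2) = integral {\<tau>..T} ?Q / 2 - K / 2 * (T - \<tau>)"
  proof -
    have "integral {\<tau>..T} (\<lambda>t. ?Q t / 2 - K / 2) = integral {\<tau>..T} (\<lambda>t. ?Q t / 2) - integral {\<tau>..T} (\<lambda>t. K / 2)"
      by (rule integral_diff; rule integrable_continuous_real) (intro continuous_intros Qc, auto)+
    then show ?thesis using \<tau> by simp
  qed
  ultimately show "integral {\<tau>..T} ?Q \<le> 2 * (m + Y) + K * (T - \<tau>)"
    by (simp add: field_simps)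
  show "\<bar>ln (d x * u x t)\<bar> ^ 3 \<le> 8 * (D * (2 * m + Y)) * ?Q t + 64 * (D * (2 * m + Y)) ^ 3 / (b - a) ^ 3"
    if x: "x \<in> {a..b}" and tt: "\<tau> \<le> t" "t \<le> T" for x t
  proof (rule cube_le_gradient_mass[OF ab ln_deriv lgc x])
    show t: "0 < t" "0 < t" using \<tau> tt by auto
    have D0: "0 < D" using D[of a] d_pos[of a] ab by force
    have "integral {a..b} (\<lambda>x. \<bar>ln (d x * u x t)\<bar>)
        \<le> integral {a..b} (\<lambda>x. D * (2 * u x t - ln (d x * u x t) / d x))"
    proof (rule integral_mono_cont)
      fix x assume x: "x \<in> {a..b}"
      note p = vp[OF x t(1)]
      have "\<bar>ln (d x * u x t)\<bar> \<le> 2 * (d x * u x t) - ln (d x * u x t)"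
        using ln_le[OF x t(1)] p by linarith
      then have "\<bar>ln (d x * u x t)\<bar> / d x \<le> 2 * u x t - ln (d x * u x t) / d x"
        using p by (simp add: field_simps)
      moreover have "\<bar>ln (d x * u x t)\<bar> \<le> D * (\<bar>ln (d x * u x t)\<bar> / d x)"
        using D[OF x] p mult_right_mono[of "d x" D "\<bar>ln (d x * u x t)\<bar> / d x"] by simp
      ultimately show "\<bar>ln (d x * u x t)\<bar> \<le> D * (2 * u x t - ln (d x * u x t) / d x)"
        using D0 by (smt (verit) mult_left_mono)
    qed (use t lnc[OF t(1)] in \<open>auto intro!: continuous_intros d_cont slice_facts simp: nonzero\<close>)
    also have "\<dots> = D * (2 * m - ?y t)"
    proof -
      have "integral {a..b} (\<lambda>x. 2 * u x t - ln (d x * u x t) / d x) = 2 * m - ?y t"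
        using t mass[OF t(1)] lnc[OF t(1)] by (subst integral_diff)
          (auto intro!: integrable_continuous_real continuous_intros d_cont slice_facts simp: nonzero)
      then show ?thesis by simp
    qed
    also have "\<dots> \<le> D * (2 * m + Y)" using Y[OF tt] D0 by (intro mult_left_mono) auto
    finally show "integral {a..b} (\<lambda>x. \<bar>ln (d x * u x t)\<bar>) \<le> D * (2 * m + Y)" .
  qed
qed

end

section \<open>Test functions and weak derivatives\<close>

text \<open>
  The derivatives of \<open>exp (- 1/y)\<close>, extended by zero to \<open>y \<le> 0\<close>, are combinations of these
  functions.
\<close>

definition bump :: "nat \<Rightarrow> real \<Rightarrow> real"
  where "bump k y = (if 0 < y then (1 / y) ^ k * exp (- (1 / y)) else 0)"

lemma bump_tendsto_0: "(bump k \<longlongrightarrow> 0) (at 0)"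
proof -
  have "((\<lambda>y. (inverse y) ^ k / exp (inverse y)) \<longlongrightarrow> 0) (at_right (0::real))"
    by (rule filterlim_compose[OF tendsto_power_div_exp_0 filterlim_inverse_at_top_right])
  moreover have "\<forall>\<^sub>F y in at_right (0::real). (inverse y) ^ k / exp (inverse y) = bump k y"
    using eventually_at_right_less[of "0::real"]
    by eventually_elim (simp add: bump_def exp_minus field_simps)
  ultimately have r: "(bump k \<longlongrightarrow> 0) (at_right 0)" by (rule Lim_transform_eventually)
  have "\<forall>\<^sub>F y in at_left (0::real). 0 = bump k y"
    by (auto simp: eventually_at_filter bump_def)
  then have "(bump k \<longlongrightarrow> 0) (at_left 0)"
    by (rule Lim_transform_eventually[OF tendsto_const])
  with r show ?thesis by (simp add: filterlim_at_split)
qed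

lemma bump_deriv:
  "(bump k has_real_derivative bump (k + 2) y - real k * bump (k + 1) y) (at y)"
proof -
  consider "0 < y" | "y = 0" | "y < 0" by linarith
  then show ?thesis
  proof cases
    case 1
    have "((\<lambda>y. (1 / y) ^ k * exp (- (1 / y))) has_real_derivative bump (k + 2) y - real k * bump (k + 1) y) (at y)"
    proof -
      have inv: "((\<lambda>y. 1 / y) has_real_derivative - ((1 / y)\<^sup>2)) (at y)"
        using 1 by (auto intro!: derivative_eq_intros simp: power2_eq_square)
      have ex: "((\<lambda>y. exp (- (1 / y))) has_real_derivative exp (- (1 / y)) * (1 / y)\<^sup>2) (at y)"
        by (rule DERIV_cong[OF DERIV_fun_exp[OF DERIV_minus[OF inv]]]) simp
      have eq: "real k * (- ((1 / y)\<^sup>2) * (1 / y) ^ (k - Suc 0)) * exp (- (1 / y))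
          = - (real k * ((1 / y) ^ (k + 1) * exp (- (1 / y))))"
      proof (cases k)
        case (Suc n)
        have "(1 / y)\<^sup>2 * (1 / y) ^ n = (1 / y) ^ (Suc n + 1)"
          by (simp only: power_add[symmetric]) simp
        then show ?thesis using Suc by (simp add: mult_ac)
      qed simp
      show ?thesis
        by (rule DERIV_cong[OF DERIV_mult[OF DERIV_power[OF inv] ex]])
          (use 1 eq in \<open>simp add: bump_def power_add mult_ac power2_eq_square\<close>)
    qed
    then show ?thesis
      by (rule has_field_derivative_transform_within_open[of _ _ _ "{0<..}"])
        (use 1 in \<open>auto simp: bump_def\<close>)
  next
    case 2
    have "((\<lambda>h. (bump k (0 + h) - bump k 0) / h) \<longlongrightarrow> 0) (at 0)"
    proof (rule Lim_transform_eventually[OF bump_tendsto_0[of "k + 1"]])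
      show "\<forall>\<^sub>F h in at 0. bump (k + 1) h = (bump k (0 + h) - bump k 0) / h"
        by (auto simp: eventually_at_filter bump_def)
    qed
    then show ?thesis by (simp add: 2 DERIV_def bump_def)
  next
    case 3
    have "((\<lambda>y. 0) has_real_derivative bump (k + 2) y - real k * bump (k + 1) y) (at y)"
      using 3 by (simp add: bump_def)
    then show ?thesis
      by (rule has_field_derivative_transform_within_open[of _ _ _ "{..<0}"])
        (use 3 in \<open>auto simp: bump_def\<close>)
  qed
qed

text \<open>
  An algebra of functions that contains the bumps and is closed under differentiation; this makes
  all its members smooth without a formula for their higher derivatives.
\<close>

inductive_set bump_algebra :: "(real \<Rightarrow> real) set"
  where
    base: "(\<lambda>x. bump k (\<alpha> * x + \<beta>)) \<in> bump_algebra"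
  | add: "f \<in> bump_algebra \<Longrightarrow> h \<in> bump_algebra \<Longrightarrow> (\<lambda>x. f x + h x) \<in> bump_algebra"
  | mult: "f \<in> bump_algebra \<Longrightarrow> h \<in> bump_algebra \<Longrightarrow> (\<lambda>x. f x * h x) \<in> bump_algebra"
  | scale: "f \<in> bump_algebra \<Longrightarrow> (\<lambda>x. c * f x) \<in> bump_algebra"

lemma bump_algebra_deriv:
  "f \<in> bump_algebra \<Longrightarrow> \<exists>f'\<in>bump_algebra. \<forall>x. (f has_real_derivative f' x) (at x)"
proof (induction rule: bump_algebra.induct)
  case (base k \<alpha> \<beta>)
  define f' where "f' x = \<alpha> * (bump (k + 2) (\<alpha> * x + \<beta>) + (- real k) * bump (k + 1) (\<alpha> * x + \<beta>))" for x
  have "((\<lambda>x. bump k (\<alpha> * x + \<beta>)) has_real_derivative f' x) (at x)" for x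
  proof -
    have "((\<lambda>x. \<alpha> * x + \<beta>) has_real_derivative \<alpha>) (at x)" by (auto intro!: derivative_eq_intros)
    from DERIV_chain2[OF bump_deriv this] show ?thesis by (simp add: mult.commute f'_def)
  qed
  moreover have "f' \<in> bump_algebra"
    unfolding f'_def[abs_def] by (intro bump_algebra.scale bump_algebra.add bump_algebra.base)
  ultimately show ?case by (intro bexI[of _ f'] allI)
next
  case (add f h)
  then obtain f' h' where "f' \<in> bump_algebra" "\<forall>x. (f has_real_derivative f' x) (at x)"
    "h' \<in> bump_algebra" "\<forall>x. (h has_real_derivative h' x) (at x)" by blast
  then show ?case
    by (intro bexI[of _ "\<lambda>x. f' x + h' x"]) (auto intro: bump_algebra.add DERIV_add)
next
  case (mult f h)
  then obtain f' h' where *: "f' \<in> bump_algebra" "\<forall>x. (f has_real_derivative f' x) (at x)"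
    "h' \<in> bump_algebra" "\<forall>x. (h has_real_derivative h' x) (at x)" by blast
  show ?case
  proof (intro bexI[of _ "\<lambda>x. f' x * h x + h' x * f x"] allI)
    show "((\<lambda>x. f x * h x) has_real_derivative f' x * h x + h' x * f x) (at x)" for x
      using * by (intro DERIV_mult) auto
    show "(\<lambda>x. f' x * h x + h' x * f x) \<in> bump_algebra"
      using * mult.hyps by (intro bump_algebra.add bump_algebra.mult)
  qed
next
  case (scale f c)
  then obtain f' where "f' \<in> bump_algebra" "\<forall>x. (f has_real_derivative f' x) (at x)" by blast
  then show ?case
    by (intro bexI[of _ "\<lambda>x. c * f' x"]) (auto intro: bump_algebra.scale DERIV_cmult)
qed

lemma bump_algebra_smooth:
  assumes "f \<in> bump_algebra"
  shows "smooth_on UNIV f"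
proof -
  obtain \<Delta> where \<Delta>: "\<And>f. f \<in> bump_algebra \<Longrightarrow> \<Delta> f \<in> bump_algebra"
    "\<And>f x. f \<in> bump_algebra \<Longrightarrow> (f has_real_derivative \<Delta> f x) (at x)"
    using bump_algebra_deriv by metis
  have D: "(\<Delta> ^^ i) f \<in> bump_algebra" for i
    by (induction i) (auto intro: assms \<Delta>)
  show ?thesis
    unfolding smooth_on_def Ck_on_def
  proof (intro allI exI[of _ "\<lambda>i. (\<Delta> ^^ i) f"] conjI impI ballI)
    show "((\<Delta> ^^ i) f has_real_derivative (\<Delta> ^^ Suc i) f x) (at x)" for i x
      using \<Delta>(2)[OF D] by simp
    show "continuous_on UNIV ((\<Delta> ^^ i) f)" for i
      using DERIV_continuous_on[OF \<Delta>(2)[OF D]] by blast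
  qed simp
qed

text \<open>
  Test functions that increase to the indicator function of \<open>(c, e)\<close>.
\<close>

definition plateau :: "real \<Rightarrow> real \<Rightarrow> nat \<Rightarrow> real \<Rightarrow> real"
  where "plateau c e n x = bump 0 (real n * (x - c)) * bump 0 (real n * (e - x))"

lemma plateau_bounds: "0 \<le> plateau c e n x" "plateau c e n x \<le> 1"
  unfolding plateau_def bump_def by (auto intro!: mult_le_one)

lemma plateau_outside: "x \<notin> {c<..<e} \<Longrightarrow> plateau c e n x = 0"
  by (auto simp: plateau_def bump_def zero_less_mult_iff)

lemma plateau_test_function:
  assumes "{c..e} \<subseteq> S"
  shows "test_function S (plateau c e n)"
proof -
  have "plateau c e n = (\<lambda>x. bump 0 (real n * x + (- real n * c)) * bump 0 ((- real n) * x + real n * e))"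
    by (rule ext) (simp add: plateau_def algebra_simps)
  also have "\<dots> \<in> bump_algebra" by (intro bump_algebra.mult bump_algebra.base)
  finally have "smooth_on UNIV (plateau c e n)" by (rule bump_algebra_smooth)
  moreover have "{x. plateau c e n x \<noteq> 0} \<subseteq> {c..e}"
  proof
    fix x assume "x \<in> {x. plateau c e n x \<noteq> 0}"
    then have "x \<in> {c<..<e}" using plateau_outside by blast
    then show "x \<in> {c..e}" by simp
  qed
  then have sub: "closure {x. plateau c e n x \<noteq> 0} \<subseteq> {c..e}"
    by (rule closure_minimal) simp
  moreover have "compact (closure {x. plateau c e n x \<noteq> 0})"
    unfolding compact_eq_bounded_closed
    using bounded_subset[OF compact_imp_bounded[OF compact_Icc] sub] by simp
  ultimately show ?thesis unfolding test_function_def using subset_trans[OF sub assms] by blast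
qed

lemma plateau_tendsto:
  "(\<lambda>n. plateau c e n x) \<longlonglongrightarrow> indicator {c<..<e} x"
proof (cases "x \<in> {c<..<e}")
  case True
  have *: "(\<lambda>n. bump 0 (real n * y)) \<longlonglongrightarrow> 1" if y: "0 < y" for y
  proof -
    have "(\<lambda>n. exp (- ((1 / y) * (1 / real n)))) \<longlonglongrightarrow> exp (- ((1 / y) * 0))"
      by (intro tendsto_intros lim_1_over_n)
    moreover have "\<forall>\<^sub>F n in sequentially. exp (- ((1 / y) * (1 / real n))) = bump 0 (real n * y)"
      using eventually_gt_at_top[of 0] by eventually_elim (use y in \<open>simp add: bump_def mult.commute\<close>)
    ultimately show ?thesis using Lim_transform_eventually by force
  qed
  show ?thesis unfolding plateau_def
    using tendsto_mult[OF *[of "x - c"] *[of "e - x"]] True by simp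
next
  case False
  then show ?thesis by (simp add: plateau_outside)
qed

text \<open>
  The positive and the negative part of \<open>h\<close> are densities of finite measures that agree on half
  lines, and hence everywhere.
\<close>

lemma zero_of_zero_integrals:
  fixes h :: "real \<Rightarrow> real"
  assumes h: "integrable lborel h" and z: "\<And>s. (LINT x:{s<..}|lborel. h x) = 0"
  shows "AE x in lborel. h x = 0"
proof -
  have [measurable]: "h \<in> borel_measurable borel" using h by (auto dest: borel_measurable_integrable)
  let ?M = "density lborel (\<lambda>x. ennreal (h x))" and ?N = "density lborel (\<lambda>x. ennreal (- h x))"
  have fin: "(\<integral>\<^sup>+x. ennreal (h x) * indicator {s<..} x \<partial>lborel) < \<infinity>"
    "(\<integral>\<^sup>+x. ennreal (- h x) * indicator {s<..} x \<partial>lborel) < \<infinity>" for s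
  proof -
    have "(\<integral>\<^sup>+x. ennreal (h x) * indicator {s<..} x \<partial>lborel) \<le> (\<integral>\<^sup>+x. ennreal (norm (h x)) \<partial>lborel)"
      "(\<integral>\<^sup>+x. ennreal (- h x) * indicator {s<..} x \<partial>lborel) \<le> (\<integral>\<^sup>+x. ennreal (norm (h x)) \<partial>lborel)"
      by (intro nn_integral_mono; auto simp: indicator_def intro!: ennreal_leI)+
    moreover have "(\<integral>\<^sup>+x. ennreal (norm (h x)) \<partial>lborel) < \<infinity>" using h by (simp add: integrable_iff_bounded)
    ultimately show "(\<integral>\<^sup>+x. ennreal (h x) * indicator {s<..} x \<partial>lborel) < \<infinity>"
      "(\<integral>\<^sup>+x. ennreal (- h x) * indicator {s<..} x \<partial>lborel) < \<infinity>" by (auto intro: le_less_trans)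
  qed
  have MN: "?M = ?N"
  proof (rule measure_eqI_lessThan)
    fix s :: real
    show "emeasure ?M {s<..} < \<infinity>" using fin(1)[of s] by (simp add: emeasure_density)
    have ind: "ennreal (h x) * indicator {s<..} x = ennreal (indicator {s<..} x *\<^sub>R h x)"
      "ennreal (- h x) * indicator {s<..} x = ennreal (- (indicator {s<..} x *\<^sub>R h x))" for x
      by (auto simp: indicator_def)
    have int: "integrable lborel (\<lambda>x. indicator {s<..} x *\<^sub>R h x)"
      by (rule integrable_mult_indicator[OF _ h]) simp
    have "enn2real (\<integral>\<^sup>+x. ennreal (h x) * indicator {s<..} x \<partial>lborel)
        - enn2real (\<integral>\<^sup>+x. ennreal (- h x) * indicator {s<..} x \<partial>lborel) = 0"
      using z[of s] unfolding set_lebesgue_integral_def real_lebesgue_integral_def[OF int] ind .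
    then have "ennreal (enn2real (\<integral>\<^sup>+x. ennreal (h x) * indicator {s<..} x \<partial>lborel))
        = ennreal (enn2real (\<integral>\<^sup>+x. ennreal (- h x) * indicator {s<..} x \<partial>lborel))" by simp
    then have "(\<integral>\<^sup>+x. ennreal (h x) * indicator {s<..} x \<partial>lborel)
        = (\<integral>\<^sup>+x. ennreal (- h x) * indicator {s<..} x \<partial>lborel)"
      using fin[of s] by (simp only: ennreal_enn2real infinity_ennreal_def)
    then show "emeasure ?M {s<..} = emeasure ?N {s<..}"
      by (subst (1 2) emeasure_density) simp_all
  qed simp_all
  have "AE x in lborel. ennreal (h x) = ennreal (- h x)"
    using MN by (subst (asm) sigma_finite_measure.density_unique_iff[OF sigma_finite_lborel]) auto
  then show ?thesis
  proof eventually_elim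
    case (elim x)
    then show ?case by (cases "h x" "0::real" rule: linorder_cases) (auto simp: ennreal_neg)
  qed
qed

text \<open>
  The plateau functions converge to indicator functions, so the integral of \<open>h\<close> over each compactly
  contained subinterval vanishes. On such a subinterval \<open>h\<close> agrees almost everywhere with a Borel
  function whose integrals over all half lines are zero.
\<close>

lemma fundamental_lemma:
  fixes h :: "real \<Rightarrow> real"
  assumes h: "\<And>K. compact K \<Longrightarrow> K \<subseteq> {a<..<b} \<Longrightarrow> set_integrable lebesgue K h"
    and z: "\<And>\<phi>. test_function {a<..<b} \<phi> \<Longrightarrow> (LINT x:{a<..<b}|lebesgue. h x * \<phi> x) = 0"
  shows "AE x in lebesgue. x \<in> {a<..<b} \<longrightarrow> h x = 0"
proof -
  have zero: "(LINT x:{c<..<e}|lebesgue. h x) = 0" if sub: "{c..e} \<subseteq> {a<..<b}" for c e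
  proof -
    let ?s = "\<lambda>n x. indicator {a<..<b} x *\<^sub>R (h x * plateau c e n x)"
    have int: "integrable lebesgue (\<lambda>x. indicator {c..e} x *\<^sub>R h x)"
      using h[OF compact_Icc sub] by (simp add: set_integrable_def)
    then have m: "(\<lambda>x. indicator {c..e} x *\<^sub>R h x) \<in> borel_measurable lebesgue" by simp
    have eq: "?s n x = (indicator {c..e} x *\<^sub>R h x) * plateau c e n x" for n x
    proof (cases "x \<in> {c<..<e}")
      case True
      then have "x \<in> {c..e}" by simp
      then have "x \<in> {a<..<b}" using sub by blast
      then show ?thesis using \<open>x \<in> {c..e}\<close> by simp
    next
      case False
      then show ?thesis by (simp add: plateau_outside)
    qed
    have "plateau c e n \<in> borel_measurable borel" for n
      unfolding plateau_def bump_def by measurable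
    then have pm: "plateau c e n \<in> borel_measurable lebesgue" for n
      by (intro measurable_completion) simp
    have "(\<lambda>n. LINT x|lebesgue. ?s n x) \<longlonglongrightarrow> (LINT x|lebesgue. indicator {c<..<e} x *\<^sub>R h x)"
    proof (rule integral_dominated_convergence[where w = "\<lambda>x. norm (indicator {c..e} x *\<^sub>R h x)"])
      show "(\<lambda>x. indicator {c<..<e} x *\<^sub>R h x) \<in> borel_measurable lebesgue"
      proof -
        have "(\<lambda>x. indicator {c<..<e} x *\<^sub>R (indicator {c..e} x *\<^sub>R h x)) \<in> borel_measurable lebesgue"
          by (rule borel_measurable_scaleR[OF borel_measurable_indicator m]) simp
        moreover have "(\<lambda>x. indicator {c<..<e} x *\<^sub>R (indicator {c..e} x *\<^sub>R h x)) = (\<lambda>x. indicator {c<..<e} x *\<^sub>R h x)"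
          by (auto simp: indicator_def fun_eq_iff)
        ultimately show ?thesis by simp
      qed
      show "?s n \<in> borel_measurable lebesgue" for n
        unfolding eq using m pm by (intro borel_measurable_times)
      show "integrable lebesgue (\<lambda>x. norm (indicator {c..e} x *\<^sub>R h x))"
        using int by (rule integrable_norm)
      show "AE x in lebesgue. norm (?s n x) \<le> norm (indicator {c..e} x *\<^sub>R h x)" for n
        unfolding eq using plateau_bounds[of c e n]
        by (intro AE_I2) (auto simp: abs_mult intro!: mult_right_le_one_le)
      show "AE x in lebesgue. (\<lambda>n. ?s n x) \<longlonglongrightarrow> indicator {c<..<e} x *\<^sub>R h x"
      proof (rule AE_I2)
        fix x
        have "(\<lambda>n. ?s n x) \<longlonglongrightarrow> (indicator {c..e} x *\<^sub>R h x) * indicator {c<..<e} x"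
          unfolding eq by (intro tendsto_intros plateau_tendsto)
        then show "(\<lambda>n. ?s n x) \<longlonglongrightarrow> indicator {c<..<e} x *\<^sub>R h x"
          by (cases "x \<in> {c<..<e}") (auto simp: indicator_def)
      qed
    qed
    moreover have "(LINT x|lebesgue. ?s n x) = 0" for n
      using z[OF plateau_test_function[OF sub]] by (simp add: set_lebesgue_integral_def)
    ultimately show ?thesis
      by (simp add: set_lebesgue_integral_def LIMSEQ_const_iff)
  qed
  have local: "AE x in lebesgue. x \<in> {c..e} \<longrightarrow> h x = 0" if sub: "{c..e} \<subseteq> {a<..<b}" for c e
  proof -
    have int: "integrable lebesgue (\<lambda>x. indicator {c..e} x *\<^sub>R h x)"
      using h[OF compact_Icc sub] by (simp add: set_integrable_def)
    obtain k where k: "k \<in> borel_measurable lborel" "AE x in lborel. indicator {c..e} x *\<^sub>R h x = k x"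
      using completion_ex_borel_measurable_real[of "\<lambda>x. indicator {c..e} x *\<^sub>R h x" lborel] int by auto
    have k': "AE x in lebesgue. indicator {c..e} x *\<^sub>R h x = k x" using k(2) by (rule AE_completion)
    have [measurable]: "k \<in> borel_measurable borel" using k(1) by simp
    have kl: "k \<in> borel_measurable lebesgue" using k(1) by (simp add: measurable_completion)
    have "integrable lebesgue k"
      using int k' by (rule integrable_cong_AE_imp[OF _ kl])
    then have intk: "integrable lborel k" using k(1) by (simp add: integrable_completion)
    have "AE x in lborel. k x = 0"
    proof (rule zero_of_zero_integrals[OF intk])
      fix s
      have "(LINT x:{s<..}|lborel. k x) = (LINT x:{s<..}|lebesgue. k x)"
        unfolding set_lebesgue_integral_def by (rule integral_completion[symmetric]) simp
      also have "\<dots> = (LINT x:{max s c<..<e}|lebesgue. h x)"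
        unfolding set_lebesgue_integral_def
      proof (rule integral_cong_AE)
        show "(\<lambda>x. indicator {s<..} x *\<^sub>R k x) \<in> borel_measurable lebesgue"
          by (rule borel_measurable_scaleR[OF borel_measurable_indicator kl]) simp
        have "(\<lambda>x. indicator {max s c<..<e} x *\<^sub>R (indicator {c..e} x *\<^sub>R h x)) \<in> borel_measurable lebesgue"
          by (rule borel_measurable_scaleR[OF borel_measurable_indicator borel_measurable_integrable[OF int]]) simp
        moreover have "(\<lambda>x. indicator {max s c<..<e} x *\<^sub>R (indicator {c..e} x *\<^sub>R h x)) = (\<lambda>x. indicator {max s c<..<e} x *\<^sub>R h x)"
          by (auto simp: indicator_def fun_eq_iff)
        ultimately show "(\<lambda>x. indicator {max s c<..<e} x *\<^sub>R h x) \<in> borel_measurable lebesgue" by simp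
        have ne: "AE x in lebesgue. x \<noteq> c" "AE x in lebesgue. x \<noteq> e"
          by (auto intro!: AE_completion AE_lborel_singleton)
        show "AE x in lebesgue. indicator {s<..} x *\<^sub>R k x = indicator {max s c<..<e} x *\<^sub>R h x"
          using k' ne by eventually_elim (auto simp: indicator_def split: if_splits)
      qed
      also have "\<dots> = 0"
      proof (cases "max s c < e")
        case True then show ?thesis using sub by (intro zero) auto
      next
        case False
        then have "{max s c<..<e} = {}" by (simp only: greaterThanLessThan_empty_iff not_less)
        then show ?thesis by (simp add: set_lebesgue_integral_def)
      qed
      finally show "(LINT x:{s<..}|lborel. k x) = 0" .
    qed
    then have "AE x in lebesgue. k x = 0" by (rule AE_completion)
    with k' show ?thesis by eventually_elim (auto simp: indicator_def)
  qed
  have "AE x in lebesgue. \<forall>n. x \<in> {a + 1 / real (Suc n)..b - 1 / real (Suc n)} \<longrightarrow> h x = 0"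
    unfolding AE_all_countable
  proof (intro allI local subsetI)
    fix n x assume x: "x \<in> {a + 1 / real (Suc n)..b - 1 / real (Suc n)}"
    have "a < x \<and> x < b" if "0 < r" "x \<in> {a + r..b - r}" for r using that by simp
    from this[of "1 / real (Suc n)"] x show "x \<in> {a<..<b}" by simp
  qed
  then show ?thesis
  proof eventually_elim
    case (elim x)
    show ?case
    proof
      assume "x \<in> {a<..<b}"
      then have "0 < min (x - a) (b - x)" by simp
      then obtain n where "inverse (real (Suc n)) < min (x - a) (b - x)" using reals_Archimedean by blast
      then have "x \<in> {a + 1 / real (Suc n)..b - 1 / real (Suc n)}" by (simp add: field_simps inverse_eq_divide)
      then show "h x = 0" using elim by blast
    qed
  qed
qed

lemma LINT_interval:
  fixes F :: "real \<Rightarrow> real"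
  assumes "continuous_on {a..b} F"
  shows "set_integrable lebesgue {a<..<b} F"
    and "(LINT x:{a<..<b}|lebesgue. F x) = integral {a..b} F"
proof -
  have ab: "set_integrable lebesgue {a..b} F"
    by (rule absolutely_integrable_continuous_real[OF assms])
  show i: "set_integrable lebesgue {a<..<b} F"
    by (rule set_integrable_subset[OF ab]) (auto simp: greaterThanLessThan_subseteq_atLeastAtMost_iff)
  show "(LINT x:{a<..<b}|lebesgue. F x) = integral {a..b} F"
    using set_lebesgue_integral_eq_integral(2)[OF i] by (simp add: integral_open_interval_real)
qed

lemma nn_integral_interval:
  fixes F :: "real \<Rightarrow> real"
  assumes "continuous_on {a..b} F" "\<And>x. x \<in> {a..b} \<Longrightarrow> 0 \<le> F x"
  shows "(\<integral>\<^sup>+x\<in>{a<..<b}. ennreal (F x) \<partial>lebesgue) = ennreal (integral {a..b} F)"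
proof -
  have "(\<integral>\<^sup>+x\<in>{a<..<b}. ennreal (F x) \<partial>lebesgue)
      = (\<integral>\<^sup>+x. ennreal (indicator {a<..<b} x *\<^sub>R F x) \<partial>lebesgue)"
    by (rule nn_integral_cong) (auto simp: indicator_def)
  also have "\<dots> = ennreal (LINT x|lebesgue. indicator {a<..<b} x *\<^sub>R F x)"
    by (rule nn_integral_eq_integral)
      (use LINT_interval(1)[OF assms(1)] assms(2) in \<open>auto simp: set_integrable_def indicator_def\<close>)
  finally show ?thesis
    using LINT_interval(2)[OF assms(1)] by (simp add: set_lebesgue_integral_def)
qed

lemma test_function_facts:
  assumes "test_function {a<..<b} \<phi>"
  obtains "\<And>x. (\<phi> has_real_derivative deriv \<phi> x) (at x)" "continuous_on UNIV (deriv \<phi>)"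
    "\<And>x. x \<notin> {a<..<b} \<Longrightarrow> \<phi> x = 0"
proof -
  have "Ck_on 1 UNIV \<phi>" using assms by (simp add: test_function_def smooth_on_def)
  then obtain D where D: "D 0 = \<phi>" "\<And>x. (D 0 has_real_derivative D (Suc 0) x) (at x)"
    "continuous_on UNIV (D (Suc 0))" unfolding Ck_on_def by force
  have d: "(\<phi> has_real_derivative D (Suc 0) x) (at x)" for x using D by simp
  have e: "deriv \<phi> = D (Suc 0)" using DERIV_imp_deriv[OF d] by blast
  show ?thesis
  proof
    show "(\<phi> has_real_derivative deriv \<phi> x) (at x)" for x using d e by simp
    show "continuous_on UNIV (deriv \<phi>)" using D e by simp
    fix x assume "x \<notin> {a<..<b}"
    then show "\<phi> x = 0"
      using assms closure_subset[of "{x. \<phi> x \<noteq> 0}"] unfolding test_function_def by blast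
  qed
qed

lemma test_function_integrable:
  assumes h: "\<And>K. compact K \<Longrightarrow> K \<subseteq> {a<..<b} \<Longrightarrow> set_integrable lebesgue K h"
    and \<phi>: "test_function {a<..<b} \<phi>"
  shows "set_integrable lebesgue {a<..<b} (\<lambda>x. h x * \<phi> x)"
proof -
  define K where "K = closure {x. \<phi> x \<noteq> 0}"
  have K: "compact K" "K \<subseteq> {a<..<b}" using \<phi> by (auto simp: test_function_def K_def)
  have K0: "x \<notin> K \<Longrightarrow> \<phi> x = 0" for x
    using closure_subset[of "{x. \<phi> x \<noteq> 0}"] unfolding K_def by blast
  have c: "continuous_on UNIV \<phi>"
    using test_function_facts[OF \<phi>] DERIV_continuous_on[of UNIV \<phi>] by metis
  obtain C where C: "\<And>x. \<bar>\<phi> x\<bar> \<le> C"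
  proof -
    have "bounded (\<phi> ` K)"
      by (intro compact_imp_bounded compact_continuous_image K continuous_on_subset[OF c]) simp
    then obtain C where C: "\<And>x. x \<in> K \<Longrightarrow> \<bar>\<phi> x\<bar> \<le> C" unfolding bounded_iff by auto
    have "\<bar>\<phi> x\<bar> \<le> max C 0" for x
      using C[of x] K0[of x] by (cases "x \<in> K") auto
    then show ?thesis by (rule that)
  qed
  have int: "integrable lebesgue (\<lambda>x. indicator K x *\<^sub>R h x)" using h[OF K] by (simp add: set_integrable_def)
  have "\<phi> \<in> borel_measurable borel" using c by (rule borel_measurable_continuous_onI)
  then have m: "\<phi> \<in> borel_measurable lebesgue" by (intro measurable_completion) simp
  have "integrable lebesgue (\<lambda>x. (indicator K x *\<^sub>R h x) * \<phi> x)"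
  proof (rule Bochner_Integration.integrable_bound)
    show "integrable lebesgue (\<lambda>x. C * (indicator K x *\<^sub>R h x))" using int by simp
    show "(\<lambda>x. (indicator K x *\<^sub>R h x) * \<phi> x) \<in> borel_measurable lebesgue"
      using borel_measurable_integrable[OF int] m by (rule borel_measurable_times)
    have "norm ((indicator K x *\<^sub>R h x) * \<phi> x) \<le> norm (C * (indicator K x *\<^sub>R h x))" for x
    proof -
      have "\<bar>\<phi> x\<bar> \<le> \<bar>C\<bar>" using C[of x] by linarith
      then have "\<bar>indicator K x *\<^sub>R h x\<bar> * \<bar>\<phi> x\<bar> \<le> \<bar>indicator K x *\<^sub>R h x\<bar> * \<bar>C\<bar>"
        by (rule mult_left_mono) simp
      then show ?thesis by (simp only: real_norm_def abs_mult mult.commute)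
    qed
    then show "AE x in lebesgue. norm ((indicator K x *\<^sub>R h x) * \<phi> x) \<le> norm (C * (indicator K x *\<^sub>R h x))"
      by (rule AE_I2)
  qed
  moreover have "(indicator K x *\<^sub>R h x) * \<phi> x = indicator {a<..<b} x *\<^sub>R (h x * \<phi> x)" for x
    using K(2) K0[of x] by (cases "x \<in> K") (auto simp: indicator_def)
  ultimately have "integrable lebesgue (\<lambda>x. indicator {a<..<b} x *\<^sub>R (h x * \<phi> x))" by (simp only:)
  then show ?thesis unfolding set_integrable_def .
qed

lemma weak_deriv_unique:
  assumes "has_weak_deriv {a<..<b} f h1" "has_weak_deriv {a<..<b} f h2"
  shows "AE x in lebesgue. x \<in> {a<..<b} \<longrightarrow> h1 x = h2 x"
proof -
  have h: "set_integrable lebesgue K h1" "set_integrable lebesgue K h2" if "compact K" "K \<subseteq> {a<..<b}" for K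
    using assms that by (auto simp: has_weak_deriv_def)
  have "AE x in lebesgue. x \<in> {a<..<b} \<longrightarrow> h1 x - h2 x = 0"
  proof (rule fundamental_lemma)
    show "set_integrable lebesgue K (\<lambda>x. h1 x - h2 x)" if "compact K" "K \<subseteq> {a<..<b}" for K
      using h[OF that] by (rule set_integral_diff(1))
    fix \<phi> assume \<phi>: "test_function {a<..<b} \<phi>"
    have i: "set_integrable lebesgue {a<..<b} (\<lambda>x. h1 x * \<phi> x)" "set_integrable lebesgue {a<..<b} (\<lambda>x. h2 x * \<phi> x)"
      by (intro test_function_integrable h \<phi>; assumption)+
    have "(LINT x:{a<..<b}|lebesgue. (h1 x - h2 x) * \<phi> x)
        = (LINT x:{a<..<b}|lebesgue. h1 x * \<phi> x) - (LINT x:{a<..<b}|lebesgue. h2 x * \<phi> x)"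
      using set_integral_diff(2)[OF i] by (simp add: left_diff_distrib)
    moreover have "(LINT x:{a<..<b}|lebesgue. f x * deriv \<phi> x) = - (LINT x:{a<..<b}|lebesgue. h1 x * \<phi> x)"
      "(LINT x:{a<..<b}|lebesgue. f x * deriv \<phi> x) = - (LINT x:{a<..<b}|lebesgue. h2 x * \<phi> x)"
      using assms \<phi> unfolding has_weak_deriv_def by blast+
    ultimately show "(LINT x:{a<..<b}|lebesgue. (h1 x - h2 x) * \<phi> x) = 0" by simp
  qed
  then show ?thesis by eventually_elim simp
qed

lemma classical_has_weak_deriv:
  fixes f f' :: "real \<Rightarrow> real"
  assumes f: "\<And>x. x \<in> {a..b} \<Longrightarrow> (f has_real_derivative f' x) (at x within {a..b})"
    and cf: "continuous_on {a..b} f'" and ab: "a \<le> b"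
  shows "has_weak_deriv {a<..<b} f f'"
proof -
  have c: "continuous_on {a..b} f" using DERIV_continuous_on[OF f] by blast
  have loc: "set_integrable lebesgue K F" if "compact K" "K \<subseteq> {a<..<b}" "continuous_on {a..b} F"
    for K and F :: "real \<Rightarrow> real"
    by (rule set_integrable_subset[OF LINT_interval(1)[OF that(3)] _ that(2)])
      (use compact_imp_closed[OF that(1)] in auto)
  have "(LINT x:{a<..<b}|lebesgue. f x * deriv \<phi> x) = - (LINT x:{a<..<b}|lebesgue. f' x * \<phi> x)"
    if \<phi>: "test_function {a<..<b} \<phi>" for \<phi>
  proof -
    obtain d: "\<And>x. (\<phi> has_real_derivative deriv \<phi> x) (at x)" and cd: "continuous_on UNIV (deriv \<phi>)"
      and z: "\<And>x. x \<notin> {a<..<b} \<Longrightarrow> \<phi> x = 0" using test_function_facts[OF \<phi>] by blast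
    have c\<phi>: "continuous_on {a..b} \<phi>" "continuous_on {a..b} (deriv \<phi>)"
      using DERIV_continuous_on[of UNIV \<phi>] d cd by (auto intro: continuous_on_subset)
    have "integral {a..b} (\<lambda>x. f x * deriv \<phi> x) = - integral {a..b} (\<lambda>x. f' x * \<phi> x)"
      by (rule ibp_vanishing_flux[OF ab f has_field_derivative_at_within[OF d] cf c\<phi>(2)])
        (auto intro: z)
    then show ?thesis
      by (simp add: LINT_interval(2) continuous_on_mult c cf c\<phi>)
  qed
  then show ?thesis unfolding has_weak_deriv_def using loc c cf by blast
qed

text \<open>
  The average over \<open>y\<close> of \<open>f(x)\<^sup>2 \<le> 2 f(y)\<^sup>2 + 2 (f(x) - f(y))\<^sup>2\<close>.
\<close>

lemma square_le_W12:
  fixes f f' :: "real \<Rightarrow> real"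
  assumes f: "\<And>x. x \<in> {a..b} \<Longrightarrow> (f has_real_derivative f' x) (at x within {a..b})"
    and cf: "continuous_on {a..b} f'" and x: "x \<in> {a..b}"
  shows "(b - a) * (f x)\<^sup>2 \<le> 2 * integral {a..b} (\<lambda>y. (f y)\<^sup>2) + 2 * (b - a)\<^sup>2 * integral {a..b} (\<lambda>y. (f' y)\<^sup>2)"
proof -
  have c: "continuous_on {a..b} f" using DERIV_continuous_on[OF f] by blast
  let ?I = "integral {a..b} (\<lambda>y. (f' y)\<^sup>2)"
  have I0: "0 \<le> ?I" by (rule integral_nonneg_cont) (auto intro!: continuous_intros cf)
  have "integral {a..b} (\<lambda>y. (f x)\<^sup>2) \<le> integral {a..b} (\<lambda>y. 2 * (f y)\<^sup>2 + 2 * (b - a) * ?I)"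
  proof (rule integral_mono_cont)
    fix y assume y: "y \<in> {a..b}"
    have "(f x - f y)\<^sup>2 \<le> \<bar>x - y\<bar> * ?I" by (rule square_increment_le[OF f cf x y])
    also have "\<dots> \<le> (b - a) * ?I" using x y I0 by (intro mult_right_mono) auto
    finally have "2 * (f x - f y)\<^sup>2 \<le> 2 * ((b - a) * ?I)" by (rule mult_left_mono) simp
    then have "2 * (f x - f y)\<^sup>2 \<le> 2 * (b - a) * ?I" by (simp only: mult.assoc)
    moreover have "(f x)\<^sup>2 \<le> 2 * (f y)\<^sup>2 + 2 * (f x - f y)\<^sup>2"
      using zero_le_power2[of "f x - 2 * f y"] by (simp add: power2_eq_square algebra_simps)
    ultimately show "(f x)\<^sup>2 \<le> 2 * (f y)\<^sup>2 + 2 * (b - a) * ?I" by linarith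
  qed (auto intro!: continuous_intros c)
  also have "\<dots> = 2 * integral {a..b} (\<lambda>y. (f y)\<^sup>2) + 2 * (b - a) * ?I * (b - a)"
    using x by (subst integral_add) (auto intro!: integrable_continuous_real continuous_intros c)
  finally show ?thesis using x by (simp add: power2_eq_square mult_ac)
qed

section \<open>The initial trace of the nutrient\<close>

lemma nn_integral_lebesgue_on:
  fixes f :: "real \<Rightarrow> ennreal"
  shows "(\<integral>\<^sup>+x\<in>{a<..<b}. f x \<partial>lebesgue) = (\<integral>\<^sup>+x. f x \<partial>lebesgue_on {a<..<b})"
  by (simp add: nn_integral_restrict_space)

lemma AE_lebesgue_on:
  fixes a b :: real
  shows "(AE x in lebesgue_on {a<..<b}. P x) \<longleftrightarrow> (AE x in lebesgue. x \<in> {a<..<b} \<longrightarrow> P x)"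
  by (rule AE_restrict_space_iff) simp

lemma continuous_measurable_interval:
  fixes f :: "real \<Rightarrow> real"
  assumes "continuous_on {a..b} f"
  shows "f \<in> borel_measurable (lebesgue_on {a<..<b})"
  by (rule continuous_imp_measurable_on_sets_lebesgue)
    (auto intro: continuous_on_subset[OF assms])

lemma nn_integral_lebesgue_on_cont:
  fixes F :: "real \<Rightarrow> real"
  assumes "continuous_on {a..b} F" "\<And>x. x \<in> {a..b} \<Longrightarrow> 0 \<le> F x"
  shows "(\<integral>\<^sup>+x. ennreal (F x) \<partial>lebesgue_on {a<..<b}) = ennreal (integral {a..b} F)"
  using nn_integral_interval[OF assms] by (simp add: nn_integral_lebesgue_on)

text \<open>
  Continuity at \<open>t = 0\<close> with values in \<open>W\<^sup>1\<^sup>,\<^sup>2\<close>, for a function that is classically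
  differentiable in space at positive times; \<open>W0\<close> is the weak derivative at time \<open>0\<close>, being the
  limit of the classical ones.
\<close>

locale w12_trace =
  fixes a b :: real and w wx :: "real \<Rightarrow> real \<Rightarrow> real" and W0 :: "real \<Rightarrow> real"
  assumes ab: "a < b"
    and w_x: "\<And>x t. x \<in> {a..b} \<Longrightarrow> 0 < t \<Longrightarrow>
      ((\<lambda>y. w y t) has_real_derivative wx x t) (at x within {a..b})"
    and wx_slice: "\<And>t. 0 < t \<Longrightarrow> continuous_on {a..b} (\<lambda>x. wx x t)"
    and w0_slice: "continuous_on {a..b} (\<lambda>x. w x 0)"
    and W0_meas: "W0 \<in> borel_measurable (lebesgue_on {a<..<b})"
    and W0_sq: "(\<integral>\<^sup>+x. ennreal ((W0 x)\<^sup>2) \<partial>lebesgue_on {a<..<b}) < \<infinity>"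
    and dist: "((\<lambda>t. \<integral>\<^sup>+x. ennreal ((w x t - w x 0)\<^sup>2 + (wx x t - W0 x)\<^sup>2) \<partial>lebesgue_on {a<..<b})
      \<longlongrightarrow> 0) (at_right 0)"
begin

definition deviation :: "real \<Rightarrow> ennreal"
  where "deviation t = (\<integral>\<^sup>+x. ennreal ((w x t - w x 0)\<^sup>2 + (wx x t - W0 x)\<^sup>2) \<partial>lebesgue_on {a<..<b})"

lemma w_slice: "0 < t \<Longrightarrow> continuous_on {a..b} (\<lambda>x. w x t)"
  using DERIV_continuous_on[OF w_x] by blast

lemma measurable_slices:
  "(\<lambda>x. w x 0) \<in> borel_measurable (lebesgue_on {a<..<b})"
  "0 < t \<Longrightarrow> (\<lambda>x. w x t) \<in> borel_measurable (lebesgue_on {a<..<b})"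
  "0 < t \<Longrightarrow> (\<lambda>x. wx x t) \<in> borel_measurable (lebesgue_on {a<..<b})"
  by (auto intro: continuous_measurable_interval w0_slice w_slice wx_slice)

lemma deviation_eventually: "0 < e \<Longrightarrow> \<forall>\<^sub>F t in at_right 0. deviation t < ennreal e"
  using order_tendstoD(2)[OF dist, of "ennreal e"] by (simp add: deviation_def ennreal_less_zero_iff)

text \<open>
  The Sobolev inequality for the difference of two slices, which is classically differentiable; the
  slice at time \<open>0\<close> need not be, and therefore only enters through the triangle inequality.
\<close>

lemma slices_close:
  assumes t: "0 < t" and s: "0 < s" and e: "0 \<le> e" "deviation t \<le> ennreal e" "deviation s \<le> ennreal e"
    and x: "x \<in> {a..b}"
  shows "(b - a) * (w x t - w x s)\<^sup>2 \<le> (8 + 8 * (b - a)\<^sup>2) * e"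
proof -
  let ?f = "\<lambda>x. w x t - w x s" and ?f' = "\<lambda>x. wx x t - wx x s"
  let ?M = "lebesgue_on {a<..<b}"
  let ?D = "\<lambda>t x. ennreal ((w x t - w x 0)\<^sup>2 + (wx x t - W0 x)\<^sup>2)"
  note [measurable] = measurable_slices(1) measurable_slices(2,3)[OF t] measurable_slices(2,3)[OF s] W0_meas
  have cf: "continuous_on {a..b} ?f" "continuous_on {a..b} ?f'"
    by (intro continuous_intros w_slice wx_slice t s)+
  have "ennreal (integral {a..b} (\<lambda>x. (?f x)\<^sup>2 + (?f' x)\<^sup>2)) = (\<integral>\<^sup>+x. ennreal ((?f x)\<^sup>2 + (?f' x)\<^sup>2) \<partial>?M)"
    by (rule nn_integral_lebesgue_on_cont[symmetric]) (intro continuous_intros cf, simp)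
  also have "\<dots> \<le> (\<integral>\<^sup>+x. 2 * ?D t x + 2 * ?D s x \<partial>?M)"
  proof (rule nn_integral_mono)
    fix x
    have sq: "(A - B)\<^sup>2 \<le> 2 * (A - C)\<^sup>2 + 2 * (B - C)\<^sup>2" for A B C :: real
      using zero_le_power2[of "A + B - 2 * C"] by (simp add: power2_eq_square algebra_simps)
    have "(?f x)\<^sup>2 + (?f' x)\<^sup>2 \<le> 2 * ((w x t - w x 0)\<^sup>2 + (wx x t - W0 x)\<^sup>2)
        + 2 * ((w x s - w x 0)\<^sup>2 + (wx x s - W0 x)\<^sup>2)"
      using sq[of "w x t" "w x s" "w x 0"] sq[of "wx x t" "wx x s" "W0 x"] by simp
    then have "ennreal ((?f x)\<^sup>2 + (?f' x)\<^sup>2) \<le> ennreal (2 * ((w x t - w x 0)\<^sup>2 + (wx x t - W0 x)\<^sup>2)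
        + 2 * ((w x s - w x 0)\<^sup>2 + (wx x s - W0 x)\<^sup>2))" by (rule ennreal_leI)
    also have "\<dots> = 2 * ?D t x + 2 * ?D s x"
      by (simp add: ennreal_plus[symmetric] ennreal_mult'[symmetric] del: ennreal_plus
          flip: ennreal_numeral)
    finally show "ennreal ((?f x)\<^sup>2 + (?f' x)\<^sup>2) \<le> 2 * ?D t x + 2 * ?D s x" .
  qed
  also have "\<dots> = 2 * deviation t + 2 * deviation s"
    unfolding deviation_def by (simp add: nn_integral_add nn_integral_cmult)
  also have "\<dots> \<le> 2 * ennreal e + 2 * ennreal e"
    using e by (intro add_mono mult_left_mono) auto
  also have "\<dots> = ennreal (4 * e)"
    using e by (simp add: ennreal_mult' flip: distrib_right)
  finally have "integral {a..b} (\<lambda>x. (?f x)\<^sup>2 + (?f' x)\<^sup>2) \<le> 4 * e"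
    using e by (simp add: ennreal_le_iff)
  moreover have "integral {a..b} (\<lambda>x. (?f x)\<^sup>2 + (?f' x)\<^sup>2)
      = integral {a..b} (\<lambda>x. (?f x)\<^sup>2) + integral {a..b} (\<lambda>x. (?f' x)\<^sup>2)"
    by (rule integral_add; rule integrable_continuous_real) (intro continuous_intros cf)+
  moreover have "0 \<le> integral {a..b} (\<lambda>x. (?f x)\<^sup>2)" "0 \<le> integral {a..b} (\<lambda>x. (?f' x)\<^sup>2)"
    by (auto intro!: integral_nonneg_cont continuous_intros w_slice wx_slice t s)
  ultimately have I: "integral {a..b} (\<lambda>x. (?f x)\<^sup>2) \<le> 4 * e" "integral {a..b} (\<lambda>x. (?f' x)\<^sup>2) \<le> 4 * e"
    by linarith+
  have "(b - a) * (?f x)\<^sup>2 \<le> 2 * integral {a..b} (\<lambda>x. (?f x)\<^sup>2) + 2 * (b - a)\<^sup>2 * integral {a..b} (\<lambda>x. (?f' x)\<^sup>2)"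
    by (rule square_le_W12[OF DERIV_diff[OF w_x w_x] cf(2) x]) (use t s in auto)
  also have "\<dots> \<le> 2 * (4 * e) + 2 * (b - a)\<^sup>2 * (4 * e)"
    using I by (intro add_mono mult_left_mono) auto
  finally show ?thesis by (simp add: algebra_simps)
qed

text \<open>
  The slices at positive times converge uniformly because they form a Cauchy family; that their
  limit is the continuous function \<open>w(\<cdot>, 0)\<close> is read off from the convergence in \<open>L\<^sup>2\<close>.
\<close>

lemma slice_close_to_initial:
  assumes e: "0 \<le> e" and t0: "\<And>s. 0 < s \<Longrightarrow> s < t0 \<Longrightarrow> deviation s \<le> ennreal e"
    and t: "0 < t" "t < t0" and x: "x \<in> {a..b}"
  shows "(b - a) * (w x t - w x 0)\<^sup>2 \<le> 2 * ((8 + 8 * (b - a)\<^sup>2) * e)"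
proof (rule ccontr)
  assume neg: "\<not> ?thesis"
  let ?C = "(8 + 8 * (b - a)\<^sup>2) * e"
  let ?f = "\<lambda>y. (b - a) * (w y t - w y 0)\<^sup>2"
  \<comment> \<open>a violation at \<open>x\<close> persists on an interval of fixed length \<open>l\<close>; all later slices are close to
     \<open>w(\<cdot>, t)\<close> there, so their distance to \<open>w(\<cdot>, 0)\<close> in \<open>L\<^sup>2\<close> could not tend to zero\<close>
  define \<delta> where "\<delta> = (?f x - 2 * ?C) / 2"
  have \<delta>: "0 < \<delta>" using neg by (simp add: \<delta>_def)
  have "continuous_on {a..b} ?f" by (intro continuous_intros w_slice w0_slice t)
  then obtain r where r: "0 < r" "\<And>y. y \<in> {a..b} \<Longrightarrow> dist y x < r \<Longrightarrow> dist (?f y) (?f x) < \<delta>"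
    using x \<delta> unfolding continuous_on_iff by metis
  define l where "l = min (r / 2) ((b - a) / 2)"
  have l: "0 < l" "l \<le> (b - a) / 2" "l < r" using r ab by (auto simp: l_def min_def)
  obtain c where c: "{c..c + l} \<subseteq> {a..b}" "\<And>y. y \<in> {c..c + l} \<Longrightarrow> \<bar>x - y\<bar> \<le> l"
    using half_interval_at[OF x less_imp_le[OF l(1)] l(2)] by metis
  have big: "2 * ?C + \<delta> \<le> ?f y" if y: "y \<in> {c..c + l}" for y
  proof -
    have "dist y x < r" using c(2)[OF y] l(3) by (simp add: dist_real_def abs_minus_commute)
    then have "\<bar>?f y - ?f x\<bar> < \<delta>" using r(2)[of y] y c(1) by (auto simp: dist_real_def)
    moreover have "2 * \<delta> = ?f x - 2 * ?C" by (simp add: \<delta>_def)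
    moreover have "2 * C + \<delta> \<le> F" if "\<bar>F - G\<bar> < \<delta>" "2 * \<delta> = G - 2 * C" for F G C :: real
      using that by linarith
    ultimately show ?thesis by blast
  qed
  define \<theta> where "\<theta> = l * (\<delta> / (2 * (b - a)))"
  have \<theta>: "0 < \<theta>" using l \<delta> ab by (simp add: \<theta>_def)
  have lower: "ennreal \<theta> \<le> deviation s" if s: "0 < s" "s < t0" for s
  proof -
    have pt: "\<delta> / (2 * (b - a)) \<le> (w y s - w y 0)\<^sup>2" if y: "y \<in> {c..c + l}" for y
    proof -
      have y': "y \<in> {a..b}" using y c(1) by auto
      have 1: "(b - a) * (w y t - w y s)\<^sup>2 \<le> ?C"
        using t t0 s by (intro slices_close[OF t(1) s(1) e _ _ y']) auto
      have "(w y t - w y 0)\<^sup>2 \<le> 2 * (w y t - w y s)\<^sup>2 + 2 * (w y s - w y 0)\<^sup>2"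
        using zero_le_power2[of "w y t - 2 * w y s + w y 0"] by (simp add: power2_eq_square algebra_simps)
      then have 2: "(b - a) * (w y t - w y 0)\<^sup>2 \<le> (b - a) * (2 * (w y t - w y s)\<^sup>2 + 2 * (w y s - w y 0)\<^sup>2)"
        using ab by (intro mult_left_mono) auto
      have "\<delta> / (2 * B) \<le> S" if "B * T \<le> C" "F \<le> B * (2 * T + 2 * S)" "2 * C + \<delta> \<le> F" "0 < B"
        for B T C F S :: real
        using that by (simp add: field_simps)
      from this[OF 1 2 big[OF y]] ab show ?thesis by simp
    qed
    have sub: "{c<..<c + l} \<subseteq> {a<..<b}"
      using c(1) l by (auto simp: atLeastatMost_subset_iff)
    have "ennreal \<theta> = (\<integral>\<^sup>+y. ennreal (\<delta> / (2 * (b - a))) * indicator {c<..<c + l} y \<partial>lebesgue)"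
      using l \<delta> ab
      by (subst nn_integral_cmult_indicator) (auto simp: \<theta>_def mult.commute simp flip: ennreal_mult')
    also have "\<dots> \<le> (\<integral>\<^sup>+y\<in>{a<..<b}. ennreal ((w y s - w y 0)\<^sup>2 + (wx y s - W0 y)\<^sup>2) \<partial>lebesgue)"
    proof (rule nn_integral_mono)
      fix y
      show "ennreal (\<delta> / (2 * (b - a))) * indicator {c<..<c + l} y
          \<le> ennreal ((w y s - w y 0)\<^sup>2 + (wx y s - W0 y)\<^sup>2) * indicator {a<..<b} y"
      proof (cases "y \<in> {c<..<c + l}")
        case True
        then have y: "y \<in> {c..c + l}" "y \<in> {a<..<b}" using sub by auto
        have "\<delta> / (2 * (b - a)) \<le> (w y s - w y 0)\<^sup>2 + (wx y s - W0 y)\<^sup>2"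
          using pt[OF y(1)] zero_le_power2[of "wx y s - W0 y"] by linarith
        then show ?thesis using True y by (simp add: ennreal_leI del: ennreal_plus)
      qed simp
    qed
    finally show ?thesis by (simp add: deviation_def nn_integral_lebesgue_on)
  qed
  have "\<forall>\<^sub>F s in at_right 0. s < t0" using t by (intro order_tendstoD(2)[OF tendsto_ident_at]) auto
  then have "\<forall>\<^sub>F s in at_right (0::real). False"
    using deviation_eventually[OF \<theta>] eventually_at_right_less[of "0::real"]
  proof eventually_elim
    case (elim s)
    then show ?case using lower[of s] by simp
  qed
  then show False by simp
qed

lemma initial_uniform:
  assumes "0 < \<rho>"
  shows "\<forall>\<^sub>F t in at_right 0. \<forall>x\<in>{a..b}. \<bar>w x t - w x 0\<bar> \<le> \<rho>"
proof -
  define e where "e = (b - a) * \<rho>\<^sup>2 / (2 * (8 + 8 * (b - a)\<^sup>2))"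
  have den: "0 < 2 * (8 + 8 * (b - a)\<^sup>2)" by (simp add: add_pos_nonneg)
  have e: "0 < e" using ab assms den by (simp add: e_def)
  from deviation_eventually[OF e] obtain t0 where t0: "0 < t0" "\<And>s. 0 < s \<Longrightarrow> s < t0 \<Longrightarrow> deviation s < ennreal e"
    unfolding eventually_at_right_field by blast
  have "\<bar>w x t - w x 0\<bar> \<le> \<rho>" if t: "0 < t" "t < t0" and x: "x \<in> {a..b}" for x t
  proof -
    have "(b - a) * (w x t - w x 0)\<^sup>2 \<le> 2 * ((8 + 8 * (b - a)\<^sup>2) * e)"
      by (rule slice_close_to_initial[OF less_imp_le[OF e] _ t x]) (simp add: t0(2) less_imp_le)
    also have "\<dots> = (b - a) * \<rho>\<^sup>2"
    proof -
      have "2 * (K * (P / (2 * K))) = P" if "0 < 2 * K" for K P :: real using that by simp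
      from this[OF den] show ?thesis unfolding e_def .
    qed
    finally have "(w x t - w x 0)\<^sup>2 \<le> \<rho>\<^sup>2" using ab by simp
    then show ?thesis using assms by (simp add: abs_le_square_iff[symmetric])
  qed
  then show ?thesis unfolding eventually_at_right_field using t0(1) by blast
qed

lemma trace_joint_cont:
  assumes pos: "continuous_on ({a..b} \<times> {0<..}) (\<lambda>(x, t). w x t)"
  shows "continuous_on ({a..b} \<times> {0..}) (\<lambda>(x, t). w x t)"
  unfolding continuous_on_def
proof (rule ballI, clarsimp)
  fix x t assume xt: "a \<le> x" "x \<le> b" "0 \<le> (t::real)"
  show "((\<lambda>(x, t). w x t) \<longlongrightarrow> w x t) (at (x, t) within {a..b} \<times> {0..})"
  proof (cases "t = 0")
    case False
    have "((\<lambda>(x, t). w x t) \<longlongrightarrow> w x t) (at (x, t) within {a..b} \<times> {0<..})"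
      using pos xt False unfolding continuous_on_def by fastforce
    moreover have "at (x, t) within {a..b} \<times> {0<..} = at (x, t) within {a..b} \<times> {0..}"
      by (rule at_within_nhd[of _ "UNIV \<times> {0<..}"]) (use xt False in \<open>auto intro: open_Times\<close>)
    ultimately show ?thesis by simp
  next
    case True
    show ?thesis unfolding True tendsto_iff
    proof (intro allI impI)
      fix r :: real assume r: "0 < r"
      from initial_uniform[of "r / 2"] r obtain t0 :: real where t0: "0 < t0"
        "\<And>(s::real) (y::real). 0 < s \<Longrightarrow> s < t0 \<Longrightarrow> y \<in> {a..b} \<Longrightarrow> \<bar>w y s - w y 0\<bar> \<le> r / 2"
        unfolding eventually_at_right_field by auto
      obtain \<rho> where \<rho>: "0 < \<rho>" "\<And>y. y \<in> {a..b} \<Longrightarrow> dist y x < \<rho> \<Longrightarrow> dist (w y 0) (w x 0) < r / 2"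
        using w0_slice r xt unfolding continuous_on_iff
        by (metis atLeastAtMost_iff half_gt_zero)
      show "\<forall>\<^sub>F z in at (x, 0) within {a..b} \<times> {0..}. dist (case z of (x, t) \<Rightarrow> w x t) (w x 0) < r"
        unfolding eventually_at
      proof (intro exI[of _ "min \<rho> t0"] conjI ballI impI)
        show "0 < min \<rho> t0" using \<rho> t0 by simp
        fix z :: "real \<times> real" assume z: "z \<in> {a..b} \<times> {0..}" "z \<noteq> (x, 0) \<and> dist z (x, 0) < min \<rho> t0"
        obtain y s where ys: "z = (y, s)" by (cases z)
        have y: "y \<in> {a..b}" "0 \<le> s" using z ys by auto
        have "dist y x < \<rho>" "dist s 0 < t0"
          using dist_fst_le[of z "(x, 0)"] dist_snd_le[of z "(x, 0)"] z ys by auto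
        then have d1: "\<bar>w y 0 - w x 0\<bar> < r / 2" and s: "s < t0"
          using \<rho>(2)[OF y(1)] y(2) by (auto simp: dist_real_def)
        have "\<bar>w y s - w y 0\<bar> \<le> r / 2" using t0(2)[of s y] y s r by (cases "s = 0") auto
        then show "dist (case z of (x, t) \<Rightarrow> w x t) (w x 0) < r"
          unfolding ys prod.case dist_real_def using d1 by linarith
      qed
    qed
  qed
qed

text \<open>
  The square root of \<open>w\<close> converges in \<open>W\<^sup>1\<^sup>,\<^sup>2\<close> as well, as \<open>w(\<cdot>, 0)\<close> is bounded below.
\<close>

lemma sqrt_gradient_tendsto:
  assumes pos: "\<And>x. x \<in> {a..b} \<Longrightarrow> 2 * \<mu> \<le> w x 0" and \<mu>: "0 < \<mu>"
  shows "((\<lambda>t. \<integral>\<^sup>+x. ennreal ((wx x t / (2 * sqrt (w x t)) - W0 x / (2 * sqrt (w x 0)))\<^sup>2) \<partial>lebesgue_on {a<..<b})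
    \<longlongrightarrow> 0) (at_right 0)"
proof (rule order_tendstoI)
  fix r :: ennreal assume "0 < r"
  then obtain q' where q': "0 < q'" "q' < r" using dense by blast
  then obtain q where q: "0 < q" "ennreal q < r"
    by (cases q') (auto simp: ennreal_less_zero_iff)
  let ?M = "lebesgue_on {a<..<b}"
  obtain B where B: "(\<integral>\<^sup>+x. ennreal ((W0 x)\<^sup>2) \<partial>?M) = ennreal B" "0 \<le> B"
    using W0_sq by (cases "\<integral>\<^sup>+x. ennreal ((W0 x)\<^sup>2) \<partial>?M") auto
  \<comment> \<open>the difference splits into \<open>w\<^sub>x - W0\<close> over \<open>2 \<surd>w\<close>, which the convergence in
     \<open>W\<^sup>1\<^sup>,\<^sup>2\<close> controls with the factor \<open>1 / \<mu>\<close>, and \<open>W0\<close> times a difference of reciprocals,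
     which uniform closeness \<open>\<rho>\<close> of \<open>w\<close> to its initial values controls with the factor
     \<open>\<kappa> \<rho>\<^sup>2\<close>\<close>
  define \<kappa> where "\<kappa> = 1 / (2 * \<mu> ^ 3)"
  have \<kappa>: "0 < \<kappa>" using \<mu> by (simp add: \<kappa>_def)
  define \<rho> where "\<rho> = min \<mu> (sqrt (q / (2 * \<kappa> * (B + 1))))"
  have \<rho>: "0 < \<rho>" "\<rho> \<le> \<mu>" "\<kappa> * \<rho>\<^sup>2 * B \<le> q / 2"
  proof -
    show "0 < \<rho>" "\<rho> \<le> \<mu>" using \<mu> q(1) \<kappa> B(2) by (auto simp: \<rho>_def)
    have "\<rho>\<^sup>2 \<le> (sqrt (q / (2 * \<kappa> * (B + 1))))\<^sup>2"
      using \<open>0 < \<rho>\<close> by (intro power_mono) (auto simp: \<rho>_def)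
    also have "\<dots> = q / (2 * \<kappa> * (B + 1))" using q(1) \<kappa> B(2) by simp
    finally have "\<kappa> * \<rho>\<^sup>2 * B \<le> \<kappa> * (q / (2 * \<kappa> * (B + 1))) * B"
      using \<kappa> B(2) by (intro mult_right_mono mult_left_mono) auto
    also have "\<dots> = q / 2 * (B / (B + 1))" using \<kappa> by simp
    also have "\<dots> \<le> q / 2 * 1" using q(1) B(2) by (intro mult_left_mono) auto
    finally show "\<kappa> * \<rho>\<^sup>2 * B \<le> q / 2" by simp
  qed
  have "\<forall>\<^sub>F t in at_right 0. deviation t < ennreal (\<mu> * q / 2)"
    by (rule deviation_eventually) (use \<mu> q in simp)
  then show "\<forall>\<^sub>F t in at_right 0. (\<integral>\<^sup>+x. ennreal ((wx x t / (2 * sqrt (w x t)) - W0 x / (2 * sqrt (w x 0)))\<^sup>2) \<partial>?M) < r"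
    using initial_uniform[OF \<rho>(1)] eventually_at_right_less[of "0::real"]
  proof eventually_elim
    case (elim t)
    note [measurable] = measurable_slices(1) measurable_slices(2,3)[OF elim(3)] W0_meas
    have "(\<integral>\<^sup>+x. ennreal ((wx x t / (2 * sqrt (w x t)) - W0 x / (2 * sqrt (w x 0)))\<^sup>2) \<partial>?M)
        \<le> (\<integral>\<^sup>+x. ennreal (1 / \<mu>) * ennreal ((w x t - w x 0)\<^sup>2 + (wx x t - W0 x)\<^sup>2)
            + ennreal (\<kappa> * \<rho>\<^sup>2) * ennreal ((W0 x)\<^sup>2) \<partial>?M)"
    proof (rule nn_integral_mono)
      fix x assume "x \<in> space ?M"
      then have x: "x \<in> {a..b}" by simp
      define p p0 where "p = sqrt (w x t)" and "p0 = sqrt (w x 0)"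
      have wt: "\<mu> \<le> w x t" "2 * \<mu> \<le> w x 0" "\<bar>w x t - w x 0\<bar> \<le> \<rho>" using elim(2) x pos[OF x] \<rho>(2) by force+
      have p: "0 < p" "0 < p0" "p\<^sup>2 = w x t" "p0\<^sup>2 = w x 0" using wt \<mu> by (auto simp: p_def p0_def)
      have pm: "\<mu> \<le> p\<^sup>2" "\<mu> \<le> p0\<^sup>2" using wt \<mu> p by auto
      have split: "wx x t / (2 * p) - W0 x / (2 * p0) = (wx x t - W0 x) / (2 * p) + W0 x * (1 / (2 * p) - 1 / (2 * p0))"
        by (simp add: diff_divide_distrib right_diff_distrib)
      have "(X + Y)\<^sup>2 \<le> 2 * X\<^sup>2 + 2 * Y\<^sup>2" for X Y :: real
        using zero_le_power2[of "X - Y"] by (simp add: power2_eq_square algebra_simps)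
      from this[of "(wx x t - W0 x) / (2 * p)" "W0 x * (1 / (2 * p) - 1 / (2 * p0))"]
      have "(wx x t / (2 * p) - W0 x / (2 * p0))\<^sup>2
          \<le> 2 * ((wx x t - W0 x) / (2 * p))\<^sup>2 + 2 * (W0 x * (1 / (2 * p) - 1 / (2 * p0)))\<^sup>2"
        unfolding split .
      moreover have "2 * ((wx x t - W0 x) / (2 * p))\<^sup>2 \<le> 1 / \<mu> * (wx x t - W0 x)\<^sup>2"
      proof -
        have "2 * ((wx x t - W0 x) / (2 * p))\<^sup>2 = (1 / (2 * p\<^sup>2)) * (wx x t - W0 x)\<^sup>2"
          by (simp add: power_divide power_mult_distrib)
        also have "\<dots> \<le> 1 / \<mu> * (wx x t - W0 x)\<^sup>2"
          using pm \<mu> by (intro mult_right_mono frac_le) auto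
        finally show ?thesis .
      qed
      moreover have "2 * (W0 x * (1 / (2 * p) - 1 / (2 * p0)))\<^sup>2 \<le> \<kappa> * \<rho>\<^sup>2 * (W0 x)\<^sup>2"
      proof -
        have e1: "1 / (2 * p) - 1 / (2 * p0) = (p0\<^sup>2 - p\<^sup>2) / (2 * p * p0 * (p + p0))"
        proof -
          have "p0\<^sup>2 - p\<^sup>2 = (p0 - p) * (p + p0)" by (simp add: power2_eq_square algebra_simps)
          then have "(p0\<^sup>2 - p\<^sup>2) / (2 * p * p0 * (p + p0)) = (p0 - p) / (2 * p * p0)" using p(1,2) by simp
          then show ?thesis using p(1,2) by (simp add: field_simps)
        qed
        have e2: "\<mu> ^ 3 \<le> (p * p0 * (p + p0))\<^sup>2"
        proof -
          have "\<mu> * \<mu> * \<mu> \<le> p\<^sup>2 * p0\<^sup>2 * (p + p0)\<^sup>2"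
          proof (intro mult_mono pm)
            have "p\<^sup>2 \<le> (p + p0)\<^sup>2" using p by (intro power_mono) auto
            then show "\<mu> \<le> (p + p0)\<^sup>2" using pm by linarith
          qed (use \<mu> in auto)
          then show ?thesis by (simp add: power3_eq_cube power_mult_distrib)
        qed
        have "(w x 0 - w x t)\<^sup>2 \<le> \<rho>\<^sup>2"
          using wt(3) \<rho>(1) by (simp add: abs_le_square_iff[symmetric] abs_minus_commute)
        then have "(p0\<^sup>2 - p\<^sup>2)\<^sup>2 / (p * p0 * (p + p0))\<^sup>2 \<le> \<rho>\<^sup>2 / \<mu> ^ 3"
          using e2 \<mu> by (intro frac_le) (auto simp: p)
        then have "(W0 x)\<^sup>2 / 2 * ((p0\<^sup>2 - p\<^sup>2)\<^sup>2 / (p * p0 * (p + p0))\<^sup>2) \<le> (W0 x)\<^sup>2 / 2 * (\<rho>\<^sup>2 / \<mu> ^ 3)"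
          by (intro mult_left_mono) auto
        moreover have "2 * (W0 x * (1 / (2 * p) - 1 / (2 * p0)))\<^sup>2
            = (W0 x)\<^sup>2 / 2 * ((p0\<^sup>2 - p\<^sup>2)\<^sup>2 / (p * p0 * (p + p0))\<^sup>2)"
          unfolding e1 by (simp add: power_mult_distrib power_divide mult.assoc)
        ultimately show ?thesis by (simp add: \<kappa>_def mult.commute)
      qed
      moreover have "1 / \<mu> * (wx x t - W0 x)\<^sup>2 \<le> 1 / \<mu> * ((w x t - w x 0)\<^sup>2 + (wx x t - W0 x)\<^sup>2)"
        using \<mu> by (intro mult_left_mono) auto
      ultimately have "(wx x t / (2 * p) - W0 x / (2 * p0))\<^sup>2
          \<le> 1 / \<mu> * ((w x t - w x 0)\<^sup>2 + (wx x t - W0 x)\<^sup>2) + \<kappa> * \<rho>\<^sup>2 * (W0 x)\<^sup>2" by linarith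
      then have "ennreal ((wx x t / (2 * p) - W0 x / (2 * p0))\<^sup>2)
          \<le> ennreal (1 / \<mu> * ((w x t - w x 0)\<^sup>2 + (wx x t - W0 x)\<^sup>2) + \<kappa> * \<rho>\<^sup>2 * (W0 x)\<^sup>2)"
        by (rule ennreal_leI)
      also have "\<dots> = ennreal (1 / \<mu>) * ennreal ((w x t - w x 0)\<^sup>2 + (wx x t - W0 x)\<^sup>2)
            + ennreal (\<kappa> * \<rho>\<^sup>2) * ennreal ((W0 x)\<^sup>2)"
      proof -
        have *: "ennreal (K * A + L * B) = ennreal K * ennreal A + ennreal L * ennreal B"
          if "0 \<le> K" "0 \<le> A" "0 \<le> L" "0 \<le> B" for K A L B
          using that by (simp add: ennreal_mult)
        show ?thesis by (rule *) (use \<mu> \<kappa> in auto)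
      qed
      finally show "ennreal ((wx x t / (2 * sqrt (w x t)) - W0 x / (2 * sqrt (w x 0)))\<^sup>2)
          \<le> ennreal (1 / \<mu>) * ennreal ((w x t - w x 0)\<^sup>2 + (wx x t - W0 x)\<^sup>2)
            + ennreal (\<kappa> * \<rho>\<^sup>2) * ennreal ((W0 x)\<^sup>2)" by (simp only: p_def p0_def)
    qed
    also have "\<dots> = ennreal (1 / \<mu>) * deviation t + ennreal (\<kappa> * \<rho>\<^sup>2) * ennreal B"
    proof -
      have "(\<integral>\<^sup>+x. ennreal (1 / \<mu>) * F x + ennreal (\<kappa> * \<rho>\<^sup>2) * H x \<partial>?M)
          = ennreal (1 / \<mu>) * (\<integral>\<^sup>+x. F x \<partial>?M) + ennreal (\<kappa> * \<rho>\<^sup>2) * (\<integral>\<^sup>+x. H x \<partial>?M)"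
        if [measurable]: "F \<in> borel_measurable ?M" "H \<in> borel_measurable ?M" for F H
        by (simp add: nn_integral_add nn_integral_cmult)
      note * = this
      show ?thesis unfolding deviation_def B(1)[symmetric] by (rule *; measurable)
    qed
    also have "\<dots> \<le> ennreal (1 / \<mu>) * ennreal (\<mu> * q / 2) + ennreal (\<kappa> * \<rho>\<^sup>2) * ennreal B"
      using elim(1) by (intro add_mono mult_left_mono) auto
    also have "\<dots> = ennreal (q / 2 + \<kappa> * \<rho>\<^sup>2 * B)"
    proof -
      have *: "ennreal K * ennreal A + ennreal L * ennreal C = ennreal (K * A + L * C)"
        if "0 \<le> K" "0 \<le> A" "0 \<le> L" "0 \<le> C" for K A L C
        using that by (simp add: ennreal_mult)
      have "1 / \<mu> * (\<mu> * q / 2) = q / 2" using \<mu> by simp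
      with *[of "1 / \<mu>" "\<mu> * q / 2" "\<kappa> * \<rho>\<^sup>2" B] show ?thesis using \<mu> \<kappa> q(1) B(2) by simp
    qed
    also have "\<dots> \<le> ennreal q" using \<rho>(3) by (intro ennreal_leI) linarith
    also have "\<dots> < r" by (rule q(2))
    finally show ?case .
  qed
qed simp

text \<open>
  At positive times the integration by parts against a test function is classical, and both sides
  of it converge as \<open>t \<down> 0\<close>: the left one by uniform convergence of the slices, the right one by
  convergence of the gradients of the square roots in \<open>L\<^sup>2\<close>.
\<close>

lemma initial_sqrt_weak_deriv:
  assumes pos: "\<And>x. x \<in> {a..b} \<Longrightarrow> 2 * \<mu> \<le> w x 0" and \<mu>: "0 < \<mu>"
    and cont: "continuous_on ({a..b} \<times> {0<..}) (\<lambda>(x, t). w x t)"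
    and wpos: "\<And>x t. x \<in> {a..b} \<Longrightarrow> 0 < t \<Longrightarrow> 0 < w x t"
  shows "has_weak_deriv {a<..<b} (\<lambda>x. sqrt (w x 0)) (\<lambda>x. W0 x / (2 * sqrt (w x 0)))"
proof -
  let ?M = "lebesgue_on {a<..<b}"
  let ?S = "\<lambda>x. W0 x / (2 * sqrt (w x 0))" and ?s = "\<lambda>t x. wx x t / (2 * sqrt (w x t))"
  note [measurable] = measurable_slices(1) W0_meas
  have s_cont: "continuous_on {a..b} (?s t)" if t: "0 < t" for t
    using wpos[OF _ t] by (intro continuous_intros w_slice wx_slice t) (auto simp: less_le)
  have s_deriv: "((\<lambda>x. sqrt (w x t)) has_real_derivative ?s t x) (at x within {a..b})"
    if "x \<in> {a..b}" "0 < t" for x t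
  proof -
    have "((\<lambda>x. sqrt (w x t)) has_real_derivative inverse (sqrt (w x t)) / 2 * wx x t) (at x within {a..b})"
      by (rule DERIV_chain2[OF DERIV_real_sqrt w_x]) (use wpos that in auto)
    then show ?thesis by (simp add: field_simps)
  qed
  have S_sq: "(\<integral>\<^sup>+x. ennreal ((?S x)\<^sup>2) \<partial>?M) < \<infinity>"
  proof -
    have "(\<integral>\<^sup>+x. ennreal ((?S x)\<^sup>2) \<partial>?M) \<le> (\<integral>\<^sup>+x. ennreal (1 / \<mu>) * ennreal ((W0 x)\<^sup>2) \<partial>?M)"
    proof (rule nn_integral_mono)
      fix x assume "x \<in> space ?M"
      then have x: "x \<in> {a..b}" by simp
      have "(?S x)\<^sup>2 = 1 / (4 * w x 0) * (W0 x)\<^sup>2"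
        using pos[OF x] \<mu> by (simp add: power_divide power_mult_distrib)
      also have "\<dots> \<le> 1 / \<mu> * (W0 x)\<^sup>2"
        using pos[OF x] \<mu> by (intro mult_right_mono frac_le) auto
      finally show "ennreal ((?S x)\<^sup>2) \<le> ennreal (1 / \<mu>) * ennreal ((W0 x)\<^sup>2)"
        using \<mu> by (simp flip: ennreal_mult add: ennreal_leI)
    qed
    also have "\<dots> = ennreal (1 / \<mu>) * (\<integral>\<^sup>+x. ennreal ((W0 x)\<^sup>2) \<partial>?M)" by (rule nn_integral_cmult) measurable
    also have "\<dots> < \<infinity>" using W0_sq by (simp add: ennreal_mult_less_top)
    finally show ?thesis .
  qed
  \<comment> \<open>square integrability over a bounded interval gives integrability\<close>
  have int_of_sq: "integrable ?M F" if "F \<in> borel_measurable ?M" "(\<integral>\<^sup>+x. ennreal ((F x)\<^sup>2) \<partial>?M) < \<infinity>"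
    for F :: "real \<Rightarrow> real"
  proof (rule integrableI_bounded)
    show [measurable]: "F \<in> borel_measurable ?M" by fact
    have "(\<integral>\<^sup>+x. ennreal (norm (F x)) \<partial>?M) \<le> (\<integral>\<^sup>+x. 1 + ennreal ((F x)\<^sup>2) \<partial>?M)"
    proof (rule nn_integral_mono)
      fix x
      have "\<bar>F x\<bar> \<le> 1 + (F x)\<^sup>2"
        using zero_le_power2[of "\<bar>F x\<bar> - 1"] zero_le_power2[of "F x"]
        by (simp add: power2_eq_square algebra_simps)
      then show "ennreal (norm (F x)) \<le> 1 + ennreal ((F x)\<^sup>2)"
        by (metis ennreal_1 ennreal_leI ennreal_plus real_norm_def zero_le_one zero_le_power2)
    qed
    also have "\<dots> = emeasure ?M (space ?M) + (\<integral>\<^sup>+x. ennreal ((F x)\<^sup>2) \<partial>?M)"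
      by (subst nn_integral_add) auto
    also have "\<dots> < \<infinity>" using that(2) ab by (simp add: emeasure_restrict_space less_top[symmetric])
    finally show "(\<integral>\<^sup>+x. ennreal (norm (F x)) \<partial>?M) < \<infinity>" .
  qed
  have S_int: "integrable ?M ?S" by (rule int_of_sq[OF _ S_sq]) measurable
  have const_int: "integrable ?M (\<lambda>x. k)" for k :: real
    by (rule finite_measure.integrable_const[OF finite_measure_lebesgue_on]) simp
  have w_joint: "continuous_on ({a..b} \<times> {0..}) (\<lambda>(x, t). w x t)" by (rule trace_joint_cont[OF cont])
  have set_int: "set_integrable lebesgue {a<..<b} F \<longleftrightarrow> integrable ?M F"
    "(LINT x:{a<..<b}|lebesgue. F x) = (LINT x|?M. F x)" for F :: "real \<Rightarrow> real"
    unfolding set_integrable_def set_lebesgue_integral_def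
    by (simp_all add: integrable_restrict_space integral_restrict_space)
  show ?thesis
    unfolding has_weak_deriv_def
  proof (intro conjI allI impI)
    fix K :: "real set" assume K: "compact K \<and> K \<subseteq> {a<..<b}"
    then have Kl: "K \<in> sets lebesgue" by (simp add: compact_imp_closed lmeasurable_compact)
    show "set_integrable lebesgue K (\<lambda>x. sqrt (w x 0))"
      by (rule set_integrable_subset[OF LINT_interval(1) Kl]) (use K in \<open>auto intro!: continuous_intros w0_slice\<close>)
    show "set_integrable lebesgue K ?S"
      by (rule set_integrable_subset[OF set_int(1)[THEN iffD2, OF S_int] Kl]) (use K in simp)
  next
    fix \<phi> assume \<phi>: "test_function {a<..<b} \<phi>"
    obtain d: "\<And>x. (\<phi> has_real_derivative deriv \<phi> x) (at x)" and cd: "continuous_on UNIV (deriv \<phi>)"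
      and "\<And>x. x \<notin> {a<..<b} \<Longrightarrow> \<phi> x = 0" using test_function_facts[OF \<phi>] by blast
    have c\<phi>: "continuous_on {a..b} \<phi>" "continuous_on {a..b} (deriv \<phi>)"
      using DERIV_continuous_on[of UNIV \<phi>] d cd by (auto intro: continuous_on_subset)
    have "bounded (\<phi> ` {a..b})" by (rule compact_imp_bounded[OF compact_continuous_image[OF c\<phi>(1) compact_Icc]])
    then obtain C where C: "\<And>x. x \<in> {a..b} \<Longrightarrow> \<bar>\<phi> x\<bar> \<le> C"
      unfolding bounded_iff real_norm_def by blast
    have C0: "0 \<le> C" using C[of a] ab by force
    have \<phi>_meas[measurable]: "\<phi> \<in> borel_measurable ?M" by (rule continuous_measurable_interval[OF c\<phi>(1)])
    define L where "L = (LINT x:{a<..<b}|lebesgue. sqrt (w x 0) * deriv \<phi> x)"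
    define R where "R = (LINT x:{a<..<b}|lebesgue. ?S x * \<phi> x)"
    have lim1: "((\<lambda>t. LINT x:{a<..<b}|lebesgue. sqrt (w x t) * deriv \<phi> x) \<longlongrightarrow> L) (at_right 0)"
    proof -
      have "continuous_on {0..} (\<lambda>t. integral {a..b} (\<lambda>x. sqrt (w x t) * deriv \<phi> x))"
        by (rule continuous_on_integral_time)
          (use w_joint in \<open>auto simp: split_beta' intro!: continuous_intros
            continuous_on_compose2[OF c\<phi>(2)]\<close>)
      then have "((\<lambda>t. integral {a..b} (\<lambda>x. sqrt (w x t) * deriv \<phi> x))
          \<longlongrightarrow> integral {a..b} (\<lambda>x. sqrt (w x 0) * deriv \<phi> x)) (at 0 within {0..})"
        unfolding continuous_on_def by auto
      then have "((\<lambda>t. integral {a..b} (\<lambda>x. sqrt (w x t) * deriv \<phi> x))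
          \<longlongrightarrow> integral {a..b} (\<lambda>x. sqrt (w x 0) * deriv \<phi> x)) (at_right 0)"
        by (rule tendsto_within_subset) auto
      moreover have "\<forall>\<^sub>F t in at_right 0. integral {a..b} (\<lambda>x. sqrt (w x t) * deriv \<phi> x)
          = (LINT x:{a<..<b}|lebesgue. sqrt (w x t) * deriv \<phi> x)"
        using eventually_at_right_less[of "0::real"]
        by eventually_elim (intro LINT_interval(2)[symmetric] continuous_intros w_slice c\<phi>)
      moreover have "L = integral {a..b} (\<lambda>x. sqrt (w x 0) * deriv \<phi> x)"
        unfolding L_def by (intro LINT_interval(2) continuous_intros w0_slice c\<phi>)
      ultimately show ?thesis using Lim_transform_eventually by force
    qed
    have lim2: "((\<lambda>t. LINT x:{a<..<b}|lebesgue. ?s t x * \<phi> x) \<longlongrightarrow> R) (at_right 0)"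
    proof (rule tendstoI)
      fix r :: real assume r: "0 < r"
      define \<eta> where "\<eta> = r / (2 * (C + 1) * (b - a + 1))"
      have \<eta>: "0 < \<eta>" using r C0 ab by (simp add: \<eta>_def)
      have "\<forall>\<^sub>F t in at_right 0. (\<integral>\<^sup>+x. ennreal ((?s t x - ?S x)\<^sup>2) \<partial>?M) < ennreal (\<eta>\<^sup>2)"
        using order_tendstoD(2)[OF sqrt_gradient_tendsto[OF pos \<mu>], of "ennreal (\<eta>\<^sup>2)"] \<eta>
        by (simp add: ennreal_less_zero_iff)
      then show "\<forall>\<^sub>F t in at_right 0. dist (LINT x:{a<..<b}|lebesgue. ?s t x * \<phi> x) R < r"
        using eventually_at_right_less[of "0::real"]
      proof eventually_elim
        case (elim t)
        have s_meas[measurable]: "?s t \<in> borel_measurable ?M"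
          by (rule continuous_measurable_interval[OF s_cont[OF elim(2)]])
        have D_meas[measurable]: "(\<lambda>x. ?s t x - ?S x) \<in> borel_measurable ?M" by measurable
        have D_sq: "(\<integral>\<^sup>+x. ennreal ((?s t x - ?S x)\<^sup>2) \<partial>?M) < \<infinity>" using elim(1) by (rule less_trans) simp
        have D_int: "integrable ?M (\<lambda>x. ?s t x - ?S x)" by (rule int_of_sq[OF D_meas D_sq])
        have Dsq_int: "integrable ?M (\<lambda>x. (?s t x - ?S x)\<^sup>2)"
          by (rule integrableI_nonneg) (use D_sq in auto)
        have i1: "integrable ?M (\<lambda>x. ?s t x * \<phi> x)"
          using LINT_interval(1)[OF continuous_on_mult[OF s_cont[OF elim(2)] c\<phi>(1)]] by (simp add: set_int)
        have i2: "integrable ?M (\<lambda>x. ?S x * \<phi> x)"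
        proof (rule Bochner_Integration.integrable_bound[OF integrable_mult_right[OF S_int, of C]])
          show "AE x in ?M. norm (?S x * \<phi> x) \<le> norm (C * ?S x)"
          proof (rule AE_I2)
            fix x assume "x \<in> space ?M"
            then have "\<bar>\<phi> x\<bar> \<le> \<bar>C\<bar>" using C[of x] by simp
            then have "\<bar>?S x\<bar> * \<bar>\<phi> x\<bar> \<le> \<bar>?S x\<bar> * \<bar>C\<bar>" by (rule mult_left_mono) simp
            then show "norm (?S x * \<phi> x) \<le> norm (C * ?S x)" by (simp only: real_norm_def abs_mult mult.commute)
          qed
        qed measurable
        have "dist (LINT x:{a<..<b}|lebesgue. ?s t x * \<phi> x) R = norm (LINT x|?M. ?s t x * \<phi> x - ?S x * \<phi> x)"
          unfolding R_def set_int dist_norm using i1 i2 by simp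
        also have "\<dots> \<le> (LINT x|?M. norm (?s t x * \<phi> x - ?S x * \<phi> x))" by (rule integral_norm_bound)
        also have "\<dots> \<le> (LINT x|?M. C * \<eta> + C / \<eta> * (?s t x - ?S x)\<^sup>2)"
        proof (rule integral_mono)
          show "integrable ?M (\<lambda>x. norm (?s t x * \<phi> x - ?S x * \<phi> x))" using i1 i2 by simp
          show "integrable ?M (\<lambda>x. C * \<eta> + C / \<eta> * (?s t x - ?S x)\<^sup>2)"
            using Dsq_int const_int by (intro Bochner_Integration.integrable_add integrable_mult_right) auto
          fix x assume "x \<in> space ?M"
          then have x: "x \<in> {a..b}" by simp
          let ?y = "?s t x - ?S x"
          have "\<bar>?y\<bar> \<le> \<eta> + ?y\<^sup>2 / \<eta>"
          proof -
            have "0 \<le> (\<bar>?y\<bar> - \<eta>)\<^sup>2 + \<bar>?y\<bar> * \<eta>" using \<eta> by simp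
            also have "\<dots> = \<eta> * (\<eta> + ?y\<^sup>2 / \<eta> - \<bar>?y\<bar>)"
              using \<eta> by (simp only: power2_eq_square abs_mult_self) (simp add: field_simps power2_eq_square)
            finally show ?thesis using \<eta> by (simp add: zero_le_mult_iff)
          qed
          then have "C * \<bar>?y\<bar> \<le> C * (\<eta> + ?y\<^sup>2 / \<eta>)" using C0 by (rule mult_left_mono)
          moreover have "norm (?s t x * \<phi> x - ?S x * \<phi> x) \<le> C * \<bar>?y\<bar>"
          proof -
            have "norm (?s t x * \<phi> x - ?S x * \<phi> x) = \<bar>?y\<bar> * \<bar>\<phi> x\<bar>"
              by (simp only: real_norm_def left_diff_distrib[symmetric] abs_mult)
            also have "\<dots> \<le> \<bar>?y\<bar> * C" using C[OF x] by (rule mult_left_mono) simp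
            finally show ?thesis by (simp only: mult.commute)
          qed
          moreover have "C * (\<eta> + ?y\<^sup>2 / \<eta>) = C * \<eta> + C / \<eta> * ?y\<^sup>2" by (simp add: distrib_left)
          ultimately show "norm (?s t x * \<phi> x - ?S x * \<phi> x) \<le> C * \<eta> + C / \<eta> * ?y\<^sup>2" by linarith
        qed
        also have "\<dots> = C * \<eta> * (b - a) + C / \<eta> * (LINT x|?M. (?s t x - ?S x)\<^sup>2)"
        proof -
          note const_int[of "C * \<eta>"]
          moreover have "(LINT x|?M. C * \<eta>) = C * \<eta> * (b - a)"
            using ab by (simp add: measure_restrict_space)
          ultimately show ?thesis using Dsq_int by (subst Bochner_Integration.integral_add) auto
        qed
        also have "\<dots> \<le> C * \<eta> * (b - a) + C / \<eta> * \<eta>\<^sup>2"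
        proof -
          have "ennreal (LINT x|?M. (?s t x - ?S x)\<^sup>2) = (\<integral>\<^sup>+x. ennreal ((?s t x - ?S x)\<^sup>2) \<partial>?M)"
            by (rule nn_integral_eq_integral[symmetric, OF Dsq_int]) simp
          then have "ennreal (LINT x|?M. (?s t x - ?S x)\<^sup>2) \<le> ennreal (\<eta>\<^sup>2)" using elim(1) by simp
          then have "(LINT x|?M. (?s t x - ?S x)\<^sup>2) \<le> \<eta>\<^sup>2" by (simp add: ennreal_le_iff)
          then show ?thesis using C0 \<eta> by (intro add_mono mult_left_mono) auto
        qed
        also have "\<dots> = C * \<eta> * (b - a + 1)" using \<eta> by (simp add: power2_eq_square distrib_left)
        also have "\<dots> < r"
        proof -
          have "C * \<eta> * (b - a + 1) \<le> (C + 1) * \<eta> * (b - a + 1)"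
            using C0 \<eta> ab by (intro mult_right_mono) auto
          also have "\<dots> = r / 2"
          proof -
            have "P * (r / (2 * P * Q)) * Q = r / 2" if "0 < P" "0 < Q" for P Q :: real
              using that by simp
            from this[of "C + 1" "b - a + 1"] show ?thesis using C0 ab by (simp only: \<eta>_def)
          qed
          also have "\<dots> < r" using r by simp
          finally show ?thesis .
        qed
        finally show ?case .
      qed
    qed
    have "\<forall>\<^sub>F t in at_right 0. (LINT x:{a<..<b}|lebesgue. sqrt (w x t) * deriv \<phi> x)
        = - (LINT x:{a<..<b}|lebesgue. ?s t x * \<phi> x)"
      using eventually_at_right_less[of "0::real"]
    proof eventually_elim
      case (elim t)
      have "has_weak_deriv {a<..<b} (\<lambda>x. sqrt (w x t)) (?s t)"
        by (rule classical_has_weak_deriv[OF s_deriv s_cont]) (use elim ab in auto)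
      then show ?case using \<phi> unfolding has_weak_deriv_def by blast
    qed
    then have "((\<lambda>t. LINT x:{a<..<b}|lebesgue. sqrt (w x t) * deriv \<phi> x) \<longlongrightarrow> - R) (at_right 0)"
      using tendsto_minus[OF lim2] by (simp add: tendsto_cong)
    then have "L = - R" using lim1 by (intro tendsto_unique[of "at_right (0::real)"]) auto
    then show "(LINT x:{a<..<b}|lebesgue. sqrt (w x 0) * deriv \<phi> x) = - (LINT x:{a<..<b}|lebesgue. ?S x * \<phi> x)"
      by (simp add: L_def R_def)
  qed
qed

text \<open>
  The gradients \<open>(\<surd>w)\<^sub>x\<close> converge in \<open>L\<^sup>2\<close> to the weak derivative at \<open>t = 0\<close>, which is the one that
  occurs in \<open>grad_sq_over\<close>. The factor \<open>2\<close> comes from splitting the square; any bound that depends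
  on \<open>G\<close> alone serves its purpose.
\<close>

lemma initial_gradient_energy:
  assumes pos: "\<And>x. x \<in> {a..b} \<Longrightarrow> 2 * \<mu> \<le> w x 0" and \<mu>: "0 < \<mu>"
    and cont: "continuous_on ({a..b} \<times> {0<..}) (\<lambda>(x, t). w x t)"
    and wpos: "\<And>x t. x \<in> {a..b} \<Longrightarrow> 0 < t \<Longrightarrow> 0 < w x t"
    and d: "continuous_on {a..b} d" "\<And>x. x \<in> {a..b} \<Longrightarrow> 0 \<le> d x"
    and G: "(\<integral>\<^sup>+x\<in>{a<..<b}. ennreal (d x * grad_sq_over {a<..<b} (\<lambda>x. w x 0) x) \<partial>lebesgue) \<le> ennreal G" "0 \<le> G"
  shows "\<forall>\<^sub>F t in at_right 0. integral {a..b} (\<lambda>x. d x * (wx x t)\<^sup>2 / w x t) \<le> 2 * G + 1"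
proof -
  let ?M = "lebesgue_on {a<..<b}"
  let ?S = "\<lambda>x. W0 x / (2 * sqrt (w x 0))" and ?s = "\<lambda>t x. wx x t / (2 * sqrt (w x t))"
  note [measurable] = measurable_slices(1) W0_meas
  have dm[measurable]: "d \<in> borel_measurable ?M" by (rule continuous_measurable_interval[OF d(1)])
  note hw = initial_sqrt_weak_deriv[OF pos \<mu> cont wpos]
  have "has_weak_deriv {a<..<b} (\<lambda>x. sqrt (w x 0)) (weak_deriv {a<..<b} (\<lambda>x. sqrt (w x 0)))"
    unfolding weak_deriv_def by (rule someI[where P = "has_weak_deriv {a<..<b} (\<lambda>x. sqrt (w x 0))", OF hw])
  from weak_deriv_unique[OF this hw]
  have "AE x in ?M. weak_deriv {a<..<b} (\<lambda>x. sqrt (w x 0)) x = ?S x" by (simp add: AE_lebesgue_on)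
  then have "(\<integral>\<^sup>+x. ennreal (d x * (4 * (?S x)\<^sup>2)) \<partial>?M)
      = (\<integral>\<^sup>+x. ennreal (d x * grad_sq_over {a<..<b} (\<lambda>x. w x 0) x) \<partial>?M)"
    by (intro nn_integral_cong_AE) (auto simp: grad_sq_over_def elim!: eventually_mono)
  then have GS: "(\<integral>\<^sup>+x. ennreal (d x * (4 * (?S x)\<^sup>2)) \<partial>?M) \<le> ennreal G"
    using G(1) by (simp add: nn_integral_lebesgue_on)
  obtain D where D: "\<And>x. x \<in> {a..b} \<Longrightarrow> d x \<le> D" "0 \<le> D"
  proof -
    obtain x1 where "x1 \<in> {a..b}" "\<And>x. x \<in> {a..b} \<Longrightarrow> d x \<le> d x1"
      using continuous_attains_sup[OF compact_Icc _ d(1)] ab by auto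
    then show ?thesis using d(2) by (intro that[of "d x1"]) auto
  qed
  have "\<forall>\<^sub>F t in at_right 0. (\<integral>\<^sup>+x. ennreal ((?s t x - ?S x)\<^sup>2) \<partial>?M) < ennreal (1 / (8 * D + 1))"
    by (rule order_tendstoD(2)[OF sqrt_gradient_tendsto[OF pos \<mu>]])
      (use D(2) in \<open>simp_all add: ennreal_less_zero_iff add_nonneg_pos\<close>)
  then show ?thesis using eventually_at_right_less[of "0::real"]
  proof eventually_elim
    case (elim t)
    have wt: "0 < w x t" if "x \<in> {a..b}" for x using wpos that elim by simp
    have cs: "continuous_on {a..b} (\<lambda>x. d x * (wx x t)\<^sup>2 / w x t)"
      using wt by (intro continuous_intros d w_slice wx_slice elim) (auto simp: less_le)
    have s_meas[measurable]: "?s t \<in> borel_measurable ?M"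
      using wt by (intro continuous_measurable_interval[of a b] continuous_intros w_slice wx_slice elim)
        (auto simp: less_le)
    have "ennreal (integral {a..b} (\<lambda>x. d x * (wx x t)\<^sup>2 / w x t)) = (\<integral>\<^sup>+x. ennreal (d x * (wx x t)\<^sup>2 / w x t) \<partial>?M)"
      using d(2) wt by (intro nn_integral_lebesgue_on_cont[symmetric] cs) (auto simp: less_imp_le)
    also have "\<dots> \<le> (\<integral>\<^sup>+x. 2 * ennreal (d x * (4 * (?S x)\<^sup>2)) + ennreal (8 * D) * ennreal ((?s t x - ?S x)\<^sup>2) \<partial>?M)"
    proof (rule nn_integral_mono)
      fix x assume "x \<in> space ?M"
      then have x: "x \<in> {a..b}" by simp
      have "d x * (wx x t)\<^sup>2 / w x t = d x * (4 * (?s t x)\<^sup>2)"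
        using wt[OF x] by (simp add: power_divide power_mult_distrib)
      also have "\<dots> \<le> d x * (4 * (2 * (?S x)\<^sup>2 + 2 * (?s t x - ?S x)\<^sup>2))"
      proof -
        have "X\<^sup>2 \<le> 2 * Y\<^sup>2 + 2 * (X - Y)\<^sup>2" for X Y :: real
          using zero_le_power2[of "X - 2 * Y"] by (simp add: power2_eq_square algebra_simps)
        then show ?thesis using d(2)[OF x] by (intro mult_left_mono) auto
      qed
      also have "\<dots> = 2 * (d x * (4 * (?S x)\<^sup>2)) + d x * (8 * (?s t x - ?S x)\<^sup>2)" by (simp only: distrib_left)
      also have "d x * (8 * (?s t x - ?S x)\<^sup>2) \<le> D * (8 * (?s t x - ?S x)\<^sup>2)"
        using D(1)[OF x] by (rule mult_right_mono) simp
      finally have le: "d x * (wx x t)\<^sup>2 / w x t \<le> 2 * (d x * (4 * (?S x)\<^sup>2)) + 8 * D * (?s t x - ?S x)\<^sup>2"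
        by (simp add: mult_ac)
      have "ennreal (d x * (wx x t)\<^sup>2 / w x t) \<le> ennreal (2 * (d x * (4 * (?S x)\<^sup>2)) + 8 * D * (?s t x - ?S x)\<^sup>2)"
        by (rule ennreal_leI[OF le])
      also have "\<dots> = 2 * ennreal (d x * (4 * (?S x)\<^sup>2)) + ennreal (8 * D) * ennreal ((?s t x - ?S x)\<^sup>2)"
      proof -
        have *: "ennreal (2 * A + 8 * D * B) = 2 * ennreal A + ennreal (8 * D) * ennreal B"
          if "0 \<le> A" "0 \<le> B" for A B
          using that D(2) by (simp add: ennreal_mult)
        show ?thesis by (rule *) (use d(2)[OF x] in auto)
      qed
      finally show "ennreal (d x * (wx x t)\<^sup>2 / w x t)
          \<le> 2 * ennreal (d x * (4 * (?S x)\<^sup>2)) + ennreal (8 * D) * ennreal ((?s t x - ?S x)\<^sup>2)" .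
    qed
    also have "\<dots> = 2 * (\<integral>\<^sup>+x. ennreal (d x * (4 * (?S x)\<^sup>2)) \<partial>?M) + ennreal (8 * D) * (\<integral>\<^sup>+x. ennreal ((?s t x - ?S x)\<^sup>2) \<partial>?M)"
    proof -
      have *: "(\<integral>\<^sup>+x. 2 * F x + k * H x \<partial>?M) = 2 * (\<integral>\<^sup>+x. F x \<partial>?M) + k * (\<integral>\<^sup>+x. H x \<partial>?M)"
        if [measurable]: "F \<in> borel_measurable ?M" "H \<in> borel_measurable ?M" for F H k
        by (simp add: nn_integral_add nn_integral_cmult)
      show ?thesis by (rule *; measurable)
    qed
    also have "\<dots> \<le> 2 * ennreal G + ennreal (8 * D) * ennreal (1 / (8 * D + 1))"
      using GS elim(1) by (intro add_mono mult_left_mono) auto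
    also have "\<dots> = ennreal (2 * G + 8 * D * (1 / (8 * D + 1)))"
    proof -
      have *: "2 * ennreal A + ennreal B * ennreal C = ennreal (2 * A + B * C)"
        if "0 \<le> A" "0 \<le> B" "0 \<le> C" for A B C
        using that by (simp add: ennreal_mult)
      show ?thesis by (rule *) (use G(2) D(2) in auto)
    qed
    also have "\<dots> \<le> ennreal (2 * G + 1)"
      using D(2) by (intro ennreal_leI add_left_mono) (simp add: field_simps)
    finally show ?case using G(2) by (simp add: ennreal_le_iff del: ennreal_plus)
  qed
qed

end

section \<open>Estimates with explicit constants\<close>

context taxis_solution
begin

text \<open>
  The constants of the preceding estimates, composed. \<open>E\<close> bounds the gradient energy, \<open>K\<close> the
  integral of \<open>w\<^sub>x\<^sup>2\<close>, \<open>- Y\<close> is the lower bound of \<open>\<integral> (ln v) / d\<close>, and \<open>A\<close> bounds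
  \<open>\<integral> \<bar>ln v\<bar>\<close>. It matters that \<open>\<epsilon>\<close> does not appear.
\<close>

definition log_cube_bound :: "real \<Rightarrow> real \<Rightarrow> real \<Rightarrow> real \<Rightarrow> real \<Rightarrow> real \<Rightarrow> real \<Rightarrow> real \<Rightarrow> real"
  where "log_cube_bound \<tau> T D W M0 H L m =
    (let E = H + sqrt (\<gamma>\<^sub>2 * W) / (4 * \<gamma>\<^sub>1\<^sup>2) * T + L;
         K = 2 * \<gamma>\<^sub>2 * ratio_bound T D M0 W E * E;
         Y = log_lower \<tau> K L m;
         A = D * (2 * m + Y)
     in 8 * A * (2 * (m + Y) + K * (T - \<tau>)) + 64 * A ^ 3 / (b - a) ^ 3 * (T - \<tau>))"

text \<open>
  The function \<open>N\<close> is an affine function of \<open>\<integral> (ln v)\<^sub>x\<^sup>2\<close>. A continuous majorant of the cube of the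
  supremum norm is more convenient in the passage to the limit than the norm itself.
\<close>

lemma log_cube_estimate:
  assumes \<tau>: "0 < \<tau>" "\<tau> < T" and e: "0 < e" "\<epsilon> = e ^ 4" "2 * e\<^sup>2 \<le> 1"
    and D: "\<And>x. x \<in> {a..b} \<Longrightarrow> d x \<le> D" and d_lower: "\<And>x. x \<in> {a..b} \<Longrightarrow> e \<le> d x"
    and dxd: "\<And>x. x \<in> {a..b} \<Longrightarrow> e * \<bar>dx x\<bar> \<le> d x"
    and A: "\<epsilon> * integral {a..b} (\<lambda>x. dx x ^ 4 / (d x)\<^sup>2) \<le> 1"
    and W: "\<And>x t. x \<in> {a..b} \<Longrightarrow> 0 < t \<Longrightarrow> t \<le> T \<Longrightarrow> w x t \<le> W"
    and M0: "\<And>x. x \<in> {a..b} \<Longrightarrow> w x 0 \<le> M0 * d x"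
    and H: "\<forall>\<^sub>F s in at_right 0. energy s \<le> H"
    and L: "integral {a..b} (\<lambda>x. 1 / d x) \<le> L"
    and m: "integral {a..b} (\<lambda>x. u x 0) = m" "0 < m"
  shows "\<exists>N. continuous_on {\<tau>..T} N \<and> integral {\<tau>..T} N \<le> log_cube_bound \<tau> T D W M0 H L m
    \<and> (\<forall>x\<in>{a..b}. \<forall>t\<in>{\<tau>..T}. \<bar>ln (d x * u x t)\<bar> ^ 3 \<le> N t)"
proof -
  define E K Y B where "E = H + sqrt (\<gamma>\<^sub>2 * W) / (4 * \<gamma>\<^sub>1\<^sup>2) * T + L"
    and "K = 2 * \<gamma>\<^sub>2 * ratio_bound T D M0 W E * E" and "Y = log_lower \<tau> K L m"
    and "B = D * (2 * m + Y)"
  let ?Q = "\<lambda>t. integral {a..b} (\<lambda>x. (lgrad x t)\<^sup>2)"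
  have W0: "0 < W" using W[of a \<tau>] w_pos[of a \<tau>] ab \<tau> by force
  have E_bound: "gradient_energy t \<le> E" if t: "0 < t" "t \<le> T" for t
  proof -
    have "\<forall>\<^sub>F s in at_right 0. s < t" using t by (intro order_tendstoD(2)[OF tendsto_ident_at]) auto
    then have "\<forall>\<^sub>F s in at_right 0. energy s \<le> H \<and> s < t \<and> 0 < s"
      using H eventually_at_right_less[of "0::real"] by eventually_elim simp
    then obtain s where s: "energy s \<le> H" "s < t" "0 < s"
      using eventually_happens[of _ "at_right (0::real)"] by force
    have "gradient_energy t \<le> energy s + sqrt (\<gamma>\<^sub>2 * W) / (4 * \<gamma>\<^sub>1\<^sup>2) * (t - s) + integral {a..b} (\<lambda>x. 1 / d x)"
      by (rule gradient_energy_le[OF s(3) _ _ A]) (use s t W in auto)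
    also have "\<dots> \<le> H + sqrt (\<gamma>\<^sub>2 * W) / (4 * \<gamma>\<^sub>1\<^sup>2) * T + L"
      using s t L \<gamma> W0 by (intro add_mono mult_left_mono) auto
    finally show ?thesis by (simp add: E_def)
  qed
  have M_bound: "w x t / d x \<le> ratio_bound T D M0 W E" if t: "0 < t" "t \<le> T" and x: "x \<in> {a..b}" for x t
  proof (rule ratio_le[OF t e D d_lower dxd _ _ E_bound[OF t] x])
    let ?p = "nat \<lfloor>1 / e\<^sup>2\<rfloor>"
    have "integral {a..b} (\<lambda>x. (w x 0 / d x) ^ ?p) \<le> integral {a..b} (\<lambda>x. (max 1 M0) ^ ?p)"
    proof (rule integral_mono_cont)
      have "continuous_on {a..b} (\<lambda>x. w x 0)" by (rule continuous_on_space_slice[OF w_cont]) simp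
      then show "continuous_on {a..b} (\<lambda>x. (w x 0 / d x) ^ ?p)"
        by (auto intro!: continuous_intros d_cont simp: nonzero)
      fix x assume x: "x \<in> {a..b}"
      have "w x 0 / d x \<le> M0" using M0[OF x] d_pos[OF x] by (simp add: field_simps)
      then show "(w x 0 / d x) ^ ?p \<le> (max 1 M0) ^ ?p"
        using d_pos[OF x] w_pos[OF x, of 0] by (intro power_mono) auto
    qed simp
    then show "integral {a..b} (\<lambda>x. (w x 0 / d x) ^ ?p) \<le> (b - a) * (max 1 M0) ^ ?p" using ab by simp
  qed (use W t in auto)
  have K_bound: "integral {a..b} (\<lambda>x. (wx x t)\<^sup>2) \<le> K" if t: "0 < t" "t \<le> T" for t
    unfolding K_def by (rule nutrient_gradient_le[OF t(1) M_bound[OF t] E_bound[OF t]])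
  note est = log_estimate[OF \<tau> K_bound L m D, folded Y_def, folded B_def]
  have Q_cont: "continuous_on {\<tau>..T} ?Q"
    by (rule continuous_on_subset[OF log_gradient_cont]) (use \<tau> in auto)
  have K0: "0 \<le> K"
    by (rule order_trans[OF _ K_bound[of \<tau>]], rule integral_nonneg_cont)
      (use \<tau> in \<open>auto intro!: continuous_intros slice_facts\<close>)
  have L0: "0 \<le> L"
    by (rule order_trans[OF _ L], rule integral_nonneg_cont)
      (use d_pos in \<open>auto intro!: continuous_intros d_cont simp: nonzero less_imp_le\<close>)
  have D0: "0 < D" using D[of a] d_pos[of a] ab by force
  have B0: "0 \<le> B"
    unfolding B_def Y_def log_lower_def using D0 m(2) K0 L0 \<tau> ab
    by (intro mult_nonneg_nonneg add_nonneg_nonneg divide_nonneg_nonneg) auto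
  let ?N = "\<lambda>t. 8 * B * ?Q t + 64 * B ^ 3 / (b - a) ^ 3"
  have "integral {\<tau>..T} ?N = 8 * B * integral {\<tau>..T} ?Q + 64 * B ^ 3 / (b - a) ^ 3 * (T - \<tau>)"
  proof -
    have "integral {\<tau>..T} ?N = integral {\<tau>..T} (\<lambda>t. 8 * B * ?Q t) + integral {\<tau>..T} (\<lambda>t. 64 * B ^ 3 / (b - a) ^ 3)"
      by (rule integral_add; rule integrable_continuous_real; intro continuous_intros Q_cont)
    then show ?thesis using \<tau> by (simp add: mult.commute)
  qed
  also have "\<dots> \<le> 8 * B * (2 * (m + Y) + K * (T - \<tau>)) + 64 * B ^ 3 / (b - a) ^ 3 * (T - \<tau>)"
    using est(1) B0 by (intro add_right_mono mult_left_mono) auto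
  also have "\<dots> = log_cube_bound \<tau> T D W M0 H L m"
    unfolding log_cube_bound_def Let_def by (simp only: E_def K_def Y_def B_def)
  finally have "integral {\<tau>..T} ?N \<le> log_cube_bound \<tau> T D W M0 H L m" .
  moreover have "continuous_on {\<tau>..T} ?N" by (intro continuous_intros Q_cont)
  ultimately show ?thesis
    by (intro exI[of _ ?N] conjI ballI est(2)) auto
qed

text \<open>
  For \<open>t \<down> 0\<close> the logarithm in the entropy is estimated by \<open>v ln v \<le> v\<^sup>2\<close>, so that only
  continuity of \<open>u\<close> at \<open>t = 0\<close> is needed where \<open>u\<close> may vanish.
\<close>

lemma initial_energy_le:
  assumes D: "\<And>x. x \<in> {a..b} \<Longrightarrow> d x \<le> D"
    and U: "\<And>x. x \<in> {a..b} \<Longrightarrow> u x 0 \<le> U" "\<And>x. x \<in> {a..b} \<Longrightarrow> 0 \<le> u x 0"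
    and G1: "\<forall>\<^sub>F t in at_right 0. integral {a..b} (\<lambda>x. d x * (wx x t)\<^sup>2 / w x t) \<le> G1"
    and G2: "integral {a..b} (\<lambda>x. (dx x)\<^sup>2 / d x * w x 0) \<le> G2"
  shows "\<forall>\<^sub>F s in at_right 0. energy s \<le> (D * U\<^sup>2 * (b - a) + 1) + G1 / (2 * \<gamma>\<^sub>1) + (G2 + 1) / \<gamma>\<^sub>1"
proof -
  have lim: "(f \<longlongrightarrow> f 0) (at_right 0)" if "continuous_on {0..} f" for f :: "real \<Rightarrow> real"
  proof -
    have "(f \<longlongrightarrow> f 0) (at 0 within {0..})" using that by (simp add: continuous_on_def)
    then show ?thesis by (rule tendsto_within_subset) auto
  qed
  have "continuous_on {0..} (\<lambda>t. integral {a..b} (\<lambda>x. d x * (u x t)\<^sup>2))"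
    by (rule continuous_on_integral_time) (auto simp: split_beta' intro!: continuous_intros joint_cont0)
  note l1 = lim[OF this]
  have "continuous_on {0..} weighted_nutrient"
    unfolding weighted_nutrient_def
    by (rule continuous_on_integral_time) (auto simp: split_beta' nonzero intro!: continuous_intros joint_cont0)
  note l2 = lim[OF this]
  have I0: "integral {a..b} (\<lambda>x. d x * (u x 0)\<^sup>2) \<le> D * U\<^sup>2 * (b - a)"
  proof -
    have "integral {a..b} (\<lambda>x. d x * (u x 0)\<^sup>2) \<le> integral {a..b} (\<lambda>x. D * U\<^sup>2)"
    proof (rule integral_mono_cont)
      have "continuous_on {a..b} (\<lambda>x. u x 0)" by (rule continuous_on_space_slice[OF u_cont]) simp
      then show "continuous_on {a..b} (\<lambda>x. d x * (u x 0)\<^sup>2)" by (intro continuous_intros d_cont)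
      show "d x * (u x 0)\<^sup>2 \<le> D * U\<^sup>2" if x: "x \<in> {a..b}" for x
        using D[OF x] U[OF x] d_pos[OF x] by (intro mult_mono power_mono) auto
    qed simp
    then show ?thesis using ab by (simp add: mult_ac)
  qed
  have "\<forall>\<^sub>F t in at_right 0. integral {a..b} (\<lambda>x. d x * (u x t)\<^sup>2) < D * U\<^sup>2 * (b - a) + 1"
    using I0 by (intro order_tendstoD(2)[OF l1]) simp
  moreover have "\<forall>\<^sub>F t in at_right 0. weighted_nutrient t < G2 + 1"
    using G2 by (intro order_tendstoD(2)[OF l2]) (simp add: weighted_nutrient_def)
  ultimately show ?thesis using G1 eventually_at_right_less[of "0::real"]
  proof eventually_elim
    case (elim t)
    note t = elim(4)
    have gp: "0 < g (w x t)" "0 < w x t" "0 < d x" "0 < u x t" if "x \<in> {a..b}" for x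
      using g_pos[OF w_pos[of x t]] w_pos[of x t] d_pos u_pos that t by auto
    have "mass_entropy t \<le> integral {a..b} (\<lambda>x. d x * (u x t)\<^sup>2)"
      unfolding mass_entropy_def
    proof (rule integral_mono_cont)
      fix x assume x: "x \<in> {a..b}"
      have "ln (d x * u x t) \<le> d x * u x t"
        using ln_le_minus_one[of "d x * u x t"] gp[OF x] by simp
      then have "u x t * ln (d x * u x t) \<le> u x t * (d x * u x t)"
        using gp[OF x] by (intro mult_left_mono) auto
      then show "u x t * ln (d x * u x t) \<le> d x * (u x t)\<^sup>2" by (simp add: power2_eq_square mult_ac)
    qed (use t in \<open>auto intro!: continuous_intros slice_facts d_cont simp: nonzero\<close>)
    moreover have "gradient_energy t \<le> G1 / (2 * \<gamma>\<^sub>1)"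
    proof -
      have "integral {a..b} (\<lambda>x. d x * (wx x t)\<^sup>2 / g (w x t))
          \<le> integral {a..b} (\<lambda>x. 1 / \<gamma>\<^sub>1 * (d x * (wx x t)\<^sup>2 / w x t))"
      proof (rule integral_mono_cont)
        fix x assume x: "x \<in> {a..b}"
        note p = gp[OF x]
        have "d x * (wx x t)\<^sup>2 / g (w x t) \<le> d x * (wx x t)\<^sup>2 / (\<gamma>\<^sub>1 * w x t)"
          using p \<gamma> g_bounds(1)[OF p(2)] by (intro divide_left_mono) auto
        then show "d x * (wx x t)\<^sup>2 / g (w x t) \<le> 1 / \<gamma>\<^sub>1 * (d x * (wx x t)\<^sup>2 / w x t)" by simp
      qed (use t \<gamma> in \<open>auto intro!: continuous_intros slice_facts d_cont simp: nonzero less_imp_le[OF t]\<close>)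
      also have "\<dots> = 1 / \<gamma>\<^sub>1 * integral {a..b} (\<lambda>x. d x * (wx x t)\<^sup>2 / w x t)" by (rule integral_mult_right)
      also have "\<dots> \<le> 1 / \<gamma>\<^sub>1 * G1" using elim(3) \<gamma> by (intro mult_left_mono) auto
      finally show ?thesis unfolding gradient_energy_def by simp
    qed
    moreover have "weighted_nutrient t / \<gamma>\<^sub>1 \<le> (G2 + 1) / \<gamma>\<^sub>1"
      using elim(2) \<gamma> by (intro divide_right_mono) auto
    ultimately show ?case unfolding energy_def using elim(1) by linarith
  qed
qed

end

section \<open>From the regularized problems to the estimates\<close>

lemma der_onI:
  assumes "(F has_real_derivative L) (at x within S)" "x \<in> S" "\<And>y. y \<in> S \<Longrightarrow> G y = F y"
    and "at x within S \<noteq> bot"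
  shows "der_on S G x = L"
  unfolding der_on_def
proof (rule vector_derivative_within[OF assms(4)])
  have "(G has_real_derivative L) (at x within S)"
    by (rule has_field_derivative_transform_within[OF assms(1) zero_less_one assms(2)]) (use assms(3) in auto)
  then show "(G has_vector_derivative L) (at x within S)"
    by (simp add: has_real_derivative_iff_has_vector_derivative)
qed

lemma at_within_Icc_nontrivial: "a < b \<Longrightarrow> x \<in> {a..b} \<Longrightarrow> at x within {a..b} \<noteq> bot" for x :: real
  by (simp add: trivial_limit_within islimpt_Icc)

lemma eq_on_closed_interval:
  fixes f h :: "real \<Rightarrow> real"
  assumes "a < b" "continuous_on {a..b} f" "continuous_on {a..b} h"
    and "\<And>x. x \<in> {a<..<b} \<Longrightarrow> f x = h x" "x \<in> {a..b}"
  shows "f x = h x"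
proof -
  have "f x - h x = 0"
    by (rule continuous_constant_on_closure[of "{a<..<b}" "\<lambda>x. f x - h x"])
      (use assms in \<open>auto intro!: continuous_intros\<close>)
  then show ?thesis by simp
qed

text \<open>
  By continuity, a failure at one point would persist on an interval, which has positive measure.
\<close>

lemma AE_le_everywhere:
  fixes f h :: "real \<Rightarrow> real"
  assumes ab: "a < b" and c: "continuous_on {a..b} f" "continuous_on {a..b} h"
    and ae: "AE x in lebesgue. x \<in> {a<..<b} \<longrightarrow> f x \<le> h x" and x: "x \<in> {a..b}"
  shows "f x \<le> h x"
proof (rule ccontr)
  assume "\<not> f x \<le> h x"
  then have \<delta>: "0 < f x - h x" by simp
  have "continuous_on {a..b} (\<lambda>x. f x - h x)" by (intro continuous_intros c)
  then obtain r where r: "0 < r" "\<And>y. y \<in> {a..b} \<Longrightarrow> dist y x < r \<Longrightarrow> dist (f y - h y) (f x - h x) < f x - h x"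
    using x \<delta> unfolding continuous_on_iff by metis
  define l where "l = min (r / 2) ((b - a) / 2)"
  have l: "0 < l" "l \<le> (b - a) / 2" "l < r" using r ab by (auto simp: l_def min_def)
  obtain k where k: "{k..k + l} \<subseteq> {a..b}" "\<And>y. y \<in> {k..k + l} \<Longrightarrow> \<bar>x - y\<bar> \<le> l"
    using half_interval_at[OF x less_imp_le[OF l(1)] l(2)] by metis
  have "f y > h y" if y: "y \<in> {k..k + l}" for y
  proof -
    have "dist y x < r" using k(2)[OF y] l(3) by (simp add: dist_real_def abs_minus_commute)
    then show ?thesis using r(2)[of y] y k(1) by (auto simp: dist_real_def)
  qed
  then have "AE y in lebesgue. y \<notin> {k<..<k + l}"
    using ae
  proof (rule_tac eventually_mono[OF ae])
    fix y assume "y \<in> {a<..<b} \<longrightarrow> f y \<le> h y" and gt: "\<And>y. y \<in> {k..k + l} \<Longrightarrow> h y < f y"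
    moreover have "{k<..<k + l} \<subseteq> {a<..<b}" using k(1) l by (auto simp: atLeastatMost_subset_iff)
    ultimately show "y \<notin> {k<..<k + l}" by (metis (no_types, lifting) atLeastAtMost_iff greaterThanLessThan_iff less_imp_le not_less subsetD)
  qed
  then have "emeasure lebesgue {k<..<k + l} = 0"
    by (subst (asm) AE_iff_measurable[of "{k<..<k + l}"]) auto
  then show False using l by simp
qed

lemma C21E:
  assumes "C21 a b f"
  obtains fx fxx ft where
    "\<And>x t. x \<in> {a..b} \<Longrightarrow> 0 < t \<Longrightarrow> ((\<lambda>y. f y t) has_real_derivative fx x t) (at x within {a..b})"
    "\<And>x t. x \<in> {a..b} \<Longrightarrow> 0 < t \<Longrightarrow> ((\<lambda>y. fx y t) has_real_derivative fxx x t) (at x within {a..b})"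
    "\<And>x t. x \<in> {a..b} \<Longrightarrow> 0 < t \<Longrightarrow> ((\<lambda>s. f x s) has_real_derivative ft x t) (at t)"
    "continuous_on ({a..b} \<times> {0<..}) (\<lambda>(x, t). f x t)" "continuous_on ({a..b} \<times> {0<..}) (\<lambda>(x, t). fx x t)"
    "continuous_on ({a..b} \<times> {0<..}) (\<lambda>(x, t). fxx x t)" "continuous_on ({a..b} \<times> {0<..}) (\<lambda>(x, t). ft x t)"
proof -
  obtain fx fxx ft where *: "\<forall>x\<in>{a..b}. \<forall>t>0.
        ((\<lambda>y. f y t) has_real_derivative fx x t) (at x within {a..b})
      \<and> ((\<lambda>y. fx y t) has_real_derivative fxx x t) (at x within {a..b})
      \<and> ((\<lambda>s. f x s) has_real_derivative ft x t) (at t)"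
    "\<forall>h\<in>{f, fx, fxx, ft}. continuous_on ({a..b} \<times> {0<..}) (\<lambda>(x, t). h x t)"
    using assms unfolding C21_def by blast
  show ?thesis by (rule that[of fx fxx ft]) (use * in blast)+
qed

lemma smooth_on_derivs:
  assumes ab: "a < b" and f: "smooth_on {a..b} f"
  obtains f'' where "\<And>x. x \<in> {a..b} \<Longrightarrow> (f has_real_derivative der_on {a..b} f x) (at x within {a..b})"
    "\<And>x. x \<in> {a..b} \<Longrightarrow> (der_on {a..b} f has_real_derivative f'' x) (at x within {a..b})"
    "continuous_on {a..b} f''"
proof -
  have "Ck_on 2 {a..b} f" using f by (simp add: smooth_on_def)
  then obtain D where D: "D 0 = f" "\<And>i x. i < 2 \<Longrightarrow> x \<in> {a..b} \<Longrightarrow> (D i has_real_derivative D (Suc i) x) (at x within {a..b})"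
    "\<And>i. i \<le> 2 \<Longrightarrow> continuous_on {a..b} (D i)" unfolding Ck_on_def by metis
  have d: "der_on {a..b} f x = D 1 x" if x: "x \<in> {a..b}" for x
    by (rule der_onI[OF _ x _ at_within_Icc_nontrivial[OF ab x]]) (use D(2)[of 0 x] D(1) x in auto)
  show ?thesis
  proof (rule that[of "D 2"])
    show "(f has_real_derivative der_on {a..b} f x) (at x within {a..b})" if "x \<in> {a..b}" for x
      using D(2)[of 0 x] D(1) d that by simp
    show "(der_on {a..b} f has_real_derivative D 2 x) (at x within {a..b})" if x: "x \<in> {a..b}" for x
    proof -
      have "(D 1 has_real_derivative D 2 x) (at x within {a..b})"
        using D(2)[of 1 x] x by (simp add: numeral_2_eq_2)
      then show ?thesis
        by (rule has_field_derivative_transform_within[OF _ zero_less_one x]) (use d in auto)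
    qed
    show "continuous_on {a..b} (D 2)" by (rule D(3)) simp
  qed
qed

lemma nutrient_rate_facts:
  assumes g: "Ck_on 2 {0..} g" "g 0 = 0"
    and g': "\<forall>s\<ge>0. \<gamma>\<^sub>1 \<le> der_on {0..} g s \<and> der_on {0..} g s \<le> \<gamma>\<^sub>2"
  shows "\<And>s. 0 < s \<Longrightarrow> (g has_real_derivative der_on {0..} g s) (at s)"
    and "continuous_on {0<..} (der_on {0..} g)"
    and "\<And>s. 0 < s \<Longrightarrow> \<gamma>\<^sub>1 * s \<le> g s" and "\<And>s. 0 < s \<Longrightarrow> g s \<le> \<gamma>\<^sub>2 * s"
proof -
  obtain D where D: "D 0 = g" "\<And>i x. i < 2 \<Longrightarrow> x \<in> {0..} \<Longrightarrow> (D i has_real_derivative D (Suc i) x) (at x within {0..})"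
    "\<And>i. i \<le> 2 \<Longrightarrow> continuous_on {0..} (D i)" using g(1) unfolding Ck_on_def by metis
  have nb: "at s within {0..} \<noteq> bot" if "0 \<le> s" for s :: real
  proof -
    have "at s within {s..s + 1} \<noteq> bot" by (rule at_within_Icc_nontrivial) auto
    moreover have "at s within {s..s + 1} \<le> at s within {0..}" by (rule at_le) (use that in auto)
    ultimately show ?thesis by (metis bot.extremum_uniqueI)
  qed
  have d: "der_on {0..} g s = D 1 s" if s: "0 \<le> s" for s
    by (rule der_onI[OF _ _ _ nb[OF s]]) (use D(2)[of 0 s] D(1) s in auto)
  show gd: "(g has_real_derivative der_on {0..} g s) (at s)" if s: "0 < s" for s
  proof -
    have "(g has_real_derivative D 1 s) (at s within {0..})" using D(2)[of 0 s] D(1) s by simp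
    moreover have "at s within {0..} = at s" by (rule at_within_interior) (use s in simp)
    ultimately show ?thesis using d[of s] s by simp
  qed
  have "continuous_on {0<..} (D 1)" by (rule continuous_on_subset[OF D(3)[of 1]]) auto
  then show "continuous_on {0<..} (der_on {0..} g)"
    by (rule continuous_on_eq) (use d in auto)
  have cg: "continuous_on {0..} g" using D(3)[of 0] D(1) by simp
  show "\<gamma>\<^sub>1 * s \<le> g s" if s: "0 < s" for s
  proof -
    have "g 0 - \<gamma>\<^sub>1 * 0 \<le> g s - \<gamma>\<^sub>1 * s"
    proof (rule DERIV_nonneg_imp_increasing_open[where f = "\<lambda>s. g s - \<gamma>\<^sub>1 * s"])
      fix x assume "0 < x" "x < s"
      then show "\<exists>y. ((\<lambda>s. g s - \<gamma>\<^sub>1 * s) has_real_derivative y) (at x) \<and> 0 \<le> y"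
        using g' by (intro exI[of _ "der_on {0..} g x - \<gamma>\<^sub>1"]) (auto intro!: derivative_eq_intros gd)
    qed (use s in \<open>auto intro!: continuous_intros continuous_on_subset[OF cg]\<close>)
    then show ?thesis using g(2) by simp
  qed
  show "g s \<le> \<gamma>\<^sub>2 * s" if s: "0 < s" for s
  proof -
    have "g s - \<gamma>\<^sub>2 * s \<le> g 0 - \<gamma>\<^sub>2 * 0"
    proof (rule DERIV_nonpos_imp_decreasing_open[where f = "\<lambda>s. g s - \<gamma>\<^sub>2 * s"])
      fix x assume "0 < x" "x < s"
      then show "\<exists>y. ((\<lambda>s. g s - \<gamma>\<^sub>2 * s) has_real_derivative y) (at x) \<and> y \<le> 0"
        using g' by (intro exI[of _ "der_on {0..} g x - \<gamma>\<^sub>2"]) (auto intro!: derivative_eq_intros gd)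
    qed (use s in \<open>auto intro!: continuous_intros continuous_on_subset[OF cg]\<close>)
    then show ?thesis using g(2) by simp
  qed
qed

lemma w12_trace_exists:
  assumes ab: "a < b" and reg: "C0_W12 a b w"
    and w_x: "\<And>x t. x \<in> {a..b} \<Longrightarrow> 0 < t \<Longrightarrow>
      ((\<lambda>y. w y t) has_real_derivative wx x t) (at x within {a..b})"
    and wx_slice: "\<And>t. 0 < t \<Longrightarrow> continuous_on {a..b} (\<lambda>x. wx x t)"
    and w0_slice: "continuous_on {a..b} (\<lambda>x. w x 0)"
  obtains W0 where "w12_trace a b w wx W0"
proof -
  let ?M = "lebesgue_on {a<..<b}"
  have W: "W1p_on 2 {a<..<b} (\<lambda>x. w x t)" if "0 \<le> t" for t using reg that by (simp add: C0_W12_def)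
  have wd: "has_weak_deriv {a<..<b} (\<lambda>x. w x t) (weak_deriv {a<..<b} (\<lambda>x. w x t))" if t: "0 \<le> t" for t
  proof -
    obtain h where "has_weak_deriv {a<..<b} (\<lambda>x. w x t) h" using W[OF t] unfolding W1p_on_def by blast
    then show ?thesis unfolding weak_deriv_def by (rule someI[where P = "has_weak_deriv {a<..<b} (\<lambda>x. w x t)"])
  qed
  obtain W0 where W0: "has_weak_deriv {a<..<b} (\<lambda>x. w x 0) W0" "Lp_on 2 {a<..<b} W0"
    using W[of 0] unfolding W1p_on_def by auto
  have e0: "AE x in ?M. weak_deriv {a<..<b} (\<lambda>x. w x 0) x = W0 x"
    using weak_deriv_unique[OF wd[of 0] W0(1)] by (simp add: AE_lebesgue_on)
  have et: "AE x in ?M. weak_deriv {a<..<b} (\<lambda>x. w x t) x = wx x t" if t: "0 < t" for t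
    using weak_deriv_unique[OF wd[of t] classical_has_weak_deriv[OF w_x wx_slice]] t ab
    by (simp add: AE_lebesgue_on)
  have "w12_trace a b w wx W0"
  proof
    show "W0 \<in> borel_measurable ?M"
      using W0(2) unfolding Lp_on_def set_borel_measurable_def
      by (subst borel_measurable_restrict_space_iff) auto
    have "integrable lebesgue (\<lambda>x. indicator {a<..<b} x *\<^sub>R (\<bar>W0 x\<bar> powr 2))"
      using W0(2) unfolding Lp_on_def set_integrable_def by simp
    then have "(\<integral>\<^sup>+x. ennreal (norm (indicator {a<..<b} x *\<^sub>R (\<bar>W0 x\<bar> powr 2))) \<partial>lebesgue) < \<infinity>"
      by (simp add: integrable_iff_bounded)
    also have "(\<integral>\<^sup>+x. ennreal (norm (indicator {a<..<b} x *\<^sub>R (\<bar>W0 x\<bar> powr 2))) \<partial>lebesgue)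
        = (\<integral>\<^sup>+x\<in>{a<..<b}. ennreal ((W0 x)\<^sup>2) \<partial>lebesgue)"
      by (rule nn_integral_cong) (auto simp: indicator_def)
    finally show "(\<integral>\<^sup>+x. ennreal ((W0 x)\<^sup>2) \<partial>?M) < \<infinity>" by (simp add: nn_integral_lebesgue_on)
    have "((\<lambda>t. \<integral>\<^sup>+x\<in>{a<..<b}. ennreal ((w x t - w x 0)\<^sup>2
        + (weak_deriv {a<..<b} (\<lambda>y. w y t) x - weak_deriv {a<..<b} (\<lambda>y. w y 0) x)\<^sup>2) \<partial>lebesgue)
        \<longlongrightarrow> 0) (at 0 within {0..})"
      using reg by (simp add: C0_W12_def)
    then have "((\<lambda>t. \<integral>\<^sup>+x\<in>{a<..<b}. ennreal ((w x t - w x 0)\<^sup>2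
        + (weak_deriv {a<..<b} (\<lambda>y. w y t) x - weak_deriv {a<..<b} (\<lambda>y. w y 0) x)\<^sup>2) \<partial>lebesgue)
        \<longlongrightarrow> 0) (at_right 0)"
      by (rule tendsto_within_subset) auto
    then show "((\<lambda>t. \<integral>\<^sup>+x. ennreal ((w x t - w x 0)\<^sup>2 + (wx x t - W0 x)\<^sup>2) \<partial>?M) \<longlongrightarrow> 0) (at_right 0)"
    proof (rule Lim_transform_eventually)
      show "\<forall>\<^sub>F t in at_right 0. (\<integral>\<^sup>+x\<in>{a<..<b}. ennreal ((w x t - w x 0)\<^sup>2
          + (weak_deriv {a<..<b} (\<lambda>y. w y t) x - weak_deriv {a<..<b} (\<lambda>y. w y 0) x)\<^sup>2) \<partial>lebesgue)
          = (\<integral>\<^sup>+x. ennreal ((w x t - w x 0)\<^sup>2 + (wx x t - W0 x)\<^sup>2) \<partial>?M)"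
        using eventually_at_right_less[of "0::real"]
      proof eventually_elim
        case (elim t)
        show ?case unfolding nn_integral_lebesgue_on
        proof (rule nn_integral_cong_AE)
          show "AE x in ?M. ennreal ((w x t - w x 0)\<^sup>2
              + (weak_deriv {a<..<b} (\<lambda>y. w y t) x - weak_deriv {a<..<b} (\<lambda>y. w y 0) x)\<^sup>2)
            = ennreal ((w x t - w x 0)\<^sup>2 + (wx x t - W0 x)\<^sup>2)"
            using e0 et[OF elim] by eventually_elim simp
        qed
      qed
    qed
  qed (use ab w_x wx_slice w0_slice in auto)
  then show ?thesis by (rule that)
qed

text \<open>
  The equations hold in the open interval only, but both sides extend continuously to the end
  points, so the flux form is valid up to the boundary.
\<close>

lemma reg_solution_classical:
  assumes ab: "a < b" and \<epsilon>: "0 < \<epsilon>" and \<gamma>: "0 < \<gamma>\<^sub>1" "0 < \<gamma>\<^sub>2"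
    and d: "smooth_on {a..b} d" "\<And>x. x \<in> {a..b} \<Longrightarrow> 0 < d x" "der_on {a..b} d a = 0" "der_on {a..b} d b = 0"
    and g: "Ck_on 2 {0..} g" "g 0 = 0"
      "\<forall>s\<ge>0. \<gamma>\<^sub>1 \<le> der_on {0..} g s \<and> der_on {0..} g s \<le> \<gamma>\<^sub>2"
    and sol: "reg_solution a b d g \<epsilon> u0 w0 u w" and w0: "continuous_on {a..b} w0"
  obtains ux ut wx wt W0 where
    "taxis_solution a b \<epsilon> \<gamma>\<^sub>1 \<gamma>\<^sub>2 d (der_on {a..b} d) g (der_on {0..} g) u ux ut w wx wt"
    "w12_trace a b w wx W0"
proof -
  obtain d'' where d': "\<And>x. x \<in> {a..b} \<Longrightarrow> (d has_real_derivative der_on {a..b} d x) (at x within {a..b})"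
    and d'': "\<And>x. x \<in> {a..b} \<Longrightarrow> (der_on {a..b} d has_real_derivative d'' x) (at x within {a..b})"
      "continuous_on {a..b} d''" using smooth_on_derivs[OF ab d(1)] by metis
  let ?d' = "der_on {a..b} d" and ?g' = "der_on {0..} g"
  have c_d: "continuous_on {a..b} d" "continuous_on {a..b} ?d'"
    using DERIV_continuous_on[OF d'] DERIV_continuous_on[OF d''(1)] by blast+
  note gf = nutrient_rate_facts[OF g]
  have g_pos: "0 < g s" if "0 < s" for s
    using gf(3)[OF that] \<gamma>(1) that by (meson less_le_trans mult_pos_pos)
  have C21: "C21 a b u" "C21 a b w" using sol by (auto simp: reg_solution_def)
  obtain ux uxx ut where u: "\<And>x t. x \<in> {a..b} \<Longrightarrow> 0 < t \<Longrightarrow> ((\<lambda>y. u y t) has_real_derivative ux x t) (at x within {a..b})"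
      "\<And>x t. x \<in> {a..b} \<Longrightarrow> 0 < t \<Longrightarrow> ((\<lambda>y. ux y t) has_real_derivative uxx x t) (at x within {a..b})"
      "\<And>x t. x \<in> {a..b} \<Longrightarrow> 0 < t \<Longrightarrow> ((\<lambda>s. u x s) has_real_derivative ut x t) (at t)"
    and uc: "continuous_on ({a..b} \<times> {0<..}) (\<lambda>(x, t). u x t)" "continuous_on ({a..b} \<times> {0<..}) (\<lambda>(x, t). ux x t)"
      "continuous_on ({a..b} \<times> {0<..}) (\<lambda>(x, t). uxx x t)" "continuous_on ({a..b} \<times> {0<..}) (\<lambda>(x, t). ut x t)"
    by (rule C21E[OF C21(1)]) (rule that)
  obtain wx wxx wt where w: "\<And>x t. x \<in> {a..b} \<Longrightarrow> 0 < t \<Longrightarrow> ((\<lambda>y. w y t) has_real_derivative wx x t) (at x within {a..b})"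
      "\<And>x t. x \<in> {a..b} \<Longrightarrow> 0 < t \<Longrightarrow> ((\<lambda>y. wx y t) has_real_derivative wxx x t) (at x within {a..b})"
      "\<And>x t. x \<in> {a..b} \<Longrightarrow> 0 < t \<Longrightarrow> ((\<lambda>s. w x s) has_real_derivative wt x t) (at t)"
    and wc: "continuous_on ({a..b} \<times> {0<..}) (\<lambda>(x, t). w x t)" "continuous_on ({a..b} \<times> {0<..}) (\<lambda>(x, t). wx x t)"
      "continuous_on ({a..b} \<times> {0<..}) (\<lambda>(x, t). wxx x t)" "continuous_on ({a..b} \<times> {0<..}) (\<lambda>(x, t). wt x t)"
    by (rule C21E[OF C21(2)]) (rule that)
  have slice: "continuous_on {a..b} (\<lambda>x. f x t)" if "continuous_on ({a..b} \<times> {0<..}) (\<lambda>(x, t). f x t)" "0 < t"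
    for f :: "real \<Rightarrow> real \<Rightarrow> real" and t
    by (rule continuous_on_space_slice[OF that(1)]) (use that(2) in simp)
  note us = uc[THEN slice] and ws = wc[THEN slice]
  have pos: "\<And>x t. x \<in> {a..b} \<Longrightarrow> 0 < t \<Longrightarrow> 0 < u x t" "\<And>x t. x \<in> {a..b} \<Longrightarrow> 0 \<le> t \<Longrightarrow> 0 < w x t"
    and init: "\<And>x. x \<in> {a..b} \<Longrightarrow> w x 0 = w0 x"
    and C0: "C0_W12 a b w" "continuous_on ({a..b} \<times> {0..}) (\<lambda>(x, t). u x t)"
    using sol unfolding reg_solution_def by auto
  have gp: "0 < g (w x t)" if "x \<in> {a..b}" "0 \<le> t" for x t using g_pos pos(2) that by blast
  have nb: "at x within {a..b} \<noteq> bot" if "x \<in> {a..b}" for x by (rule at_within_Icc_nontrivial[OF ab that])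
  have dux: "der_on {a..b} (\<lambda>y. u y t) x = ux x t" and dwx: "der_on {a..b} (\<lambda>y. w y t) x = wx x t"
    if "x \<in> {a..b}" "0 < t" for x t
    using that by (auto intro!: der_onI[OF _ _ refl nb] u w)
  have w0_slice: "continuous_on {a..b} (\<lambda>x. w x 0)" using w0 by (rule continuous_on_eq) (simp add: init)
  obtain W0 where trace: "w12_trace a b w wx W0"
    by (rule w12_trace_exists[OF ab C0(1) w(1) _ w0_slice]) (use ws in auto)
  have w_joint: "continuous_on ({a..b} \<times> {0..}) (\<lambda>(x, t). w x t)"
    by (rule w12_trace.trace_joint_cont[OF trace wc(1)])
  have u_flux: "((\<lambda>y. ?d' y * u y t + d y * ux y t - d y * u y t * wx y t) has_real_derivative ut x t) (at x within {a..b})"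
    if x: "x \<in> {a..b}" and t: "0 < t" for x t
  proof -
    let ?V' = "\<lambda>x. d'' x * u x t + ?d' x * ux x t + (?d' x * ux x t + d x * uxx x t)"
    let ?N' = "\<lambda>x. (?d' x * u x t + d x * ux x t) * wx x t + d x * u x t * wxx x t"
    have V: "((\<lambda>y. ?d' y * u y t + d y * ux y t) has_real_derivative ?V' x) (at x within {a..b})" if x: "x \<in> {a..b}" for x
      by (auto intro!: derivative_eq_intros d' d'' u x t)
    have N: "((\<lambda>y. d y * u y t * wx y t) has_real_derivative ?N' x) (at x within {a..b})" if x: "x \<in> {a..b}" for x
      by (auto intro!: derivative_eq_intros d' d'' u w x t)
    have du: "der_on {a..b} (\<lambda>y. d y * u y t) x = ?d' x * u x t + d x * ux x t" if x: "x \<in> {a..b}" for x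
      by (rule der_onI[OF _ x refl nb[OF x]]) (auto intro!: derivative_eq_intros d' u x t)
    have eq: "?V' x - ?N' x = ut x t" if x: "x \<in> {a<..<b}" for x
    proof -
      have x': "x \<in> {a..b}" using x by simp
      have "deriv (\<lambda>s. u x s) t
          = der_on {a..b} (der_on {a..b} (\<lambda>y. d y * u y t)) x
            - der_on {a..b} (\<lambda>y. d y * u y t * der_on {a..b} (\<lambda>z. w z t) y) x"
        using sol x t unfolding reg_solution_def by blast
      moreover have "deriv (\<lambda>s. u x s) t = ut x t" by (rule DERIV_imp_deriv[OF u(3)[OF x' t]])
      moreover have "der_on {a..b} (der_on {a..b} (\<lambda>y. d y * u y t)) x = ?V' x"
        by (rule der_onI[OF V[OF x'] x' du nb[OF x']])
      moreover have "der_on {a..b} (\<lambda>y. d y * u y t * der_on {a..b} (\<lambda>z. w z t) y) x = ?N' x"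
        by (rule der_onI[OF N[OF x'] x' _ nb[OF x']]) (simp add: dwx t)
      ultimately show ?thesis by simp
    qed
    have "?V' x - ?N' x = ut x t"
      by (rule eq_on_closed_interval[where f = "\<lambda>x. ?V' x - ?N' x" and h = "\<lambda>x. ut x t", OF ab _ _ eq x])
        (intro continuous_intros c_d d'' us ws t)+
    with DERIV_diff[OF V[OF x] N[OF x]] show ?thesis by simp
  qed
  have w_flux: "((\<lambda>y. d y * wx y t / sqrt (g (w y t))) has_real_derivative (wt x t + u x t * g (w x t)) / \<epsilon>) (at x within {a..b})"
    if x: "x \<in> {a..b}" and t: "0 < t" for x t
  proof -
    have t0: "0 \<le> t" using t by simp
    let ?r = "\<lambda>x. sqrt (g (w x t))"
    let ?q' = "\<lambda>x. ((?d' x * wx x t + d x * wxx x t) * ?r x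
        - d x * wx x t * (inverse (?r x) / 2 * (?g' (w x t) * wx x t))) / (?r x * ?r x)"
    have r: "0 < ?r x" if "x \<in> {a..b}" for x using gp[OF that t0] by simp
    have q: "((\<lambda>y. d y * wx y t / ?r y) has_real_derivative ?q' x) (at x within {a..b})" if x: "x \<in> {a..b}" for x
    proof (rule DERIV_divide)
      show "((\<lambda>y. d y * wx y t) has_real_derivative ?d' x * wx x t + d x * wxx x t) (at x within {a..b})"
        by (auto intro!: derivative_eq_intros d' w x t)
      have "((\<lambda>y. g (w y t)) has_real_derivative ?g' (w x t) * wx x t) (at x within {a..b})"
        by (rule DERIV_chain2[OF gf(1) w(1)[OF x t]]) (use pos(2)[OF x t0] in simp)
      then show "(?r has_real_derivative inverse (?r x) / 2 * (?g' (w x t) * wx x t)) (at x within {a..b})"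
        by (rule DERIV_chain2[OF DERIV_real_sqrt, rotated]) (use gp[OF x t0] in simp)
      show "?r x \<noteq> 0" using r[OF x] by simp
    qed
    have cg: "continuous_on {0<..} g"
      by (rule DERIV_continuous_on[of _ _ ?g']) (auto intro: has_field_derivative_at_within gf(1))
    have c: "continuous_on {a..b} (\<lambda>x. g (w x t))" "continuous_on {a..b} (\<lambda>x. ?g' (w x t))"
      by (rule continuous_on_compose2[OF cg ws(1)[OF t]] continuous_on_compose2[OF gf(2) ws(1)[OF t]];
          use pos(2) t0 in auto)+
    have eq: "?q' x = (wt x t + u x t * g (w x t)) / \<epsilon>" if x: "x \<in> {a<..<b}" for x
    proof -
      have x': "x \<in> {a..b}" using x by simp
      have "deriv (\<lambda>s. w x s) t
          = \<epsilon> * der_on {a..b} (\<lambda>y. d y * (der_on {a..b} (\<lambda>z. w z t) y / sqrt (g (w y t)))) x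
            - u x t * g (w x t)"
        using sol x t unfolding reg_solution_def by blast
      moreover have "deriv (\<lambda>s. w x s) t = wt x t" by (rule DERIV_imp_deriv[OF w(3)[OF x' t]])
      moreover have "der_on {a..b} (\<lambda>y. d y * (der_on {a..b} (\<lambda>z. w z t) y / sqrt (g (w y t)))) x = ?q' x"
        by (rule der_onI[OF q[OF x'] x' _ nb[OF x']]) (simp add: dwx t)
      ultimately have "wt x t = \<epsilon> * ?q' x - u x t * g (w x t)" by simp
      then show ?thesis using \<epsilon> by (simp add: eq_divide_eq mult.commute)
    qed
    have "?q' x = (wt x t + u x t * g (w x t)) / \<epsilon>"
      by (rule eq_on_closed_interval[where f = ?q' and h = "\<lambda>x. (wt x t + u x t * g (w x t)) / \<epsilon>", OF ab _ _ eq x])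
        (use r \<epsilon> in \<open>auto intro!: continuous_intros c_d us ws t c simp: less_le\<close>)
    with q[OF x] show ?thesis by simp
  qed
  have "taxis_solution a b \<epsilon> \<gamma>\<^sub>1 \<gamma>\<^sub>2 d ?d' g ?g' u ux ut w wx wt"
  proof
    show "ux a t = 0" "ux b t = 0" "wx a t = 0" "wx b t = 0" if t: "0 < t" for t
      using sol t ab dux[of a t] dux[of b t] dwx[of a t] dwx[of b t] unfolding reg_solution_def by auto
    show "\<gamma>\<^sub>1 \<le> ?g' s" if "0 < s" for s using g(3) that by simp
  qed (fact | assumption | (rule d' d(2) gf u w pos u_flux w_flux; assumption))+
  then show ?thesis using trace by (rule that)
qed

lemma Linf_norm_AE:
  "AE x in lebesgue. x \<in> {a<..<b} \<longrightarrow> ennreal \<bar>f x\<bar> \<le> Linf_norm {a<..<b} f" for a b :: real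
proof -
  have "AE x in restrict_space lebesgue {a<..<b}. ennreal \<bar>f x\<bar> \<le> Linf_norm {a<..<b} f"
    unfolding Linf_norm_def by (rule esssup_AE)
  then show ?thesis by (simp add: AE_lebesgue_on)
qed

lemma weak_deriv_cong:
  assumes "\<And>x. x \<in> S \<Longrightarrow> f x = h x"
  shows "weak_deriv S f = weak_deriv S h"
proof -
  have "has_weak_deriv S h k"
    if w: "has_weak_deriv S f k" and e: "\<And>x. x \<in> S \<Longrightarrow> f x = h x" for f h k :: "real \<Rightarrow> real"
  proof -
    have 1: "set_integrable lebesgue K h" if "compact K" "K \<subseteq> S" for K
    proof -
      have "indicator K x *\<^sub>R f x = indicator K x *\<^sub>R h x" for x
        using e that(2) by (cases "x \<in> K") auto
      moreover have "set_integrable lebesgue K f" using w that by (simp add: has_weak_deriv_def)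
      ultimately show ?thesis unfolding set_integrable_def by (simp only:)
    qed
    have 2: "(LINT x:S|lebesgue. f x * c x) = (LINT x:S|lebesgue. h x * c x)" for c
    proof -
      have "indicator S x *\<^sub>R (f x * c x) = indicator S x *\<^sub>R (h x * c x)" for x
        using e by (cases "x \<in> S") auto
      then show ?thesis unfolding set_lebesgue_integral_def by (simp only:)
    qed
    show ?thesis using w 1 unfolding has_weak_deriv_def 2 by blast
  qed
  from this[of f _ h] this[of h _ f] have "has_weak_deriv S f = has_weak_deriv S h"
    using assms by (intro ext iffI) auto
  then show ?thesis by (simp add: weak_deriv_def)
qed

text \<open>
  The bounds in \<open>approx_diffusion\<close> that are stated through essential suprema hold everywhere,
  because the functions involved are continuous; the same applies to the next lemma.
\<close>

lemma approx_diffusion_uniform: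
  assumes ab: "a < b" and dc: "continuous_on {a..b} d" and ap: "approx_diffusion a b d dE"
    and \<rho>: "0 < \<rho>"
  shows "\<forall>\<^sub>F \<epsilon> in at_right 0. \<forall>x\<in>{a..b}. \<bar>dE \<epsilon> x - d x\<bar> \<le> \<rho>"
proof -
  have "((\<lambda>\<epsilon>. Linf_norm {a<..<b} (\<lambda>x. dE \<epsilon> x - d x)) \<longlongrightarrow> 0) (at_right 0)"
    using ap by (simp add: approx_diffusion_def)
  then have "\<forall>\<^sub>F \<epsilon> in at_right 0. Linf_norm {a<..<b} (\<lambda>x. dE \<epsilon> x - d x) < ennreal \<rho>"
    by (rule order_tendstoD(2)) (use \<rho> in \<open>simp add: ennreal_less_zero_iff\<close>)
  moreover have "\<forall>\<^sub>F \<epsilon> in at_right 0. (\<epsilon>::real) < 1" by (intro order_tendstoD(2)[OF tendsto_ident_at]) auto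
  ultimately show ?thesis using eventually_at_right_less[of "0::real"]
  proof eventually_elim
    case (elim \<epsilon>)
    then have sm: "smooth_on {a..b} (dE \<epsilon>)" using ap unfolding approx_diffusion_def by simp
    have c: "continuous_on {a..b} (dE \<epsilon>)"
      using smooth_on_derivs[OF ab sm] DERIV_continuous_on by metis
    show ?case
    proof
      fix x assume x: "x \<in> {a..b}"
      show "\<bar>dE \<epsilon> x - d x\<bar> \<le> \<rho>"
      proof (rule AE_le_everywhere[OF ab _ _ _ x])
        show "AE x in lebesgue. x \<in> {a<..<b} \<longrightarrow> \<bar>dE \<epsilon> x - d x\<bar> \<le> \<rho>"
          using Linf_norm_AE[of a b "\<lambda>x. dE \<epsilon> x - d x"]
        proof eventually_elim
          case (elim x)
          show ?case
          proof
            assume "x \<in> {a<..<b}"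
            then have "ennreal \<bar>dE \<epsilon> x - d x\<bar> \<le> Linf_norm {a<..<b} (\<lambda>x. dE \<epsilon> x - d x)" using elim by simp
            also have "\<dots> < ennreal \<rho>" by fact
            finally show "\<bar>dE \<epsilon> x - d x\<bar> \<le> \<rho>" using \<rho> by (simp add: ennreal_less_iff)
          qed
        qed
      qed (intro continuous_intros c dc)+
    qed
  qed
qed

lemma approx_diffusion_facts:
  assumes ab: "a < b" and dc: "continuous_on {a..b} d" and ap: "approx_diffusion a b d dE"
    and \<epsilon>: "0 < \<epsilon>" "\<epsilon> < 1"
  shows "smooth_on {a..b} (dE \<epsilon>)" and "continuous_on {a..b} (dE \<epsilon>)"
    and "continuous_on {a..b} (der_on {a..b} (dE \<epsilon>))"
    and "\<And>x. x \<in> {a..b} \<Longrightarrow> 0 < dE \<epsilon> x"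
    and "der_on {a..b} (dE \<epsilon>) a = 0" and "der_on {a..b} (dE \<epsilon>) b = 0"
    and "\<And>x. x \<in> {a..b} \<Longrightarrow> d x \<le> dE \<epsilon> x"
    and "\<And>x. x \<in> {a..b} \<Longrightarrow> \<epsilon> powr (1/4) \<le> dE \<epsilon> x"
    and "\<And>x. x \<in> {a..b} \<Longrightarrow> \<epsilon> powr (1/4) * \<bar>der_on {a..b} (dE \<epsilon>) x\<bar> \<le> dE \<epsilon> x"
    and "\<epsilon> * integral {a..b} (\<lambda>x. der_on {a..b} (dE \<epsilon>) x ^ 4 / (dE \<epsilon> x)\<^sup>2) \<le> 1"
proof -
  let ?d = "dE \<epsilon>" and ?d' = "der_on {a..b} (dE \<epsilon>)" and ?e = "\<epsilon> powr (1/4)"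
  have e0: "0 < ?e" using \<epsilon> by simp
  show sm: "smooth_on {a..b} ?d" using ap \<epsilon> unfolding approx_diffusion_def by simp
  obtain d'' where d': "\<And>x. x \<in> {a..b} \<Longrightarrow> (?d has_real_derivative ?d' x) (at x within {a..b})"
    and d'': "\<And>x. x \<in> {a..b} \<Longrightarrow> (?d' has_real_derivative d'' x) (at x within {a..b})"
    using smooth_on_derivs[OF ab sm] by metis
  show c: "continuous_on {a..b} ?d" and c': "continuous_on {a..b} ?d'"
    using DERIV_continuous_on[OF d'] DERIV_continuous_on[OF d''] by blast+
  have all: "(\<forall>x\<in>{a..b}. ?d x > 0) \<and> (\<forall>x\<in>{a, b}. ?d' x = 0)
      \<and> ennreal (sqrt \<epsilon>) * (\<integral>\<^sup>+x\<in>{a<..<b}. ennreal (?d' x ^ 4 / (?d x)\<^sup>2) \<partial>lebesgue) \<le> 1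
      \<and> ?e * (1 / (INF x\<in>{a<..<b}. ?d x)) \<le> 1
      \<and> ennreal ?e * Linf_norm {a<..<b} (\<lambda>x. ?d' x / ?d x) \<le> 1"
    using ap \<epsilon> unfolding approx_diffusion_def by auto
  show pos: "\<And>x. x \<in> {a..b} \<Longrightarrow> 0 < ?d x" and "?d' a = 0" "?d' b = 0" using all by auto
  show "d x \<le> ?d x" if x: "x \<in> {a..b}" for x
  proof (rule field_le_epsilon)
    fix \<rho> :: real assume \<rho>: "0 < \<rho>"
    have "\<forall>\<^sub>F \<epsilon>' in at_right 0. \<epsilon>' < \<epsilon>" using \<epsilon> by (intro order_tendstoD(2)[OF tendsto_ident_at]) auto
    then have "\<forall>\<^sub>F \<epsilon>' in at_right 0. 0 < \<epsilon>' \<and> \<epsilon>' < \<epsilon> \<and> (\<forall>x\<in>{a..b}. \<bar>dE \<epsilon>' x - d x\<bar> \<le> \<rho>)"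
      using approx_diffusion_uniform[OF ab dc ap \<rho>] eventually_at_right_less[of "0::real"]
      by eventually_elim simp
    then obtain \<epsilon>' where \<epsilon>': "0 < \<epsilon>'" "\<epsilon>' < \<epsilon>" "\<bar>dE \<epsilon>' x - d x\<bar> \<le> \<rho>"
      using eventually_happens[of _ "at_right (0::real)"] x by force
    have "dE \<epsilon>' x \<le> ?d x" using ap \<epsilon> \<epsilon>' x unfolding approx_diffusion_def by (meson less_imp_le)
    then show "d x \<le> ?d x + \<rho>" using \<epsilon>'(3) by linarith
  qed
  show "?e \<le> ?d x" if x: "x \<in> {a..b}" for x
  proof (rule AE_le_everywhere[OF ab _ c _ x])
    obtain x1 where x1: "x1 \<in> {a..b}" "\<And>x. x \<in> {a..b} \<Longrightarrow> ?d x1 \<le> ?d x"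
      using continuous_attains_inf[OF compact_Icc _ c] ab by auto
    have ne: "{a<..<b} \<noteq> {}" using ab by simp
    have inf: "?d x1 \<le> (INF x\<in>{a<..<b}. ?d x)" by (rule cINF_greatest[OF ne]) (use x1 in auto)
    then have "0 < (INF x\<in>{a<..<b}. ?d x)" using pos[OF x1(1)] by linarith
    then have "?e \<le> (INF x\<in>{a<..<b}. ?d x)" using all by (simp add: field_simps)
    moreover have "(INF x\<in>{a<..<b}. ?d x) \<le> ?d x" if "x \<in> {a<..<b}" for x
      by (rule cINF_lower[OF _ that]) (use x1 in \<open>auto intro!: bdd_belowI[of _ "?d x1"]\<close>)
    ultimately show "AE x in lebesgue. x \<in> {a<..<b} \<longrightarrow> ?e \<le> ?d x" by (intro AE_I2) force
  qed simp
  show "?e * \<bar>?d' x\<bar> \<le> ?d x" if x: "x \<in> {a..b}" for x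
  proof (rule AE_le_everywhere[OF ab _ c _ x])
    show "AE x in lebesgue. x \<in> {a<..<b} \<longrightarrow> ?e * \<bar>?d' x\<bar> \<le> ?d x"
      using Linf_norm_AE[of a b "\<lambda>x. ?d' x / ?d x"]
    proof eventually_elim
      case (elim x)
      show ?case
      proof
        assume x: "x \<in> {a<..<b}"
        have "ennreal (?e * \<bar>?d' x / ?d x\<bar>) = ennreal ?e * ennreal \<bar>?d' x / ?d x\<bar>"
          by (rule ennreal_mult) (use e0 in auto)
        also have "\<dots> \<le> ennreal ?e * Linf_norm {a<..<b} (\<lambda>x. ?d' x / ?d x)"
          using elim x by (intro mult_left_mono) auto
        also have "\<dots> \<le> 1" using all by blast
        finally have "?e * \<bar>?d' x / ?d x\<bar> \<le> 1" by simp
        then show "?e * \<bar>?d' x\<bar> \<le> ?d x" using pos[of x] x by (simp add: field_simps)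
      qed
    qed
  qed (intro continuous_intros c')
  let ?I = "integral {a..b} (\<lambda>x. ?d' x ^ 4 / (?d x)\<^sup>2)"
  have cI: "continuous_on {a..b} (\<lambda>x. ?d' x ^ 4 / (?d x)\<^sup>2)"
    using pos by (intro continuous_intros c c') (auto simp: less_le)
  have I0: "0 \<le> ?I" by (rule integral_nonneg_cont[OF cI]) simp
  have "ennreal (sqrt \<epsilon> * ?I) = ennreal (sqrt \<epsilon>) * (\<integral>\<^sup>+x\<in>{a<..<b}. ennreal (?d' x ^ 4 / (?d x)\<^sup>2) \<partial>lebesgue)"
    using \<epsilon> I0 by (subst nn_integral_interval[OF cI]) (auto simp: ennreal_mult)
  also have "\<dots> \<le> 1" using all by blast
  finally have 1: "sqrt \<epsilon> * ?I \<le> 1" by simp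
  have "\<epsilon> \<le> sqrt \<epsilon>" using \<epsilon> by (simp add: real_le_rsqrt power2_eq_square mult_left_le_one_le)
  then have "\<epsilon> * ?I \<le> sqrt \<epsilon> * ?I" using I0 by (rule mult_right_mono)
  then show "\<epsilon> * ?I \<le> 1" using 1 by linarith
qed

lemma AE_pos_of_integral_inverse:
  fixes d :: "real \<Rightarrow> real"
  assumes ab: "a < b" and dc: "continuous_on {a..b} d" and d0: "\<forall>x\<in>{a..b}. d x \<ge> 0"
    and int: "(\<integral>\<^sup>+x\<in>{a<..<b}. 1 / ennreal (d x) \<partial>lebesgue) < \<infinity>"
  shows "AE x in lebesgue. x \<in> {a<..<b} \<longrightarrow> 0 < d x"
proof -
  have m[measurable]: "d \<in> borel_measurable (lebesgue_on {a<..<b})" by (rule continuous_measurable_interval[OF dc])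
  have "(\<integral>\<^sup>+x. 1 / ennreal (d x) \<partial>lebesgue_on {a<..<b}) \<noteq> \<infinity>"
    using int by (simp add: nn_integral_lebesgue_on)
  then have "AE x in lebesgue_on {a<..<b}. 1 / ennreal (d x) \<noteq> \<infinity>"
    by (intro nn_integral_PInf_AE) measurable
  then have "AE x in lebesgue. x \<in> {a<..<b} \<longrightarrow> 1 / ennreal (d x) \<noteq> \<infinity>" by (simp only: AE_lebesgue_on)
  then show ?thesis
  proof eventually_elim
    case (elim x)
    show ?case
    proof
      assume x: "x \<in> {a<..<b}"
      have "d x \<noteq> 0" using elim x by (auto simp: ennreal_divide_zero)
      then show "0 < d x" using d0 x by (simp add: less_le)
    qed
  qed
qed

text \<open>
  The approximate initial data inherit the bound \<open>w\<^sub>0 \<le> K d\<close>, since they increase to \<open>w\<^sub>0\<close> and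
  the coefficients decrease to \<open>d\<close>; the shift by \<open>\<epsilon>\<^sup>1\<^sup>/\<^sup>4\<close> is absorbed by the
  lower bound of the coefficients.
\<close>

lemma approx_initial_ratio:
  assumes ab: "a < b" and dc: "continuous_on {a..b} d" and d0: "\<forall>x\<in>{a..b}. d x \<ge> 0"
    and int: "(\<integral>\<^sup>+x\<in>{a<..<b}. 1 / ennreal (d x) \<partial>lebesgue) < \<infinity>"
    and quot: "Linf_on {a<..<b} (\<lambda>x. w0 x / d x)"
    and ap: "approx_diffusion a b d dE" "approx_w0 a b d w0 w0J" "approx_eps a b dE w0J eps"
  obtains M where "0 \<le> M" "\<And>j x. x \<in> {a..b} \<Longrightarrow> w0_reg w0J eps j x \<le> M * dE (eps j) x"
proof -
  have dpos: "AE x in lebesgue. x \<in> {a<..<b} \<longrightarrow> 0 < d x"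
    by (rule AE_pos_of_integral_inverse[OF ab dc d0 int])
  obtain K where K: "Linf_norm {a<..<b} (\<lambda>x. w0 x / d x) = ennreal K" "0 \<le> K"
    using quot unfolding Linf_on_def by (cases "Linf_norm {a<..<b} (\<lambda>x. w0 x / d x)") auto
  have ae: "AE x in lebesgue. x \<in> {a<..<b} \<longrightarrow> w0 x \<le> K * d x"
    using Linf_norm_AE[of a b "\<lambda>x. w0 x / d x"] dpos
  proof eventually_elim
    case (elim x)
    show ?case
    proof
      assume x: "x \<in> {a<..<b}"
      then have "\<bar>w0 x / d x\<bar> \<le> K" using elim(1) K by simp
      then have "w0 x / d x \<le> K" by linarith
      then show "w0 x \<le> K * d x" using elim(2) x by (simp add: field_simps)
    qed
  qed
  show ?thesis
  proof (rule that[of "K + 1"])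
    show "0 \<le> K + 1" using K by simp
    fix j x assume x: "x \<in> {a..b}"
    have ej: "0 < eps j" "eps j < 1" using ap(3) by (auto simp: approx_eps_def)
    note f = approx_diffusion_facts[OF ab dc ap(1) ej]
    have "w0J j x \<le> K * dE (eps j) x"
    proof (rule AE_le_everywhere[OF ab _ _ _ x])
      show "continuous_on {a..b} (w0J j)" using ap(2) by (simp add: approx_w0_def)
      show "continuous_on {a..b} (\<lambda>x. K * dE (eps j) x)" by (intro continuous_intros f(2))
      show "AE x in lebesgue. x \<in> {a<..<b} \<longrightarrow> w0J j x \<le> K * dE (eps j) x"
        using ae
      proof eventually_elim
        case (elim y)
        show ?case
        proof
          assume y: "y \<in> {a<..<b}"
          then have "incseq (\<lambda>j. w0J j y)" "(\<lambda>j. w0J j y) \<longlonglongrightarrow> w0 y"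
            using ap(2) by (auto simp: approx_w0_def)
          then have "w0J j y \<le> w0 y" by (rule incseq_le)
          also have "\<dots> \<le> K * d y" using elim y by simp
          also have "\<dots> \<le> K * dE (eps j) y" using f(7)[of y] y K by (intro mult_left_mono) auto
          finally show "w0J j y \<le> K * dE (eps j) y" .
        qed
      qed
    qed
    then show "w0_reg w0J eps j x \<le> (K + 1) * dE (eps j) x"
      using f(8)[OF x] by (simp add: w0_reg_def algebra_simps)
  qed
qed

lemma inverse_integral_bound:
  fixes a b :: real
  assumes ab: "a < b" and int: "(\<integral>\<^sup>+x\<in>{a<..<b}. 1 / ennreal (d x) \<partial>lebesgue) < \<infinity>"
  obtains L where "0 \<le> L" "\<forall>f. continuous_on {a..b} f \<and> (\<forall>x\<in>{a..b}. 0 < f x \<and> d x \<le> f x)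
    \<longrightarrow> integral {a..b} (\<lambda>x. 1 / f x) \<le> L"
proof -
  obtain L where L: "(\<integral>\<^sup>+x\<in>{a<..<b}. 1 / ennreal (d x) \<partial>lebesgue) = ennreal L" "0 \<le> L"
    using int by (cases "\<integral>\<^sup>+x\<in>{a<..<b}. 1 / ennreal (d x) \<partial>lebesgue") auto
  show ?thesis
  proof (rule that[OF L(2)], intro allI impI)
    fix f :: "real \<Rightarrow> real"
    assume "continuous_on {a..b} f \<and> (\<forall>x\<in>{a..b}. 0 < f x \<and> d x \<le> f x)"
    then have f: "continuous_on {a..b} f" "\<And>x. x \<in> {a..b} \<Longrightarrow> 0 < f x \<and> d x \<le> f x" by auto
    have c: "continuous_on {a..b} (\<lambda>x. 1 / f x)"
      using f by (intro continuous_intros) (auto simp: less_le)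
    have "ennreal (integral {a..b} (\<lambda>x. 1 / f x)) = (\<integral>\<^sup>+x\<in>{a<..<b}. ennreal (1 / f x) \<partial>lebesgue)"
      by (rule nn_integral_interval[OF c, symmetric]) (use f(2) in \<open>simp add: less_imp_le\<close>)
    also have "\<dots> \<le> (\<integral>\<^sup>+x\<in>{a<..<b}. 1 / ennreal (d x) \<partial>lebesgue)"
    proof (rule nn_integral_mono)
      fix x
      show "ennreal (1 / f x) * indicator {a<..<b} x \<le> 1 / ennreal (d x) * indicator {a<..<b} x"
      proof (cases "x \<in> {a<..<b}")
        case True
        then have fx: "0 < f x" "d x \<le> f x" using f(2)[of x] by auto
        have "ennreal (1 / f x) \<le> 1 / ennreal (d x)"
        proof (cases "0 < d x")
          case True
          then have "1 / ennreal (d x) = ennreal (1 / d x)" by (simp add: divide_ennreal flip: ennreal_1)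
          moreover have "1 / f x \<le> 1 / d x" using fx True by (intro divide_left_mono) auto
          ultimately show ?thesis by (simp add: ennreal_leI)
        next
          case False
          then show ?thesis by (simp add: ennreal_neg ennreal_divide_zero)
        qed
        then show ?thesis using True by simp
      qed simp
    qed
    also have "\<dots> = ennreal L" by (rule L(1))
    finally show "integral {a..b} (\<lambda>x. 1 / f x) \<le> L" using L(2) by (simp add: ennreal_le_iff)
  qed
qed

lemma SUP_real_bound:
  fixes F :: "nat \<Rightarrow> ennreal"
  assumes "(SUP j. F j) < \<infinity>"
  obtains G where "0 \<le> G" "\<And>j. F j \<le> ennreal G"
proof -
  define S where "S = (SUP j. F j)"
  have "F j \<le> S" for j unfolding S_def by (rule SUP_upper) simp
  moreover have "S < \<infinity>" using assms by (simp add: S_def)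
  then obtain G where "S = ennreal G" "0 \<le> G" by (cases S) auto
  ultimately show ?thesis by (intro that[of G]) auto
qed

text \<open>
  The bound of \<open>log_cube_estimate\<close> with one constant for all but finitely many members of the
  subsequence. The quantities that it depends on are bounded uniformly by the data, except for the
  upper bound of \<open>w\<^sub>\<epsilon>\<close>, which is read off from the uniform convergence.
\<close>

lemma regularized_estimate:
  assumes ab: "a < b" and dc: "continuous_on {a..b} d" and d0: "\<forall>x\<in>{a..b}. d x \<ge> 0"
    and int: "(\<integral>\<^sup>+x\<in>{a<..<b}. 1 / ennreal (d x) \<partial>lebesgue) < \<infinity>"
    and g: "Ck_on 2 {0..} g" "g 0 = 0" and \<gamma>: "\<gamma>\<^sub>1 > 0" "\<gamma>\<^sub>2 > 0"
    and g': "\<forall>s\<ge>0. \<gamma>\<^sub>1 \<le> der_on {0..} g s \<and> der_on {0..} g s \<le> \<gamma>\<^sub>2"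
    and u0: "continuous_on {a..b} u0" "\<forall>x\<in>{a..b}. u0 x \<ge> 0" "\<exists>x\<in>{a..b}. u0 x \<noteq> 0"
    and quot: "Linf_on {a<..<b} (\<lambda>x. w0 x / d x)"
    and ap: "approx_diffusion a b d dE" "approx_w0 a b d w0 w0J" "approx_eps a b dE w0J eps"
    and sol: "\<forall>j. reg_solution a b (dE (eps j)) g (eps j) u0 (w0_reg w0J eps j) (uE j) (wE j)"
    and r: "strict_mono r"
    and w: "continuous_on ({a..b} \<times> {0..}) (\<lambda>(x, t). w x t)"
    and conv: "\<forall>T>0. uniform_limit ({a..b} \<times> {0..T}) (\<lambda>k (x, t). wE (r k) x t) (\<lambda>(x, t). w x t) sequentially"
    and \<tau>: "0 < \<tau>" "\<tau> < T"
  obtains B where "\<forall>\<^sub>F k in sequentially. \<exists>N. continuous_on {\<tau>..T} N \<and> integral {\<tau>..T} N \<le> B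
    \<and> (\<forall>x\<in>{a..b}. \<forall>t\<in>{\<tau>..T}. \<bar>ln (dE (eps (r k)) x * uE (r k) x t)\<bar> ^ 3 \<le> N t)"
proof -
  have ej: "0 < eps j" "eps j < 1" for j using ap(3) by (auto simp: approx_eps_def)
  note f = approx_diffusion_facts[OF ab dc ap(1) ej]
  obtain M where M: "0 \<le> M" "\<And>j x. x \<in> {a..b} \<Longrightarrow> w0_reg w0J eps j x \<le> M * dE (eps j) x"
    by (rule approx_initial_ratio[OF ab dc d0 int quot ap]) (rule that)
  obtain L where L: "0 \<le> L" "\<forall>f. continuous_on {a..b} f \<and> (\<forall>x\<in>{a..b}. 0 < f x \<and> d x \<le> f x)
    \<longrightarrow> integral {a..b} (\<lambda>x. 1 / f x) \<le> L"
    by (rule inverse_integral_bound[OF ab int]) (rule that)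
  obtain D where D: "\<And>j x. x \<in> {a..b} \<Longrightarrow> dE (eps j) x \<le> D"
  proof -
    obtain x1 where x1: "x1 \<in> {a..b}" "\<And>x. x \<in> {a..b} \<Longrightarrow> dE (eps 0) x \<le> dE (eps 0) x1"
      using continuous_attains_sup[OF compact_Icc _ f(2)[of 0]] ab by auto
    show ?thesis
    proof (rule that)
      fix j x assume x: "x \<in> {a..b}"
      have "eps j \<le> eps 0" using ap(3) by (auto simp: approx_eps_def decseq_def)
      then have "dE (eps j) x \<le> dE (eps 0) x"
        using ap(1) ej[of j] ej[of 0] x unfolding approx_diffusion_def by blast
      then show "dE (eps j) x \<le> dE (eps 0) x1" using x1(2)[OF x] by linarith
    qed
  qed
  obtain U where U: "\<And>x. x \<in> {a..b} \<Longrightarrow> u0 x \<le> U"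
  proof -
    have "{a..b} \<noteq> {}" using ab by simp
    from continuous_attains_sup[OF compact_Icc this u0(1)] obtain x1 where "\<forall>x\<in>{a..b}. u0 x \<le> u0 x1"
      by blast
    then show ?thesis by (intro that[of "u0 x1"]) blast
  qed
  define m where "m = integral {a..b} u0"
  have m: "0 < m"
  proof -
    have "0 \<le> m" unfolding m_def using u0 by (intro integral_nonneg_cont) auto
    moreover have "m \<noteq> 0" unfolding m_def using integral_eq_0_iff[OF u0(1) ab] u0 by auto
    ultimately show ?thesis by simp
  qed
  have w0c: "continuous_on {a..b} (w0_reg w0J eps j)" for j
    unfolding w0_reg_def using ap(2) by (intro continuous_intros) (simp add: approx_w0_def)
  have w0_ge: "eps j powr (1/4) \<le> w0_reg w0J eps j x" if "x \<in> {a..b}" for j x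
    using ap(2) that by (simp add: approx_w0_def w0_reg_def)
  obtain G1 where G1: "0 \<le> G1" "\<And>j. (\<integral>\<^sup>+x\<in>{a<..<b}.
        ennreal (dE (eps j) x * grad_sq_over {a<..<b} (w0_reg w0J eps j) x) \<partial>lebesgue) \<le> ennreal G1"
  proof -
    have "(SUP j. \<integral>\<^sup>+x\<in>{a<..<b}. ennreal (dE (eps j) x * grad_sq_over {a<..<b} (w0_reg w0J eps j) x) \<partial>lebesgue) < \<infinity>"
      using ap(3) unfolding approx_eps_def by blast
    then show ?thesis by (rule SUP_real_bound) (rule that)
  qed
  obtain G2 where G2: "0 \<le> G2" "\<And>j. (\<integral>\<^sup>+x\<in>{a<..<b}.
        ennreal ((der_on {a..b} (dE (eps j)) x)\<^sup>2 / dE (eps j) x * w0_reg w0J eps j x) \<partial>lebesgue) \<le> ennreal G2"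
  proof -
    have "(SUP j. \<integral>\<^sup>+x\<in>{a<..<b}. ennreal ((der_on {a..b} (dE (eps j)) x)\<^sup>2 / dE (eps j) x * w0_reg w0J eps j x) \<partial>lebesgue) < \<infinity>"
      using ap(3) unfolding approx_eps_def by blast
    then show ?thesis by (rule SUP_real_bound) (rule that)
  qed
  obtain W where W: "\<forall>\<^sub>F k in sequentially. \<forall>x\<in>{a..b}. \<forall>t\<in>{0..T}. wE (r k) x t \<le> W"
  proof -
    have T: "0 < T" using \<tau> by simp
    have cw: "continuous_on ({a..b} \<times> {0..T}) (\<lambda>(x, t). w x t)" by (rule continuous_on_subset[OF w]) auto
    have "bounded ((\<lambda>(x, t). w x t) ` ({a..b} \<times> {0..T}))"
      by (intro compact_imp_bounded compact_continuous_image[OF cw] compact_Times compact_Icc)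
    then obtain C where C: "\<And>x t. x \<in> {a..b} \<Longrightarrow> t \<in> {0..T} \<Longrightarrow> \<bar>w x t\<bar> \<le> C"
      unfolding bounded_iff by force
    have "\<forall>\<^sub>F k in sequentially. \<forall>z\<in>{a..b} \<times> {0..T}. dist (case z of (x, t) \<Rightarrow> wE (r k) x t) (case z of (x, t) \<Rightarrow> w x t) < 1"
      using conv T by (intro uniform_limitD) auto
    then show ?thesis
    proof (intro that[of "C + 1"], eventually_elim)
      case (elim k)
      show ?case
      proof (intro ballI)
        fix x t assume xt: "x \<in> {a..b}" "t \<in> {0..T}"
        then have "\<bar>wE (r k) x t - w x t\<bar> < 1" using elim by (auto simp: dist_real_def)
        then show "wE (r k) x t \<le> C + 1" using C[OF xt] by linarith
      qed
    qed
  qed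
  define H where "H = (D * U\<^sup>2 * (b - a) + 1) + (2 * G1 + 1) / (2 * \<gamma>\<^sub>1) + (G2 + 1) / \<gamma>\<^sub>1"
  have "(\<lambda>k. eps (r k)) \<longlonglongrightarrow> 0"
    using LIMSEQ_subseq_LIMSEQ[of eps 0 r] ap(3) r by (simp add: approx_eps_def o_def)
  then have small: "\<forall>\<^sub>F k in sequentially. eps (r k) < 1 / 4" by (rule order_tendstoD(2)) simp
  have "\<forall>\<^sub>F k in sequentially. \<exists>N. continuous_on {\<tau>..T} N
      \<and> integral {\<tau>..T} N \<le> taxis_solution.log_cube_bound a b \<gamma>\<^sub>1 \<gamma>\<^sub>2 \<tau> T D W M H L m
    \<and> (\<forall>x\<in>{a..b}. \<forall>t\<in>{\<tau>..T}. \<bar>ln (dE (eps (r k)) x * uE (r k) x t)\<bar> ^ 3 \<le> N t)"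
    using W small
  proof eventually_elim
    case (elim k)
    define j where "j = r k"
    define e where "e = eps j powr (1/4)"
    have e: "0 < e" "eps j = e ^ 4" "2 * e\<^sup>2 \<le> 1"
    proof -
      show "0 < e" using ej[of j] by (simp add: e_def)
      show "eps j = e ^ 4" using ej[of j] by (simp add: e_def powr_power)
      have "e\<^sup>2 = eps j powr (1/2)" using ej[of j] by (simp add: e_def powr_power)
      also have "\<dots> = sqrt (eps j)" using ej[of j] by (simp add: powr_half_sqrt)
      also have "\<dots> \<le> sqrt (1 / 4)" using elim(2) by (intro real_sqrt_le_mono) (simp add: j_def)
      also have "\<dots> = 1 / 2" by (simp add: real_sqrt_divide)
      finally show "2 * e\<^sup>2 \<le> 1" by simp
    qed
    note sol_j = sol[rule_format, of j]
    obtain ux ut wx wt W0 where ts: "taxis_solution a b (eps j) \<gamma>\<^sub>1 \<gamma>\<^sub>2 (dE (eps j)) (der_on {a..b} (dE (eps j))) g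
        (der_on {0..} g) (uE j) ux ut (wE j) wx wt"
      and tr: "w12_trace a b (wE j) wx W0"
      by (rule reg_solution_classical[OF ab ej(1) \<gamma> f(1) f(4) f(5,6) g g' sol_j w0c]) (assumption | rule that)+
    interpret taxis_solution a b "eps j" \<gamma>\<^sub>1 \<gamma>\<^sub>2 "dE (eps j)" "der_on {a..b} (dE (eps j))" g
        "der_on {0..} g" "uE j" ux ut "wE j" wx wt by (rule ts)
    have init: "uE j x 0 = u0 x" "wE j x 0 = w0_reg w0J eps j x" if "x \<in> {a..b}" for x
      using sol_j that by (auto simp: reg_solution_def)
    have g1: "\<forall>\<^sub>F t in at_right 0. integral {a..b} (\<lambda>x. dE (eps j) x * (wx x t)\<^sup>2 / wE j x t) \<le> 2 * G1 + 1"
    proof (rule w12_trace.initial_gradient_energy[OF tr, where \<mu> = "e / 2"])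
      show "2 * (e / 2) \<le> wE j x 0" if "x \<in> {a..b}" for x
        using w0_ge[OF that, of j] init(2)[OF that] by (simp add: e_def)
      show "continuous_on ({a..b} \<times> {0<..}) (\<lambda>(x, t). wE j x t)"
        by (rule continuous_on_subset[OF w_cont]) auto
      have "weak_deriv {a<..<b} (\<lambda>x. sqrt (wE j x 0)) = weak_deriv {a<..<b} (\<lambda>x. sqrt (w0_reg w0J eps j x))"
        by (rule weak_deriv_cong) (simp add: init)
      then show "(\<integral>\<^sup>+x\<in>{a<..<b}. ennreal (dE (eps j) x * grad_sq_over {a<..<b} (\<lambda>x. wE j x 0) x) \<partial>lebesgue) \<le> ennreal G1"
        using G1(2)[of j] by (simp add: grad_sq_over_def)
    qed (use e w_pos d_cont d_pos G1(1) in \<open>auto simp: less_imp_le\<close>)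
    have g2: "integral {a..b} (\<lambda>x. (der_on {a..b} (dE (eps j)) x)\<^sup>2 / dE (eps j) x * wE j x 0) \<le> G2"
    proof -
      let ?h = "\<lambda>x. (der_on {a..b} (dE (eps j)) x)\<^sup>2 / dE (eps j) x * w0_reg w0J eps j x"
      have "continuous_on {a..b} ?h" by (auto intro!: continuous_intros d_cont dx_cont w0c simp: nonzero)
      moreover have "0 \<le> ?h x" if "x \<in> {a..b}" for x
        using w_pos[OF that, of 0] init(2)[OF that] d_pos[OF that]
        by (intro mult_nonneg_nonneg) (auto simp: less_imp_le)
      ultimately have "ennreal (integral {a..b} ?h) = (\<integral>\<^sup>+x\<in>{a<..<b}. ennreal (?h x) \<partial>lebesgue)"
        by (rule nn_integral_interval[symmetric])
      also have "\<dots> \<le> ennreal G2" by (rule G2(2))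
      finally have "integral {a..b} ?h \<le> G2" using G2(1) by (simp add: ennreal_le_iff)
      moreover have "integral {a..b} (\<lambda>x. (der_on {a..b} (dE (eps j)) x)\<^sup>2 / dE (eps j) x * wE j x 0) = integral {a..b} ?h"
        by (rule integral_cong) (simp add: init)
      ultimately show ?thesis by simp
    qed
    have mass: "integral {a..b} (\<lambda>x. uE j x 0) = m"
      unfolding m_def by (rule integral_cong) (simp add: init)
    have H: "\<forall>\<^sub>F s in at_right 0. energy s \<le> H"
      unfolding H_def by (rule initial_energy_le[OF D _ _ g1 g2]) (use init u0 U in auto)
    have "\<exists>N. continuous_on {\<tau>..T} N \<and> integral {\<tau>..T} N \<le> log_cube_bound \<tau> T D W M H L m
      \<and> (\<forall>x\<in>{a..b}. \<forall>t\<in>{\<tau>..T}. \<bar>ln (dE (eps j) x * uE j x t)\<bar> ^ 3 \<le> N t)"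
    proof (rule log_cube_estimate[OF \<tau> e D _ _ f(10) _ _ H _ mass m])
      show "e \<le> dE (eps j) x" "e * \<bar>der_on {a..b} (dE (eps j)) x\<bar> \<le> dE (eps j) x" if "x \<in> {a..b}" for x
        using f(8)[OF that, of j] f(9)[OF that, of j] by (simp_all add: e_def)
      show "wE j x t \<le> W" if "x \<in> {a..b}" "0 < t" "t \<le> T" for x t
        using elim(1) that by (simp add: j_def)
      show "wE j x 0 \<le> M * dE (eps j) x" if "x \<in> {a..b}" for x using M(2)[OF that, of j] init(2)[OF that] by simp
      show "integral {a..b} (\<lambda>x. 1 / dE (eps j) x) \<le> L" by (rule L(2)[rule_format]) (use d_cont d_pos f(7) in blast)
    qed
    then show ?case by (simp add: j_def)
  qed
  then show ?thesis by (rule that)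
qed

section \<open>Passage to the limit\<close>

text \<open>
  Fubini's theorem for null sets with the time variable outside. Replacing the Lebesgue null set by a
  Borel one makes it measurable for the product measure.
\<close>

lemma AE_lebesgue_sections:
  assumes "AE z in lebesgue. P (z :: real \<times> real)"
  shows "AE t in lebesgue. AE x in lebesgue. P (x, t)"
proof -
  have "AE z in lborel \<Otimes>\<^sub>M lborel. P z"
    using assms unfolding lborel_prod by (simp add: AE_completion_iff)
  then have "AE z in distr (lborel \<Otimes>\<^sub>M lborel) (lborel \<Otimes>\<^sub>M lborel) (\<lambda>(x, y). (y, x)). P z"
    by (subst (asm) lborel_pair.distr_pair_swap)
  then have "AE z in lborel \<Otimes>\<^sub>M lborel. P (case z of (x, y) \<Rightarrow> (y, x))"
    by (rule AE_distrD[rotated]) (rule measurable_pair_swap')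
  then have "AE t in lborel. AE x in lborel. P (x, t)"
    using lborel_pair.AE_pair by fastforce
  then have "AE t in lborel. AE x in lebesgue. P (x, t)"
    by eventually_elim (rule AE_completion)
  then show ?thesis by (rule AE_completion)
qed

text \<open>
  Lebesgue measure is complete, so changing a function on a null set preserves measurability.
\<close>

lemma measurable_lebesgue_AE_cong:
  fixes f h :: "real \<Rightarrow> ennreal"
  assumes h: "h \<in> borel_measurable lebesgue" and eq: "AE x in lebesgue. f x = h x"
  shows "f \<in> borel_measurable lebesgue"
proof -
  obtain N where N: "N \<in> null_sets lebesgue" "{x. f x \<noteq> h x} \<subseteq> N"
    by (rule AE_E3[OF eq]) (rule that, assumption, auto)
  show ?thesis
  proof (rule measurableI)
    fix A :: "ennreal set" assume A: "A \<in> sets borel"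
    have "f -` A \<inter> space lebesgue = (h -` A \<inter> space lebesgue - N) \<union> (f -` A \<inter> N)"
      using N(2) by auto
    moreover have "h -` A \<inter> space lebesgue \<in> sets lebesgue" by (rule measurable_sets[OF h A])
    moreover have "f -` A \<inter> N \<in> sets lebesgue"
      by (rule null_setsD2[OF null_sets_completion_subset[OF _ N(1)]]) auto
    moreover have "N \<in> sets lebesgue" using N(1) by blast
    ultimately show "f -` A \<inter> space lebesgue \<in> sets lebesgue"
      by (metis sets.Diff sets.Un)
  qed simp
qed

text \<open>
  The essential supremum of a section is at most \<open>c\<close> iff the section of the superlevel set of
  \<open>c\<close> is a null set, and the measures of sections depend measurably on the parameter.
\<close>

lemma esssup_section_measurable:
  fixes G :: "real \<times> real \<Rightarrow> ennreal"
  assumes G: "G \<in> borel_measurable borel"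
  shows "(\<lambda>t. esssup (lebesgue_on {a<..<b}) (\<lambda>x. G (x, t))) \<in> borel_measurable borel"
proof (rule borel_measurableI_le)
  fix c :: ennreal
  define Q where "Q = {z. fst z \<in> {a<..<b} \<and> c < G z}"
  have sl: "(\<lambda>x. G (x, t)) \<in> borel_measurable borel" for t
    by (rule measurable_compose[OF _ G]) (intro borel_measurable_continuous_onI continuous_intros)
  have slm: "(\<lambda>x. G (x, t)) \<in> borel_measurable (lebesgue_on {a<..<b})" for t
    by (intro measurable_restrict_space1 measurable_completion) (simp add: sl)
  have Qs: "Q \<in> sets borel"
  proof -
    have "Q = (fst -` {a<..<b}) \<inter> {z \<in> space borel. c < G z}" by (auto simp: Q_def)
    moreover have "open (fst -` {a<..<b} :: (real \<times> real) set)" by (intro open_vimage_fst) simp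
    moreover have "{z \<in> space borel. c < G z} \<in> sets borel" using G by measurable
    ultimately show ?thesis by (simp add: sets.Int)
  qed
  have "(\<lambda>t. emeasure lborel ((\<lambda>x. (x, t)) -` Q)) \<in> borel_measurable lborel"
    by (rule lborel_pair.measurable_emeasure_Pair2) (use Qs in \<open>simp only: lborel_prod sets_lborel\<close>)
  then have m: "{t \<in> space borel. emeasure lborel ((\<lambda>x. (x, t)) -` Q) = 0} \<in> sets borel" by measurable
  have "esssup (lebesgue_on {a<..<b}) (\<lambda>x. G (x, t)) \<le> c \<longleftrightarrow> emeasure lborel ((\<lambda>x. (x, t)) -` Q) = 0" for t
  proof -
    have "esssup (lebesgue_on {a<..<b}) (\<lambda>x. G (x, t)) \<le> c \<longleftrightarrow> (AE x in lebesgue_on {a<..<b}. G (x, t) \<le> c)"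
    proof
      assume le: "esssup (lebesgue_on {a<..<b}) (\<lambda>x. G (x, t)) \<le> c"
      show "AE x in lebesgue_on {a<..<b}. G (x, t) \<le> c"
        using esssup_AE[of "\<lambda>x. G (x, t)" "lebesgue_on {a<..<b}"] by eventually_elim (use le in auto)
    qed (rule esssup_I[OF slm])
    also have "\<dots> \<longleftrightarrow> (AE x in lborel. x \<notin> (\<lambda>x. (x, t)) -` Q)"
      unfolding AE_lebesgue_on by (auto simp: AE_completion_iff Q_def not_less)
    also have "\<dots> \<longleftrightarrow> emeasure lborel ((\<lambda>x. (x, t)) -` Q) = 0"
    proof -
      have "(\<lambda>x. (x, t)) -` Q \<in> sets lborel"
      proof -
        have "continuous_on UNIV (\<lambda>x. (x, t))" by (intro continuous_intros)
        from measurable_sets[OF borel_measurable_continuous_onI[OF this] Qs] show ?thesis by simp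
      qed
      then show ?thesis by (subst AE_iff_measurable) auto
    qed
    finally show ?thesis .
  qed
  then show "{t \<in> space borel. esssup (lebesgue_on {a<..<b}) (\<lambda>x. G (x, t)) \<le> c} \<in> sets borel"
    using m by simp
qed

lemma abs_ln_measurable [measurable]: "abs_ln \<in> borel_measurable borel"
  unfolding abs_ln_def[abs_def] by measurable

text \<open>The convention \<open>\<bar>ln 0\<bar> = \<infinity>\<close> makes the logarithm continuous on \<open>[0, \<infinity>)\<close>.\<close>

lemma abs_ln_tendsto:
  assumes v: "v \<longlonglongrightarrow> l" and pos: "\<And>k. 0 < v k"
  shows "(\<lambda>k. abs_ln (v k)) \<longlonglongrightarrow> abs_ln l"
proof (cases "l = 0")
  case True
  have "filterlim v (at_right 0) sequentially"
    using v pos less_imp_neq[OF pos, symmetric] by (simp add: True filterlim_at)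
  then have "filterlim (\<lambda>k. ln (v k)) at_bot sequentially" by (rule filterlim_compose[OF ln_at_0])
  then have "filterlim (\<lambda>k. - ln (v k)) at_top sequentially" by (simp add: filterlim_uminus_at_top)
  then have "filterlim (\<lambda>k. \<bar>ln (v k)\<bar>) at_top sequentially"
    by (rule filterlim_at_top_mono) (intro always_eventually allI abs_ge_minus_self)
  then have "(\<lambda>k. ennreal \<bar>ln (v k)\<bar>) \<longlonglongrightarrow> \<infinity>" by (simp add: ennreal_tendsto_top_eq_at_top)
  then show ?thesis using pos True by (simp add: abs_ln_def)
next
  case False
  have "0 \<le> l" by (rule LIMSEQ_le_const[OF v]) (use pos less_imp_le in blast)
  then have l: "0 < l" using False by simp
  have "(\<lambda>k. ennreal \<bar>ln (v k)\<bar>) \<longlonglongrightarrow> ennreal \<bar>ln l\<bar>"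
    by (intro tendsto_ennrealI tendsto_rabs tendsto_ln v) (use l in simp)
  then show ?thesis using pos l by (simp add: abs_ln_def)
qed

lemma abs_ln_le_iff:
  assumes "0 \<le> c"
  shows "abs_ln s \<le> ennreal c \<longleftrightarrow> exp (- c) \<le> s \<and> s \<le> exp c"
proof (cases "0 < s")
  case True
  have "\<bar>ln s\<bar> \<le> c \<longleftrightarrow> - c \<le> ln s \<and> ln s \<le> c" by linarith
  also have "\<dots> \<longleftrightarrow> exp (- c) \<le> s \<and> s \<le> exp c"
    using True by (simp add: ln_ge_iff flip: ln_le_cancel_iff[of s "exp c"])
  finally show ?thesis using True assms by (simp add: abs_ln_def)
next
  case False
  then have "\<not> exp (- c) \<le> s" using exp_gt_zero[of "- c"] by linarith
  then show ?thesis using False by (simp add: abs_ln_def top_unique)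
qed

text \<open>
  The cube of the norm of \<open>ln (d u)\<close> is lower semicontinuous along the approximation, so Fatou's
  lemma carries the bound over to the limit.
\<close>

lemma ln_Linf_norm_cube_integral:
  fixes v :: "nat \<Rightarrow> real \<Rightarrow> real \<Rightarrow> real" and d :: "real \<Rightarrow> real" and u :: "real \<Rightarrow> real \<Rightarrow> real"
  assumes ab: "a < b" and \<tau>: "\<tau> < T"
    and meas: "\<And>t. t \<in> {\<tau><..<T} \<Longrightarrow> (\<lambda>x. l x t) \<in> borel_measurable (lebesgue_on {a<..<b})"
    and vpos: "\<And>k x t. x \<in> {a..b} \<Longrightarrow> t \<in> {\<tau>..T} \<Longrightarrow> 0 < v k x t"
    and conv: "AE t in lebesgue. t \<in> {\<tau><..<T} \<longrightarrow>
      (AE x in lebesgue. x \<in> {a<..<b} \<longrightarrow> (\<lambda>k. v k x t) \<longlonglongrightarrow> l x t)"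
    and est: "\<forall>\<^sub>F k in sequentially. \<exists>N. continuous_on {\<tau>..T} N \<and> integral {\<tau>..T} N \<le> B
      \<and> (\<forall>x\<in>{a..b}. \<forall>t\<in>{\<tau>..T}. \<bar>ln (v k x t)\<bar> ^ 3 \<le> N t)"
  shows "(\<integral>\<^sup>+t\<in>{\<tau><..<T}. ln_Linf_norm {a<..<b} (\<lambda>x. l x t) ^ 3 \<partial>lebesgue) < \<infinity>"
proof -
  let ?M = "lebesgue_on {\<tau><..<T}"
  obtain k0 where "\<And>k. k0 \<le> k \<Longrightarrow> \<exists>N. continuous_on {\<tau>..T} N \<and> integral {\<tau>..T} N \<le> B
      \<and> (\<forall>x\<in>{a..b}. \<forall>t\<in>{\<tau>..T}. \<bar>ln (v k x t)\<bar> ^ 3 \<le> N t)"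
    using est unfolding eventually_sequentially by blast
  then obtain N where N: "\<And>k. k0 \<le> k \<Longrightarrow> continuous_on {\<tau>..T} (N k)"
    "\<And>k. k0 \<le> k \<Longrightarrow> integral {\<tau>..T} (N k) \<le> B"
    "\<And>k x t. k0 \<le> k \<Longrightarrow> x \<in> {a..b} \<Longrightarrow> t \<in> {\<tau>..T} \<Longrightarrow> \<bar>ln (v k x t)\<bar> ^ 3 \<le> N k t" by metis
  have N0: "0 \<le> N k t" if "k0 \<le> k" "t \<in> {\<tau>..T}" for k t
    by (rule order_trans[OF _ N(3)[of k a t]]) (use that ab in auto)
  define \<Lambda> where "\<Lambda> t = liminf (\<lambda>k. ennreal (N (k + k0) t))" for t
  have bound: "ln_Linf_norm {a<..<b} (\<lambda>x. l x t) ^ 3 \<le> \<Lambda> t"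
    if t: "t \<in> {\<tau><..<T}" and ae: "AE x in lebesgue. x \<in> {a<..<b} \<longrightarrow> (\<lambda>k. v k x t) \<longlonglongrightarrow> l x t" for t
  proof (cases "\<Lambda> t")
    case (real q)
    have "abs_ln (l x t) \<le> ennreal (root 3 q)"
      if x: "x \<in> {a<..<b}" and lim: "(\<lambda>k. v k x t) \<longlonglongrightarrow> l x t" for x
    proof -
      have lim': "(\<lambda>k. abs_ln (v (k + k0) x t)) \<longlonglongrightarrow> abs_ln (l x t)"
        by (rule abs_ln_tendsto[OF LIMSEQ_ignore_initial_segment[OF lim]]) (use vpos x t in auto)
      show ?thesis
      proof (rule ccontr)
        assume "\<not> ?thesis"
        then obtain p' where p': "ennreal (root 3 q) < p'" "p' < abs_ln (l x t)" using dense[of "ennreal (root 3 q)"]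
          by (auto simp: not_le)
        then obtain p where p: "p' = ennreal p" "0 \<le> p" by (cases p') auto
        have qp: "q < p ^ 3"
        proof -
          have "root 3 q < p" using p'(1) p \<open>0 \<le> q\<close> by (simp add: ennreal_less_iff)
          then have "root 3 q ^ 3 < p ^ 3" using \<open>0 \<le> q\<close> by (intro power_strict_mono) auto
          then show ?thesis using \<open>0 \<le> q\<close> by (simp add: real_root_pow_pos2)
        qed
        have "\<forall>\<^sub>F k in sequentially. p' < abs_ln (v (k + k0) x t)" by (rule order_tendstoD(1)[OF lim' p'(2)])
        then have "\<forall>\<^sub>F k in sequentially. ennreal (p ^ 3) \<le> ennreal (N (k + k0) t)"
        proof eventually_elim
          case (elim k)
          have "0 < v (k + k0) x t" using vpos x t by simp
          then have "p < \<bar>ln (v (k + k0) x t)\<bar>" using elim p by (simp add: abs_ln_def ennreal_less_iff)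
          then have "p ^ 3 \<le> \<bar>ln (v (k + k0) x t)\<bar> ^ 3" using p by (intro power_mono) auto
          also have "\<dots> \<le> N (k + k0) t" using N(3)[of "k + k0" x t] x t by simp
          finally show ?case by (rule ennreal_leI)
        qed
        then have "ennreal (p ^ 3) \<le> \<Lambda> t" unfolding \<Lambda>_def by (rule Liminf_bounded)
        then have "p ^ 3 \<le> q" using real \<open>0 \<le> q\<close> by (simp add: ennreal_le_iff)
        then show False using qp by simp
      qed
    qed
    then have "AE x in lebesgue_on {a<..<b}. abs_ln (l x t) \<le> ennreal (root 3 q)"
      unfolding AE_lebesgue_on using ae by (auto elim!: eventually_mono)
    moreover have "(\<lambda>x. abs_ln (l x t)) \<in> borel_measurable (lebesgue_on {a<..<b})"
      by (rule measurable_compose[OF meas[OF t] abs_ln_measurable])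
    ultimately have "ln_Linf_norm {a<..<b} (\<lambda>x. l x t) \<le> ennreal (root 3 q)"
      unfolding ln_Linf_norm_def by (intro esssup_I)
    then have "ln_Linf_norm {a<..<b} (\<lambda>x. l x t) ^ 3 \<le> ennreal (root 3 q) ^ 3" by (intro power_mono) auto
    also have "\<dots> = ennreal q" using \<open>0 \<le> q\<close> by (simp add: ennreal_power real_root_pow_pos2)
    finally show ?thesis using real by simp
  qed simp
  have N_meas: "(\<lambda>t. ennreal (N (k + k0) t)) \<in> borel_measurable ?M" for k
    using continuous_measurable_interval[OF N(1)[of "k + k0"]] by simp
  have N_int: "(\<integral>\<^sup>+t. ennreal (N (k + k0) t) \<partial>?M) \<le> ennreal B" for k
    using nn_integral_lebesgue_on_cont[OF N(1)[of "k + k0"] N0] N(2)[of "k + k0"]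
    by (simp add: ennreal_leI)
  have "(\<integral>\<^sup>+t\<in>{\<tau><..<T}. ln_Linf_norm {a<..<b} (\<lambda>x. l x t) ^ 3 \<partial>lebesgue)
      = (\<integral>\<^sup>+t. ln_Linf_norm {a<..<b} (\<lambda>x. l x t) ^ 3 \<partial>?M)" by (rule nn_integral_lebesgue_on)
  also have "\<dots> \<le> (\<integral>\<^sup>+t. \<Lambda> t \<partial>?M)"
  proof (rule nn_integral_mono_AE)
    show "AE t in ?M. ln_Linf_norm {a<..<b} (\<lambda>x. l x t) ^ 3 \<le> \<Lambda> t"
      unfolding AE_lebesgue_on using conv by eventually_elim (use bound in blast)
  qed
  also have "\<dots> \<le> liminf (\<lambda>k. \<integral>\<^sup>+t. ennreal (N (k + k0) t) \<partial>?M)"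
    unfolding \<Lambda>_def by (rule nn_integral_liminf[OF N_meas])
  also have "\<dots> \<le> liminf (\<lambda>k::nat. ennreal B)" by (intro Liminf_mono always_eventually allI N_int)
  also have "\<dots> = ennreal B" by (simp add: Liminf_const)
  also have "\<dots> < \<infinity>" by simp
  finally show ?thesis .
qed

text \<open>
  The limit \<open>l\<close> is known to be measurable slice by slice only. Joint measurability is gained by
  replacing it with the lower limit of the approximations, which agrees with it for almost all
  \<open>t\<close> and is a Borel function of both variables.
\<close>

lemma ln_Linf_norm_measurable:
  fixes v :: "nat \<Rightarrow> real \<Rightarrow> real \<Rightarrow> real" and l :: "real \<Rightarrow> real \<Rightarrow> real"
  assumes meas: "\<And>t. t \<in> {\<tau><..<T} \<Longrightarrow> (\<lambda>x. l x t) \<in> borel_measurable (lebesgue_on {a<..<b})"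
    and vpos: "\<And>k x t. x \<in> {a..b} \<Longrightarrow> t \<in> {\<tau>..T} \<Longrightarrow> 0 < v k x t"
    and vcont: "\<And>k. continuous_on ({a..b} \<times> {\<tau>..T}) (\<lambda>(x, t). v k x t)"
    and conv: "AE t in lebesgue. t \<in> {\<tau><..<T} \<longrightarrow>
      (AE x in lebesgue. x \<in> {a<..<b} \<longrightarrow> (\<lambda>k. v k x t) \<longlonglongrightarrow> l x t)"
  shows "(\<lambda>t. ln_Linf_norm {a<..<b} (\<lambda>x. l x t)) \<in> borel_measurable (restrict_space lebesgue {\<tau><..<T})"
proof -
  define h where "h k z = (if z \<in> {a..b} \<times> {\<tau>..T} then v k (fst z) (snd z) else 0)" for k z
  have hm: "h k \<in> borel_measurable borel" for k
  proof -
    have "continuous_on ({a..b} \<times> {\<tau>..T}) (\<lambda>z. v k (fst z) (snd z))" using vcont[of k] by (simp add: split_beta')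
    then show ?thesis unfolding h_def[abs_def]
      by (intro borel_measurable_continuous_on_if) (auto intro!: borel_closed closed_Times)
  qed
  define G where "G z = liminf (\<lambda>k. abs_ln (h k z))" for z
  have G: "G \<in> borel_measurable borel"
    unfolding G_def[abs_def]
    by (intro borel_measurable_liminf measurable_compose[OF hm abs_ln_measurable])
  define E where "E t = esssup (lebesgue_on {a<..<b}) (\<lambda>x. G (x, t))" for t
  have E: "E \<in> borel_measurable borel" unfolding E_def[abs_def] by (rule esssup_section_measurable[OF G])
  have eq: "ln_Linf_norm {a<..<b} (\<lambda>x. l x t) = E t"
    if t: "t \<in> {\<tau><..<T}" and ae: "AE x in lebesgue. x \<in> {a<..<b} \<longrightarrow> (\<lambda>k. v k x t) \<longlonglongrightarrow> l x t" for t
    unfolding ln_Linf_norm_def E_def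
  proof (rule esssup_AE_cong)
    show "(\<lambda>x. abs_ln (l x t)) \<in> borel_measurable (lebesgue_on {a<..<b})"
      by (rule measurable_compose[OF meas[OF t] abs_ln_measurable])
    have "(\<lambda>x. G (x, t)) \<in> borel_measurable borel"
      by (rule measurable_compose[OF _ G]) (intro borel_measurable_continuous_onI continuous_intros)
    then show "(\<lambda>x. G (x, t)) \<in> borel_measurable (lebesgue_on {a<..<b})"
      by (intro measurable_restrict_space1 measurable_completion) simp
    show "AE x in lebesgue_on {a<..<b}. abs_ln (l x t) = G (x, t)"
      unfolding AE_lebesgue_on using ae
    proof eventually_elim
      case (elim x)
      show ?case
      proof
        assume x: "x \<in> {a<..<b}"
        have "(\<lambda>k. abs_ln (v k x t)) \<longlonglongrightarrow> abs_ln (l x t)"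
          by (rule abs_ln_tendsto) (use elim x t vpos in auto)
        then have "liminf (\<lambda>k. abs_ln (v k x t)) = abs_ln (l x t)" by (rule lim_imp_Liminf[OF sequentially_bot])
        moreover have "h k (x, t) = v k x t" for k using x t by (simp add: h_def)
        ultimately show "abs_ln (l x t) = G (x, t)" by (simp add: G_def)
      qed
    qed
  qed
  have "(\<lambda>t. ln_Linf_norm {a<..<b} (\<lambda>x. l x t) * indicator {\<tau><..<T} t) \<in> borel_measurable lebesgue"
  proof (rule measurable_lebesgue_AE_cong)
    have "(\<lambda>t. E t * indicator {\<tau><..<T} t) \<in> borel_measurable borel" using E by measurable
    then show "(\<lambda>t. E t * indicator {\<tau><..<T} t) \<in> borel_measurable lebesgue"
      by (intro measurable_completion) simp
    show "AE t in lebesgue. ln_Linf_norm {a<..<b} (\<lambda>x. l x t) * indicator {\<tau><..<T} t = E t * indicator {\<tau><..<T} t"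
      using conv by eventually_elim (use eq in \<open>auto simp: indicator_def\<close>)
  qed
  then show ?thesis by (subst borel_measurable_restrict_space_iff_ennreal) auto
qed

theorem theorem1p3:
  fixes a b \<gamma>\<^sub>1 \<gamma>\<^sub>2 :: real
    and d g u0 w0 :: "real \<Rightarrow> real"
    and u w :: "real \<Rightarrow> real \<Rightarrow> real"
  assumes "a < b"
    and "continuous_on {a..b} d" and "\<forall>x\<in>{a..b}. d x \<ge> 0"
    and "Ck_on 1 (pos_set a b d) d"
    and "(\<integral>\<^sup>+x\<in>{a<..<b}. 1 / ennreal (d x) \<partial>lebesgue) < \<infinity>"
    and "Ck_on 2 {0..} g" and "g 0 = 0"
    and "\<gamma>\<^sub>1 > 0" and "\<gamma>\<^sub>2 > 0"
    and "\<forall>s\<ge>0. \<gamma>\<^sub>1 \<le> der_on {0..} g s \<and> der_on {0..} g s \<le> \<gamma>\<^sub>2"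
    and "continuous_on {a..b} u0" and "\<forall>x\<in>{a..b}. u0 x \<ge> 0" and "\<exists>x\<in>{a..b}. u0 x \<noteq> 0"
    and "continuous_on {a..b} w0" and "\<forall>x\<in>{a..b}. w0 x \<ge> 0"
    and "W1p_on 2 {a<..<b} (\<lambda>x. sqrt (w0 x))"
    and "(\<integral>\<^sup>+x\<in>pos_set a b d. ennreal ((der_on {a..b} d x)\<^sup>2 / d x * w0 x) \<partial>lebesgue) < \<infinity>"
    and "set_integrable lebesgue {a<..<b} (\<lambda>x. 1 / d x * ln (1 / d x))"
    and "Linf_on {a<..<b} (\<lambda>x. w0 x / d x)"
    and "constructed_solution a b d g u0 w0 u w"
  shows "(\<forall>T>0. \<forall>\<tau>\<in>{0<..<T}.
            (\<lambda>t. ln_Linf_norm {a<..<b} (\<lambda>x. d x * u x t))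
              \<in> borel_measurable (restrict_space lebesgue {\<tau><..<T})
          \<and> (\<integral>\<^sup>+t\<in>{\<tau><..<T}. ln_Linf_norm {a<..<b} (\<lambda>x. d x * u x t) ^ 3 \<partial>lebesgue) < \<infinity>)
    \<and> (AE t in lebesgue. t > 0 \<longrightarrow> (\<exists>C\<^sub>1>0. \<exists>C\<^sub>2>0. AE x in lebesgue. x \<in> {a<..<b} \<longrightarrow>
          C\<^sub>1 / d x \<le> u x t \<and> u x t \<le> C\<^sub>2 / d x))
    \<and> (\<not> Linf_on {a<..<b} (\<lambda>x. 1 / d x) \<longrightarrow>
          (AE t in lebesgue. t > 0 \<longrightarrow> Linf_norm {a<..<b} (\<lambda>x. u x t) = \<infinity>))"
proof -
  note ab = assms(1) and dc = assms(2) and d0 = assms(3) and int = assms(5)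
  note m_d = continuous_measurable_interval[OF dc]
  obtain dE w0J eps uE wE r wx where ap: "approx_diffusion a b d dE" "approx_w0 a b d w0 w0J" "approx_eps a b dE w0J eps"
    and sol: "\<forall>j. reg_solution a b (dE (eps j)) g (eps j) u0 (w0_reg w0J eps j) (uE j) (wE j)"
    and ureg: "u_regularity a b u" and wreg: "w_regularity a b w wx" and r: "strict_mono r"
    and uconv: "AE z in lebesgue. z \<in> {a<..<b} \<times> {0<..} \<longrightarrow>
            (\<lambda>k. uE (r k) (fst z) (snd z)) \<longlonglongrightarrow> u (fst z) (snd z)"
    and wconv: "\<forall>T>0. uniform_limit ({a..b} \<times> {0..T})
            (\<lambda>k (x, t). wE (r k) x t) (\<lambda>(x, t). w x t) sequentially"
    using assms(20) unfolding constructed_solution_def by blast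
  have ej: "0 < eps j" "eps j < 1" for j using ap(3) by (auto simp: approx_eps_def)
  note f = approx_diffusion_facts[OF ab dc ap(1) ej]
  define v where "v k x t = dE (eps (r k)) x * uE (r k) x t" for k x t
  define L where "L t = ln_Linf_norm {a<..<b} (\<lambda>x. d x * u x t)" for t
  have dconv: "(\<lambda>k. dE (eps (r k)) x) \<longlonglongrightarrow> d x" if x: "x \<in> {a..b}" for x
  proof (rule tendstoI)
    fix \<rho> :: real assume \<rho>: "0 < \<rho>"
    have "(\<lambda>k. eps (r k)) \<longlonglongrightarrow> 0"
      using LIMSEQ_subseq_LIMSEQ[of eps 0 r] ap(3) r by (simp add: approx_eps_def o_def)
    then have "filterlim (\<lambda>k. eps (r k)) (at_right 0) sequentially"
      using ej less_imp_neq[OF ej(1), symmetric] by (simp add: filterlim_at)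
    moreover have "\<forall>\<^sub>F \<epsilon> in at_right 0. \<forall>x\<in>{a..b}. \<bar>dE \<epsilon> x - d x\<bar> \<le> \<rho> / 2"
      by (rule approx_diffusion_uniform[OF ab dc ap(1)]) (use \<rho> in simp)
    ultimately have "\<forall>\<^sub>F k in sequentially. \<forall>x\<in>{a..b}. \<bar>dE (eps (r k)) x - d x\<bar> \<le> \<rho> / 2"
      by (rule eventually_compose_filterlim[rotated])
    then show "\<forall>\<^sub>F k in sequentially. dist (dE (eps (r k)) x) (d x) < \<rho>"
    proof eventually_elim
      case (elim k)
      then have "\<bar>dE (eps (r k)) x - d x\<bar> \<le> \<rho> / 2" using x by blast
      then show ?case using \<rho> by (simp add: dist_real_def)
    qed
  qed
  have conv: "AE t in lebesgue. t > 0 \<longrightarrow> (AE x in lebesgue. x \<in> {a<..<b} \<longrightarrow> (\<lambda>k. v k x t) \<longlonglongrightarrow> d x * u x t)"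
    using AE_lebesgue_sections[OF uconv]
  proof eventually_elim
    case (elim t)
    show ?case
    proof
      assume t: "t > 0"
      show "AE x in lebesgue. x \<in> {a<..<b} \<longrightarrow> (\<lambda>k. v k x t) \<longlonglongrightarrow> d x * u x t"
        using elim
      proof eventually_elim
        case (elim x)
        then show ?case using t dconv[of x] by (auto simp: v_def intro!: tendsto_mult)
      qed
    qed
  qed
  have u_meas: "(\<lambda>x. u x t) \<in> borel_measurable (lebesgue_on {a<..<b})" if "0 \<le> t" for t
  proof -
    have "set_integrable lebesgue {a<..<b} (\<lambda>x. u x t)" using ureg that by (simp add: u_regularity_def)
    then have "integrable (lebesgue_on {a<..<b}) (\<lambda>x. u x t)"
      unfolding set_integrable_def by (subst integrable_restrict_space) auto
    then show ?thesis by (rule borel_measurable_integrable)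
  qed
  have l_meas: "(\<lambda>x. d x * u x t) \<in> borel_measurable (lebesgue_on {a<..<b})" if "0 \<le> t" for t
    using m_d u_meas[OF that] by (rule borel_measurable_times)
  have vpos: "0 < v k x t" if "x \<in> {a..b}" "0 < t" for k x t
    using f(4)[OF that(1)] sol that unfolding v_def reg_solution_def by (intro mult_pos_pos) auto
  have part1: "L \<in> borel_measurable (restrict_space lebesgue {\<tau><..<T})
      \<and> (\<integral>\<^sup>+t\<in>{\<tau><..<T}. L t ^ 3 \<partial>lebesgue) < \<infinity>" if \<tau>: "0 < \<tau>" "\<tau> < T" for \<tau> T
  proof
    have conv': "AE t in lebesgue. t \<in> {\<tau><..<T} \<longrightarrow>
      (AE x in lebesgue. x \<in> {a<..<b} \<longrightarrow> (\<lambda>k. v k x t) \<longlonglongrightarrow> d x * u x t)"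
      using conv by eventually_elim (use \<tau> in auto)
    have wc: "continuous_on ({a..b} \<times> {0..}) (\<lambda>(x, t). w x t)" using wreg by (simp add: w_regularity_def)
    obtain B where B: "\<forall>\<^sub>F k in sequentially. \<exists>N. continuous_on {\<tau>..T} N \<and> integral {\<tau>..T} N \<le> B
      \<and> (\<forall>x\<in>{a..b}. \<forall>t\<in>{\<tau>..T}. \<bar>ln (dE (eps (r k)) x * uE (r k) x t)\<bar> ^ 3 \<le> N t)"
      by (rule regularized_estimate[OF ab dc d0 int assms(6-10) assms(11-13) assms(19) ap sol r wc wconv \<tau>]) (rule that)
    show "(\<integral>\<^sup>+t\<in>{\<tau><..<T}. L t ^ 3 \<partial>lebesgue) < \<infinity>" unfolding L_def
      by (rule ln_Linf_norm_cube_integral[OF ab \<tau>(2) l_meas vpos conv' B[folded v_def]]) (use \<tau> in auto)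
    show "L \<in> borel_measurable (restrict_space lebesgue {\<tau><..<T})" unfolding L_def
    proof (rule ln_Linf_norm_measurable[OF l_meas vpos _ conv'])
      show "continuous_on ({a..b} \<times> {\<tau>..T}) (\<lambda>(x, t). v k x t)" for k
      proof -
        have "continuous_on ({a..b} \<times> {0..}) (\<lambda>(x, t). uE (r k) x t)" using sol by (simp add: reg_solution_def)
        then have "continuous_on ({a..b} \<times> {\<tau>..T}) (\<lambda>(x, t). uE (r k) x t)"
          by (rule continuous_on_subset) (use \<tau> in auto)
        moreover have "continuous_on ({a..b} \<times> {\<tau>..T}) (\<lambda>z. dE (eps (r k)) (fst z))"
          by (rule continuous_on_compose2[OF f(2)]) (auto intro!: continuous_intros)
        ultimately show ?thesis unfolding v_def split_beta' by (intro continuous_intros)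
      qed
    qed (use \<tau> in auto)
  qed
  \<comment> \<open>the intervals \<open>(1 / (n + 2), n + 2)\<close> exhaust \<open>(0, \<infinity>)\<close>; the shift keeps the end points in order\<close>
  have fin: "AE t in lebesgue. t > 0 \<longrightarrow> L t < \<infinity>"
  proof -
    have "AE t in lebesgue. t \<in> {1 / real (n + 2)<..<real (n + 2)} \<longrightarrow> L t \<noteq> \<infinity>" for n
    proof -
      let ?\<tau> = "1 / real (n + 2)" and ?T = "real (n + 2)"
      have "?\<tau> < 1" by simp
      also have "\<dots> < ?T" by simp
      finally have \<tau>: "0 < ?\<tau>" "?\<tau> < ?T" by simp_all
      have m: "(\<lambda>t. L t ^ 3) \<in> borel_measurable (lebesgue_on {?\<tau><..<?T})"
        using part1[OF \<tau>] unfolding power3_eq_cube by (intro borel_measurable_times_ennreal) blast+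
      have "AE t in lebesgue_on {?\<tau><..<?T}. L t ^ 3 \<noteq> \<infinity>"
      proof (rule nn_integral_PInf_AE[OF m])
        show "(\<integral>\<^sup>+t. L t ^ 3 \<partial>lebesgue_on {?\<tau><..<?T}) \<noteq> \<infinity>"
          using conjunct2[OF part1[OF \<tau>]] unfolding nn_integral_lebesgue_on by (rule less_imp_neq)
      qed
      then have "AE t in lebesgue_on {?\<tau><..<?T}. L t \<noteq> \<infinity>" by eventually_elim auto
      then show ?thesis by (simp only: AE_lebesgue_on)
    qed
    then have "AE t in lebesgue. \<forall>n. t \<in> {1 / real (n + 2)<..<real (n + 2)} \<longrightarrow> L t \<noteq> \<infinity>"
      unfolding AE_all_countable by blast
    then show ?thesis
    proof eventually_elim
      case (elim t)
      show ?case
      proof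
        assume t: "t > 0"
        obtain n where n: "max t (1 / t) < real n" using reals_Archimedean2 by blast
        then have "t < real (n + 2)" by simp
        moreover have "1 / real (n + 2) < t"
        proof -
          have "1 / t < real (n + 2)" using n by simp
          then show ?thesis using t by (simp add: field_simps)
        qed
        ultimately have "t \<in> {1 / real (n + 2)<..<real (n + 2)}" by (simp only: greaterThanLessThan_iff)
        then show "L t < \<infinity>" using elim by (auto simp: less_top)
      qed
    qed
  qed
  have dpos: "AE x in lebesgue. x \<in> {a<..<b} \<longrightarrow> 0 < d x" by (rule AE_pos_of_integral_inverse[OF ab dc d0 int])
  have two_sided: "\<exists>C\<^sub>1>0. \<exists>C\<^sub>2>0. AE x in lebesgue. x \<in> {a<..<b} \<longrightarrow> C\<^sub>1 / d x \<le> u x t \<and> u x t \<le> C\<^sub>2 / d x"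
    if Lt: "L t < \<infinity>" for t
  proof -
    obtain c where c: "L t = ennreal c" "0 \<le> c" using Lt by (cases "L t") auto
    have "AE x in lebesgue_on {a<..<b}. abs_ln (d x * u x t) \<le> L t"
      unfolding L_def ln_Linf_norm_def by (rule esssup_AE)
    then have ae: "AE x in lebesgue. x \<in> {a<..<b} \<longrightarrow> abs_ln (d x * u x t) \<le> ennreal c"
      by (simp add: AE_lebesgue_on c)
    have "AE x in lebesgue. x \<in> {a<..<b} \<longrightarrow> exp (- c) / d x \<le> u x t \<and> u x t \<le> exp c / d x"
      using ae dpos
    proof eventually_elim
      case (elim x)
      then show ?case by (auto simp: abs_ln_le_iff[OF c(2)] field_simps)
    qed
    then show ?thesis by (meson exp_gt_zero)
  qed
  have part2: "AE t in lebesgue. t > 0 \<longrightarrow> (\<exists>C\<^sub>1>0. \<exists>C\<^sub>2>0. AE x in lebesgue. x \<in> {a<..<b} \<longrightarrow>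
          C\<^sub>1 / d x \<le> u x t \<and> u x t \<le> C\<^sub>2 / d x)"
    using fin by eventually_elim (use two_sided in blast)
  have part3: "AE t in lebesgue. t > 0 \<longrightarrow> Linf_norm {a<..<b} (\<lambda>x. u x t) = \<infinity>"
    if notb: "\<not> Linf_on {a<..<b} (\<lambda>x. 1 / d x)"
    using part2
  proof eventually_elim
    case (elim t)
    show ?case
    proof (intro impI, rule ccontr)
      assume t: "t > 0" and "Linf_norm {a<..<b} (\<lambda>x. u x t) \<noteq> \<infinity>"
      then obtain c where c: "Linf_norm {a<..<b} (\<lambda>x. u x t) = ennreal c" "0 \<le> c"
        by (cases "Linf_norm {a<..<b} (\<lambda>x. u x t)") auto
      obtain C C' where "0 < C" and CC': "AE x in lebesgue. x \<in> {a<..<b} \<longrightarrow> C / d x \<le> u x t \<and> u x t \<le> C' / d x"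
        using elim t by blast
      then have C: "0 < C" "AE x in lebesgue. x \<in> {a<..<b} \<longrightarrow> C / d x \<le> u x t"
        by (simp, intro eventually_mono[OF CC'] impI) blast
      have m: "(\<lambda>x. 1 / d x) \<in> borel_measurable (lebesgue_on {a<..<b})" using m_d by measurable
      have "Linf_norm {a<..<b} (\<lambda>x. 1 / d x) \<le> ennreal (c / C)"
        unfolding Linf_norm_def
      proof (rule esssup_I)
        show "(\<lambda>x. ennreal \<bar>1 / d x\<bar>) \<in> borel_measurable (lebesgue_on {a<..<b})" using m by measurable
        show "AE x in lebesgue_on {a<..<b}. ennreal \<bar>1 / d x\<bar> \<le> ennreal (c / C)"
          unfolding AE_lebesgue_on using C(2) dpos Linf_norm_AE[of a b "\<lambda>x. u x t"]
        proof eventually_elim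
          case (elim x)
          show ?case
          proof
            assume x: "x \<in> {a<..<b}"
            have "\<bar>u x t\<bar> \<le> c" using elim x c by simp
            then have "C / d x \<le> c" using elim(1) x by linarith
            then have "1 / d x \<le> c / C" using C(1) elim(2) x by (simp add: field_simps)
            then show "ennreal \<bar>1 / d x\<bar> \<le> ennreal (c / C)" using elim(2) x by (intro ennreal_leI) simp
          qed
        qed
      qed
      also have "\<dots> < \<infinity>" by simp
      finally have "Linf_norm {a<..<b} (\<lambda>x. 1 / d x) < \<infinity>" .
      moreover have "set_borel_measurable lebesgue {a<..<b} (\<lambda>x. 1 / d x)"
        using m unfolding set_borel_measurable_def by (subst (asm) borel_measurable_restrict_space_iff) auto
      ultimately show False using notb by (simp add: Linf_on_def)
    qed
  qed
  have "\<forall>T>0. \<forall>\<tau>\<in>{0<..<T}. L \<in> borel_measurable (restrict_space lebesgue {\<tau><..<T})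
      \<and> (\<integral>\<^sup>+t\<in>{\<tau><..<T}. L t ^ 3 \<partial>lebesgue) < \<infinity>"
    using part1 by simp
  from this[unfolded L_def[abs_def]] show ?thesis by (intro conjI part2 impI part3)
qed

end
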